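(* Let $B=\bigoplus_{i\in\mathbb{Z}}B_i$ be a $\mathbb{Z}$-graded integral domain which is finitely generated as an algebra over a field of characteristic zero, and assume that $B$ satisfies at least one of: (i) the transcendence degree of $\operatorname{Frac}(B)$ over $\operatorname{Frac}(B_0)$ is at least $2$; (ii) there exist integers $i<0<j$ with $B_i\neq 0$ and $B_j\neq 0$. Then: (1) The following are equivalent: (a) there exists $d\ge 1$ such that $B^{(d)}=\bigoplus_{i\in\mathbb{Z}}B_{id}$ is non-rigid; (b) $B$ has a cylindrical element. (2) If moreover $B$ is normal and saturated in codimension $1$, then (a) and (b) are also equivalent to: (c) $B$ is non-rigid.
   Context: All rings are commutative with $1$. A derivation $D:B\to B$ is locally nilpotent if for every $b\in B$ there is $n>0$ with $D^n(b)=0$. A ring $B$ is rigid if its only locally nilpotent derivation is $0$ (for graded rings this concerns all, not necessarily homogeneous, derivations). For a nonzero homogeneous $f\in B$, $B_{(f)}$ denotes the degree-$0$ subring of the graded ring $B_f=S^{-1}B$, $S=\{1,f,f^2,\dots\}$. A ring $C$ is a polynomial ring in one variable if there is a subring $A\subseteq C$ such that $C$ is a polynomial ring in one variable over $A$ (the zero ring counts). An element $f$ of the $\mathbb{Z}$-graded domain $B$ is cylindrical if it is nonzero, homogeneous of nonzero degree, and $B_{(f)}$ is a polynomial ring in one variable. For a $\mathbb{Z}$-graded domain $C$, the saturation index is $e(C)=\gcd\{i\in\mathbb{Z}: C_i\neq 0\}$. $B$ is saturated in codimension $1$ if $e(B/\mathfrak{p})=e(B)$ for every homogeneous prime ideal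 $\mathfrak{p}$ of $B$ of height $1$ (with the induced grading on $B/\mathfrak{p}$). *)

theory Defs
  imports "HOL-Computational_Algebra.Fraction_Field" "HOL-Computational_Algebra.Polynomial"
begin

definition is_subring :: "'a::comm_ring_1 set \<Rightarrow> bool" where
  "is_subring A \<longleftrightarrow> 0 \<in> A \<and> 1 \<in> A \<and>
     (\<forall>x\<in>A. \<forall>y\<in>A. x + y \<in> A \<and> x * y \<in> A) \<and> (\<forall>x\<in>A. - x \<in> A)"

definition is_subfield :: "'a::comm_ring_1 set \<Rightarrow> bool" where
  "is_subfield K \<longleftrightarrow> is_subring K \<and> (\<forall>x\<in>K. x \<noteq> 0 \<longrightarrow> (\<exists>y\<in>K. x * y = 1))"

inductive_set ring_gen :: "'a::comm_ring_1 set \<Rightarrow> 'a set" for S where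
  gen: "x \<in> S \<Longrightarrow> x \<in> ring_gen S"
| zero: "0 \<in> ring_gen S"
| one: "1 \<in> ring_gen S"
| add: "x \<in> ring_gen S \<Longrightarrow> y \<in> ring_gen S \<Longrightarrow> x + y \<in> ring_gen S"
| mult: "x \<in> ring_gen S \<Longrightarrow> y \<in> ring_gen S \<Longrightarrow> x * y \<in> ring_gen S"
| neg: "x \<in> ring_gen S \<Longrightarrow> - x \<in> ring_gen S"

(* B (the whole type) is a finitely generated algebra over a field of char. 0;
   the field is identified with its (injective) image K in the domain B *)
definition fg_algebra_over_char0_field :: "'b::idom itself \<Rightarrow> bool" where
  "fg_algebra_over_char0_field _ \<longleftrightarrow>
     (\<exists>K::'b set. is_subfield K \<and> (\<forall>n::nat. n > 0 \<longrightarrow> (of_nat n :: 'b) \<noteq> 0) \<and>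
        (\<exists>S. finite S \<and> ring_gen (K \<union> S) = UNIV))"

definition is_ideal :: "'a::comm_ring_1 set \<Rightarrow> bool" where
  "is_ideal I \<longleftrightarrow> 0 \<in> I \<and> (\<forall>x\<in>I. \<forall>y\<in>I. x + y \<in> I) \<and> (\<forall>x\<in>I. \<forall>b. b * x \<in> I)"

definition is_prime_ideal :: "'a::comm_ring_1 set \<Rightarrow> bool" where
  "is_prime_ideal P \<longleftrightarrow> is_ideal P \<and> P \<noteq> UNIV \<and> (\<forall>a b. a * b \<in> P \<longrightarrow> a \<in> P \<or> b \<in> P)"

definition height_one :: "'a::idom set \<Rightarrow> bool" where
  "height_one P \<longleftrightarrow> is_prime_ideal P \<and> P \<noteq> {0} \<and>
     \<not> (\<exists>Q. is_prime_ideal Q \<and> {0} \<subset> Q \<and> Q \<subset> P)"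

definition normal_domain :: "'b::idom itself \<Rightarrow> bool" where
  "normal_domain _ \<longleftrightarrow>
     (\<forall>x::'b fract. (\<exists>p::'b poly. lead_coeff p = 1 \<and>
         poly (map_poly (\<lambda>a. Fraction_Field.Fract a 1) p) x = 0) \<longrightarrow> (\<exists>b. x = Fraction_Field.Fract b 1))"

definition graded_decomp :: "(int \<Rightarrow> 'a::comm_ring_1 set) \<Rightarrow> 'a \<Rightarrow> (int \<Rightarrow> 'a) \<Rightarrow> bool" where
  "graded_decomp G b f \<longleftrightarrow> finite {i. f i \<noteq> 0} \<and> (\<forall>i. f i \<in> G i) \<and> b = sum f {i. f i \<noteq> 0}"

definition grading :: "(int \<Rightarrow> 'a::comm_ring_1 set) \<Rightarrow> bool" where
  "grading G \<longleftrightarrow>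
     (\<forall>i. 0 \<in> G i \<and> (\<forall>x\<in>G i. \<forall>y\<in>G i. x + y \<in> G i) \<and> (\<forall>x\<in>G i. - x \<in> G i)) \<and>
     (\<forall>i j. \<forall>x\<in>G i. \<forall>y\<in>G j. x * y \<in> G (i + j)) \<and>
     (\<forall>b. \<exists>!f. graded_decomp G b f)"

definition hcomp :: "(int \<Rightarrow> 'a::comm_ring_1 set) \<Rightarrow> 'a \<Rightarrow> int \<Rightarrow> 'a" where
  "hcomp G b = (THE f. graded_decomp G b f)"

definition veronese :: "(int \<Rightarrow> 'a::comm_ring_1 set) \<Rightarrow> nat \<Rightarrow> 'a set" where
  "veronese G d = {b. \<forall>i. hcomp G b i \<noteq> 0 \<longrightarrow> int d dvd i}"

definition lnd_on :: "'a::comm_ring_1 set \<Rightarrow> ('a \<Rightarrow> 'a) \<Rightarrow> bool" where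
  "lnd_on S D \<longleftrightarrow> (\<forall>x\<in>S. D x \<in> S) \<and>
     (\<forall>x\<in>S. \<forall>y\<in>S. D (x + y) = D x + D y \<and> D (x * y) = x * D y + y * D x) \<and>
     (\<forall>x\<in>S. \<exists>n>0. (D ^^ n) x = 0)"

definition rigid :: "'a::comm_ring_1 set \<Rightarrow> bool" where
  "rigid S \<longleftrightarrow> (\<forall>D. lnd_on S D \<longrightarrow> (\<forall>x\<in>S. D x = 0))"

definition poly_ring_one_var :: "'a::comm_ring_1 set \<Rightarrow> bool" where
  "poly_ring_one_var C \<longleftrightarrow> (\<exists>A t. is_subring A \<and> A \<subseteq> C \<and> t \<in> C \<and>
     (\<forall>p. (\<forall>i. coeff p i \<in> A) \<longrightarrow> poly p t \<in> C) \<and>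
     (\<forall>c\<in>C. \<exists>p. (\<forall>i. coeff p i \<in> A) \<and> c = poly p t) \<and>
     (\<forall>p. (\<forall>i. coeff p i \<in> A) \<and> poly p t = 0 \<longrightarrow> p = 0))"

(* B_(f), f homogeneous of degree e, realised inside Frac(B):
   degree-0 elements of B_f are exactly b / f^n with b \<in> B_{n e} *)
definition loc_deg0 :: "(int \<Rightarrow> 'b::idom set) \<Rightarrow> 'b \<Rightarrow> int \<Rightarrow> 'b fract set" where
  "loc_deg0 G f e = {Fraction_Field.Fract b (f ^ n) | b n. b \<in> G (int n * e)}"

definition cylindrical :: "(int \<Rightarrow> 'b::idom set) \<Rightarrow> 'b \<Rightarrow> bool" where
  "cylindrical G f \<longleftrightarrow> f \<noteq> 0 \<and> (\<exists>e. e \<noteq> 0 \<and> f \<in> G e \<and> poly_ring_one_var (loc_deg0 G f e))"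

definition alg_indep2 :: "'a::field set \<Rightarrow> 'a \<Rightarrow> 'a \<Rightarrow> bool" where
  "alg_indep2 F u v \<longleftrightarrow> (\<forall>n c. (\<forall>i<n. \<forall>j<n. c i j \<in> F) \<and>
      (\<Sum>i<n. \<Sum>j<n. c i j * u ^ i * v ^ j) = 0 \<longrightarrow> (\<forall>i<n. \<forall>j<n. c i j = 0))"

definition frac_deg0 :: "(int \<Rightarrow> 'b::idom set) \<Rightarrow> 'b fract set" where
  "frac_deg0 G = {Fraction_Field.Fract a b | a b. a \<in> G 0 \<and> b \<in> G 0 \<and> b \<noteq> 0}"

definition trdeg_ge2 :: "(int \<Rightarrow> 'b::idom set) \<Rightarrow> bool" where
  "trdeg_ge2 G \<longleftrightarrow> (\<exists>u v :: 'b fract. alg_indep2 (frac_deg0 G) u v)"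

definition homogeneous_ideal :: "(int \<Rightarrow> 'a::comm_ring_1 set) \<Rightarrow> 'a set \<Rightarrow> bool" where
  "homogeneous_ideal G P \<longleftrightarrow> is_ideal P \<and> (\<forall>x\<in>P. \<forall>i. hcomp G x i \<in> P)"

definition sat_index :: "(int \<Rightarrow> 'a::comm_ring_1 set) \<Rightarrow> int" where
  "sat_index G = Gcd {i. G i \<noteq> {0}}"

(* e(B/P) for the induced grading: (B/P)_i = image of B_i, nonzero iff B_i \<not>\<subseteq> P *)
definition sat_index_quot :: "(int \<Rightarrow> 'a::comm_ring_1 set) \<Rightarrow> 'a set \<Rightarrow> int" where
  "sat_index_quot G P = Gcd {i. \<not> G i \<subseteq> P}"

definition saturated_codim1 :: "(int \<Rightarrow> 'a::idom set) \<Rightarrow> bool" where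
  "saturated_codim1 G \<longleftrightarrow> (\<forall>P. homogeneous_ideal G P \<and> is_prime_ideal P \<and> height_one P
       \<longrightarrow> sat_index_quot G P = sat_index G)"

end

theory Submission
  imports Defs "HOL-Library.FuncSet" "HOL-Computational_Algebra.Polynomial_Factorial"
begin

text \<open>
  A nonzero locally nilpotent derivation of a Veronese subring R of B may be replaced by its top
  homogeneous part D. If s is a homogeneous local slice of D, so that D s is a nonzero kernel
  element, then R[1/f] is a polynomial ring in s over the localized kernel for every homogeneous f in
  the kernel divisible by D s. When f has nonzero degree and contains enough factors to provide a
  unit u of the degree of some minimal power s^k, the degree-0 part is a polynomial ring in s^k / u.
  A kernel element of nonzero degree exists: otherwise each graded piece of B is a line over
  Frac(B_0), contradicting (i); under (ii) a suitable product of powers of elements of negative and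
  positive degree has degree 0, so either it lies in the kernel, and then so do its factors since
  kernels are factorially closed, or D has degree 0 and B = B_0. Conversely, d/dt on B_(f),
  extended by f \<mapsto> 0 and multiplied by a large power of f, preserves the Veronese subring of
  order |deg f|.

  For the second part D extends to Frac(B), and it maps B to B if this holds at all homogeneous primes
  P of height one, by normality. There saturation provides a homogeneous u outside P such that
  u x lies in R, and the value at x is determined by the values at u x and u^d.
\<close>

section \<open>Graded rings and Veronese subrings\<close>

text \<open>Two steps need a uniform bound, and both take it from the finite generation of the
  Veronese subring over the ground field: a top part exists only if the degree shifts of the
  derivation are bounded above, and a single power of f must clear the denominators of d/dt at every
  element. The ground field does not disturb these bounds: its nonzero elements are units, so they
  lie in degree 0 and are killed by every locally nilpotent derivation.

  The lines over Frac(B_0) arise as follows. If all nonzero homogeneous kernel elements have degree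
  0, then so does the last nonzero derivative of a homogeneous x, that is, deg x + N * dg x = 0,
  where N is the degree of D. Hence nonzero elements of the same nonzero degree have the same
  D-degree. A kernel combination of two of them that cancels the last nonzero derivatives would have
  smaller D-degree, so it is 0.

  D is known only on R, while the claims concern B. Products with d factors, such as x^d or x * y^(d
  - 1), carry elements of B into R, and the extra factor is cancelled afterwards.\<close>

locale graded_ring =
  fixes G :: "int \<Rightarrow> 'a::comm_ring_1 set"
  assumes grading: "grading G"
begin

lemma zero_in [simp]: "0 \<in> G i"
  and add_in: "x \<in> G i \<Longrightarrow> y \<in> G i \<Longrightarrow> x + y \<in> G i"
  and uminus_in: "x \<in> G i \<Longrightarrow> - x \<in> G i"
  and mult_in: "x \<in> G i \<Longrightarrow> y \<in> G j \<Longrightarrow> x * y \<in> G (i + j)"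
  using grading unfolding grading_def by blast+

lemma diff_in: "x \<in> G i \<Longrightarrow> y \<in> G i \<Longrightarrow> x - y \<in> G i"
  using add_in[of x i "- y"] uminus_in by simp

abbreviation "hc \<equiv> hcomp G"

definition supp :: "'a \<Rightarrow> int set" where "supp b = {i. hc b i \<noteq> 0}"

lemma hcomp_decomp: "graded_decomp G b (hc b)"
proof -
  have "\<exists>!f. graded_decomp G b f" using grading unfolding grading_def by blast
  then show ?thesis unfolding hcomp_def by (rule theI')
qed

lemma hcomp_in [simp]: "hc b i \<in> G i"
  and finite_supp [simp]: "finite (supp b)"
  and sum_supp: "sum (hc b) (supp b) = b"
  using hcomp_decomp[of b] by (auto simp: graded_decomp_def supp_def)

lemma in_supp_iff: "i \<in> supp b \<longleftrightarrow> hc b i \<noteq> 0"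
  by (simp add: supp_def)

lemma sum_hcomp:
  assumes "finite I" "supp b \<subseteq> I"
  shows "sum (hc b) I = b"
  using sum.mono_neutral_right[OF assms, of "hc b"] sum_supp[of b] by (auto simp: supp_def)

lemma hcomp_unique:
  assumes "finite I" "\<And>i. i \<in> I \<Longrightarrow> f i \<in> G i" "\<And>i. i \<notin> I \<Longrightarrow> f i = 0" "b = sum f I"
  shows "hc b = f"
proof -
  have "{i. f i \<noteq> 0} \<subseteq> I" using assms(3) by auto
  then have "sum f {i. f i \<noteq> 0} = sum f I"
    by (intro sum.mono_neutral_left) (use assms in auto)
  moreover have "f i \<in> G i" for i using assms(2,3)[of i] by (cases "i \<in> I") auto
  ultimately have "graded_decomp G b f"
    using assms \<open>{i. f i \<noteq> 0} \<subseteq> I\<close> by (auto simp: graded_decomp_def intro: finite_subset)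
  then show ?thesis
    using grading hcomp_decomp[of b] unfolding grading_def by blast
qed

lemma hcomp_of_homogeneous:
  assumes "x \<in> G i"
  shows "hc x j = (if j = i then x else 0)"
  using hcomp_unique[of "{i}" "\<lambda>j. if j = i then x else 0" x] assms by auto

lemma supp_homogeneous: "x \<in> G i \<Longrightarrow> supp x \<subseteq> {i}"
  by (auto simp: supp_def hcomp_of_homogeneous split: if_splits)

lemma homogeneous_degree_unique: "x \<in> G i \<Longrightarrow> x \<in> G j \<Longrightarrow> x \<noteq> 0 \<Longrightarrow> i = j"
  using hcomp_of_homogeneous by metis

lemma hcomp_0 [simp]: "hc 0 i = 0"
  using hcomp_of_homogeneous[of 0 0 i] by simp

lemma hcomp_hcomp: "hc (hc x i) j = (if j = i then hc x i else 0)"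
  by (simp add: hcomp_of_homogeneous[OF hcomp_in])

lemma hcomp_add: "hc (x + y) i = hc x i + hc y i"
proof -
  have "hc (x + y) = (\<lambda>i. hc x i + hc y i)"
    by (rule hcomp_unique[of "supp x \<union> supp y"])
       (auto simp: sum.distrib sum_hcomp in_supp_iff intro: add_in)
  then show ?thesis by simp
qed

lemma hcomp_sum: "hc (sum f I) i = (\<Sum>x\<in>I. hc (f x) i)"
  by (induction I rule: infinite_finite_induct) (auto simp: hcomp_add)

lemma hcomp_uminus: "hc (- x) i = - hc x i"
  using hcomp_add[of x "-x" i] by (simp add: eq_neg_iff_add_eq_0 add.commute)

lemma hcomp_mult_left:
  assumes "x \<in> G i"
  shows "hc (x * y) j = x * hc y (j - i)"
proof -
  have "hc (x * y) = (\<lambda>j. x * hc y (j - i))"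
  proof (rule hcomp_unique[of "(\<lambda>j. j + i) ` supp y"])
    show "x * hc y (j - i) = 0" if "j \<notin> (\<lambda>j. j + i) ` supp y" for j
      using that by (auto simp: supp_def image_iff dest: spec[of _ "j - i"])
    have "(\<Sum>j\<in>(\<lambda>j. j + i) ` supp y. x * hc y (j - i)) = (\<Sum>j\<in>supp y. x * hc y j)"
      by (subst sum.reindex) (auto simp: inj_on_def)
    then show "x * y = (\<Sum>j\<in>(\<lambda>j. j + i) ` supp y. x * hc y (j - i))"
      by (simp add: sum_distrib_left[symmetric] sum_supp)
  qed (use mult_in[OF assms hcomp_in] in auto, metis add.commute diff_add_cancel)
  then show ?thesis by simp
qed

lemma hcomp_mult_right: "y \<in> G i \<Longrightarrow> hc (x * y) j = hc x (j - i) * y"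
  using hcomp_mult_left[of y i x j] by (simp add: mult.commute)

lemma hcomp_mult: "hc (x * y) k = (\<Sum>i\<in>supp x. hc x i * hc y (k - i))"
proof -
  have "x * y = (\<Sum>i\<in>supp x. hc x i * y)"
    by (simp add: sum_distrib_right[symmetric] sum_supp)
  then show ?thesis by (simp add: hcomp_sum hcomp_mult_left[OF hcomp_in])
qed

lemma homogeneous_induct:
  assumes "\<And>i. P (hc b i)" "P 0" "\<And>x y. P x \<Longrightarrow> P y \<Longrightarrow> P (x + y)"
  shows "P b"
proof -
  have "P (sum (hc b) I)" for I
    by (induction I rule: infinite_finite_induct) (auto intro: assms)
  then show ?thesis using sum_supp[of b] by metis
qed

text \<open>Comparing components of degree i in x = x * 1 shows that the degree-0 component
  \<open>u\<close> of 1 acts as the identity on every homogeneous x. Summing over the components of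
  1 gives 1 * \<open>u\<close> = 1.\<close>

lemma one_in [simp]: "1 \<in> G 0"
proof -
  define u where "u = hc 1 0"
  have *: "x = x * u" if "x \<in> G i" for x i
    using hcomp_mult_left[OF that, of 1 i] hcomp_of_homogeneous[OF that, of i] by (simp add: u_def)
  have "(\<Sum>i\<in>supp 1. hc 1 i * u) = sum (hc 1) (supp 1)"
    by (rule sum.cong) (use *[OF hcomp_in, symmetric] in auto)
  then have "1 * u = 1" by (simp only: sum_distrib_right[symmetric] sum_supp)
  then show ?thesis using hcomp_in[of 1 0] by (simp add: u_def)
qed

lemma power_in: "x \<in> G i \<Longrightarrow> x ^ n \<in> G (int n * i)"
  by (induction n) (auto simp: algebra_simps dest: mult_in[of x i])

lemma of_nat_in: "of_nat n \<in> G 0"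
  by (induction n) (auto intro: add_in)

lemma prod_in: "(\<And>x. x \<in> I \<Longrightarrow> f x \<in> G (k x)) \<Longrightarrow> prod f I \<in> G (sum k I)"
  by (induction I rule: infinite_finite_induct) (auto intro: mult_in)

abbreviation "V \<equiv> veronese G"

lemma veronese_homogeneous: "x \<in> G i \<Longrightarrow> int d dvd i \<Longrightarrow> x \<in> V d"
  by (auto simp: veronese_def hcomp_of_homogeneous split: if_splits)

lemma homogeneous_veroneseD: "x \<in> V d \<Longrightarrow> x \<in> G i \<Longrightarrow> x \<noteq> 0 \<Longrightarrow> int d dvd i"
  unfolding veronese_def using hcomp_of_homogeneous[of x i i] by auto

lemma hcomp_veronese: "x \<in> V d \<Longrightarrow> hc x i \<in> V d"
  by (auto simp: veronese_def hcomp_hcomp split: if_splits)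

lemma veronese_hcomp_eq_0: "x \<in> V d \<Longrightarrow> \<not> int d dvd i \<Longrightarrow> hc x i = 0"
  by (auto simp: veronese_def)

lemma veronese_add: "x \<in> V d \<Longrightarrow> y \<in> V d \<Longrightarrow> x + y \<in> V d"
  unfolding veronese_def by (auto simp: hcomp_add) (metis add_0)

lemma veronese_uminus: "x \<in> V d \<Longrightarrow> - x \<in> V d"
  unfolding veronese_def by (auto simp: hcomp_uminus)

lemma veronese_0: "0 \<in> V d" and veronese_1: "1 \<in> V d"
  by (rule veronese_homogeneous[of _ 0]; simp)+

lemma veronese_sum: "(\<And>i. i \<in> I \<Longrightarrow> f i \<in> V d) \<Longrightarrow> sum f I \<in> V d"
  by (induction I rule: infinite_finite_induct) (auto intro: veronese_add veronese_0)

lemma veronese_mult: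
  assumes "x \<in> V d" "y \<in> V d"
  shows "x * y \<in> V d"
proof -
  have "x * y = (\<Sum>i\<in>supp x. \<Sum>j\<in>supp y. hc x i * hc y j)"
    by (simp add: sum_product[symmetric] sum_supp)
  also have "\<dots> \<in> V d"
  proof (intro veronese_sum)
    fix i j assume "i \<in> supp x" "j \<in> supp y"
    then have "int d dvd i + j" using assms by (auto simp: veronese_def supp_def)
    then show "hc x i * hc y j \<in> V d"
      by (rule veronese_homogeneous[OF mult_in[OF hcomp_in hcomp_in]])
  qed
  finally show ?thesis .
qed

lemma subring_veronese: "is_subring (V d)"
  unfolding is_subring_def
  using veronese_0 veronese_1 veronese_add veronese_mult veronese_uminus by blast

lemma veronese_Suc_0: "V (Suc 0) = UNIV"
  by (auto simp: veronese_def)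

text \<open>Each derivation constructed later (the top part, the one from a cylinder, the extension
  to the whole ring) is known only on homogeneous elements, and this lemma does the gluing for all
  three. The fixed shift \<open>N\<close> keeps iterates of a homogeneous element homogeneous, so
  local nilpotency may be checked on the pieces.\<close>

lemma lnd_of_homogeneous_pieces:
  fixes \<delta> :: "'a \<Rightarrow> 'a"
  assumes cl: "\<And>i x. int d dvd i \<Longrightarrow> x \<in> G i \<Longrightarrow> \<delta> x \<in> V d"
    and add: "\<And>i x y. int d dvd i \<Longrightarrow> x \<in> G i \<Longrightarrow> y \<in> G i \<Longrightarrow> \<delta> (x + y) = \<delta> x + \<delta> y"
    and mult: "\<And>i j x y. int d dvd i \<Longrightarrow> int d dvd j \<Longrightarrow> x \<in> G i \<Longrightarrow> y \<in> G j \<Longrightarrow>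
       \<delta> (x * y) = x * \<delta> y + y * \<delta> x"
    and hom: "\<And>i x. int d dvd i \<Longrightarrow> x \<in> G i \<Longrightarrow> \<delta> x \<in> G (i + N)"
    and nil: "\<And>i x. int d dvd i \<Longrightarrow> x \<in> G i \<Longrightarrow> \<exists>n. (\<delta> ^^ n) x = 0"
  obtains D where "lnd_on (V d) D" "\<And>i x. int d dvd i \<Longrightarrow> x \<in> G i \<Longrightarrow> D x = \<delta> x"
proof -
  define D where "D b = (\<Sum>i\<in>supp b. \<delta> (hc b i))" for b
  have d0: "\<delta> 0 = 0" using add[of 0 0 0] by simp
  have DI: "D b = (\<Sum>i\<in>I. \<delta> (hc b i))" if "finite I" "supp b \<subseteq> I" for b I
    unfolding D_def by (rule sum.mono_neutral_left) (use that d0 in \<open>auto simp: supp_def\<close>)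
  have Dh: "D x = \<delta> x" if "int d dvd i" "x \<in> G i" for i x
    using DI[of "{i}" x] supp_homogeneous[OF that(2)] that(2) by (simp add: hcomp_of_homogeneous)
  have Dcl: "D x \<in> V d" if "x \<in> V d" for x
    unfolding D_def
  proof (rule veronese_sum)
    fix i assume "i \<in> supp x"
    then have "int d dvd i" using that by (auto simp: veronese_def supp_def)
    then show "\<delta> (hc x i) \<in> V d" by (rule cl[OF _ hcomp_in])
  qed
  have dadd: "\<delta> (hc x i + hc y i) = \<delta> (hc x i) + \<delta> (hc y i)" if "x \<in> V d" "y \<in> V d" for x y i
    by (cases "int d dvd i") (simp_all add: add[OF _ hcomp_in hcomp_in] veronese_hcomp_eq_0[OF that(1)] veronese_hcomp_eq_0[OF that(2)] d0)
  have Dadd: "D (x + y) = D x + D y" if "x \<in> V d" "y \<in> V d" for x y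
  proof -
    have "supp (x + y) \<subseteq> supp x \<union> supp y" by (auto simp: supp_def hcomp_add)
    then show ?thesis
      by (subst (1 2 3) DI[of "supp x \<union> supp y"]) (auto simp: hcomp_add dadd that sum.distrib)
  qed
  have D0: "D 0 = 0" using Dh[of 0 0] d0 by simp
  have Dsum: "D (sum f I) = (\<Sum>i\<in>I. D (f i))" if "\<And>i. i \<in> I \<Longrightarrow> f i \<in> V d" for f and I :: "int set"
    using that by (induction I rule: infinite_finite_induct) (auto simp: D0 Dadd veronese_sum)
  have Dm1: "D (x * y) = x * D y + y * D x" if x: "x \<in> G i" "int d dvd i" and y: "y \<in> V d" for x y i
  proof -
    have "D (x * y) = D (\<Sum>j\<in>supp y. x * hc y j)" by (simp add: sum_distrib_left[symmetric] sum_supp)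
    also have "\<dots> = (\<Sum>j\<in>supp y. D (x * hc y j))"
      by (rule Dsum) (use x y in \<open>auto intro: veronese_mult veronese_homogeneous hcomp_veronese\<close>)
    also have "\<dots> = (\<Sum>j\<in>supp y. x * \<delta> (hc y j) + hc y j * \<delta> x)"
    proof (rule sum.cong)
      fix j assume "j \<in> supp y"
      then have "int d dvd j" using y by (auto simp: veronese_def supp_def)
      then show "D (x * hc y j) = x * \<delta> (hc y j) + hc y j * \<delta> x"
        using mult[of i j x "hc y j"] Dh[OF _ mult_in[OF x(1) hcomp_in[of y j]]] x by simp
    qed simp
    finally show ?thesis
      by (simp add: sum.distrib sum_distrib_left[symmetric] sum_distrib_right[symmetric] sum_supp
          Dh[OF x(2,1)]) (simp add: D_def)
  qed
  have Dmult: "D (x * y) = x * D y + y * D x" if x: "x \<in> V d" and y: "y \<in> V d" for x y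
  proof -
    have xi: "int d dvd i" if "i \<in> supp x" for i using that x by (auto simp: veronese_def supp_def)
    have "D (x * y) = D (\<Sum>j\<in>supp x. hc x j * y)" by (simp add: sum_distrib_right[symmetric] sum_supp)
    also have "\<dots> = (\<Sum>j\<in>supp x. D (hc x j * y))"
      by (rule Dsum) (use x y in \<open>auto intro: veronese_mult veronese_homogeneous hcomp_veronese\<close>)
    also have "\<dots> = (\<Sum>j\<in>supp x. hc x j * D y + y * \<delta> (hc x j))"
      by (rule sum.cong) (use Dm1[OF hcomp_in xi y] Dh[OF xi hcomp_in] in auto)
    finally show ?thesis
      by (simp add: sum.distrib sum_distrib_left[symmetric] sum_distrib_right[symmetric] sum_supp)
         (simp add: D_def)
  qed
  have pow0: "(D ^^ n) 0 = 0" for n by (induction n) (auto simp: D0)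
  have powcl: "(D ^^ n) x \<in> V d" if "x \<in> V d" for n x by (induction n) (auto simp: that Dcl)
  have powadd: "(D ^^ n) (x + y) = (D ^^ n) x + (D ^^ n) y" if "x \<in> V d" "y \<in> V d" for x y n
    by (induction n) (auto simp: that Dadd powcl)
  have powmono: "(D ^^ n) x = 0" if "(D ^^ m) x = 0" "m \<le> n" for x m n
    using that funpow_add[of "n - m" m D] pow0 by simp
  have nilh: "\<exists>n. (D ^^ n) x = 0" if x: "x \<in> G i" "int d dvd i" for x i
  proof -
    have "(\<delta> ^^ n) x \<in> V d \<and> (D ^^ n) x = (\<delta> ^^ n) x \<and>
       (\<exists>j. int d dvd j \<and> (\<delta> ^^ n) x \<in> G j)" for n
    proof (induction n)
      case 0
      then show ?case using x veronese_homogeneous by auto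
    next
      case (Suc n)
      then obtain j where j: "int d dvd j" "(\<delta> ^^ n) x \<in> G j" by auto
      have "\<delta> ((\<delta> ^^ n) x) \<in> G (j + N)" using hom j by blast
      moreover have "\<delta> ((\<delta> ^^ n) x) \<in> V d" using cl j by blast
      \<comment> \<open>The degree \<open>j + N\<close> need not be a multiple of \<open>d\<close>.
        If the new iterate is nonzero, membership in \<open>V d\<close> forces divisibility; if it
        is 0, degree 0 is recorded instead.\<close>
      ultimately have "\<exists>j. int d dvd j \<and> \<delta> ((\<delta> ^^ n) x) \<in> G j"
        by (cases "\<delta> ((\<delta> ^^ n) x) = 0") (auto dest: homogeneous_veroneseD intro: exI[of _ 0])
      then show ?case using Suc j Dh \<open>\<delta> ((\<delta> ^^ n) x) \<in> V d\<close> by auto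
    qed
    then show ?thesis using nil[OF x(2,1)] by metis
  qed
  have nilall: "\<exists>n>0. (D ^^ n) x = 0" if "x \<in> V d" for x
  proof -
    have "x \<in> V d \<and> (\<exists>n. (D ^^ n) x = 0)"
    proof (rule homogeneous_induct[where b = x])
      fix i show "hc x i \<in> V d \<and> (\<exists>n. (D ^^ n) (hc x i) = 0)"
        by (cases "int d dvd i")
          (use nilh[OF hcomp_in] that pow0 in \<open>auto simp: veronese_hcomp_eq_0[OF that] hcomp_veronese veronese_0\<close>)
    next
      show "0 \<in> V d \<and> (\<exists>n. (D ^^ n) 0 = 0)" using pow0 veronese_0 by auto
    next
      fix x y assume "x \<in> V d \<and> (\<exists>n. (D ^^ n) x = 0)" "y \<in> V d \<and> (\<exists>n. (D ^^ n) y = 0)"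
      then obtain m n where "x \<in> V d" "(D ^^ m) x = 0" "y \<in> V d" "(D ^^ n) y = 0" by auto
      then have "x + y \<in> V d" "(D ^^ (max m n)) (x + y) = 0"
        using powmono[of m x "max m n"] powmono[of n y "max m n"]
        by (auto simp: veronese_add powadd)
      then show "x + y \<in> V d \<and> (\<exists>n. (D ^^ n) (x + y) = 0)" by blast
    qed
    then obtain n where "(D ^^ n) x = 0" by auto
    then have "(D ^^ Suc n) x = 0" using D0 by simp
    then show ?thesis by (intro exI[of _ "Suc n"]) simp
  qed
  have "lnd_on (V d) D"
    unfolding lnd_on_def by (intro conjI ballI Dcl Dadd Dmult nilall)
  then show ?thesis using that Dh by blast
qed

end

section \<open>Graded domains: units are homogeneous, and the ground field sits in degree 0\<close>

locale graded_domain = graded_ring G for G :: "int \<Rightarrow> 'b::idom set"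
begin

text \<open>In a domain the products of the two top components and of the two bottom components do
  not vanish. For x * y = 1 both sit in degree 0, so the lengths of the degree ranges of x and y,
  two nonnegative numbers, add up to 0.\<close>

lemma unit_homogeneous:
  assumes "x * y = 1"
  shows "\<exists>i. x \<in> G i"
proof -
  \<comment> \<open>The sign \<open>s\<close> treats both ends at once: 1 selects the largest
    degrees, -1 the smallest.\<close>
  have ext: "\<exists>i\<in>supp x. \<exists>j\<in>supp y. hc (x * y) (i + j) \<noteq> 0 \<and> 
      (\<forall>k\<in>supp x. s * k \<le> s * i) \<and> (\<forall>k\<in>supp y. s * k \<le> s * j)"
    if "x \<noteq> 0" "y \<noteq> 0" and s: "s = 1 \<or> s = -1" for x y and s :: int
  proof -
    have ne: "supp z \<noteq> {}" if "z \<noteq> 0" for z using that sum_supp[of z] by auto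
    have "\<exists>i\<in>supp z. \<forall>k\<in>supp z. s * k \<le> s * i" if "z \<noteq> 0" for z
    proof -
      have "Max ((\<lambda>k. s * k) ` supp z) \<in> (\<lambda>k. s * k) ` supp z"
        using ne[OF that] by (intro Max_in) auto
      then obtain i where "i \<in> supp z" "Max ((\<lambda>k. s * k) ` supp z) = s * i" by blast
      then show ?thesis by (metis Max_ge finite_imageI finite_supp imageI)
    qed
    then obtain i j where i: "i \<in> supp x" "\<forall>k\<in>supp x. s * k \<le> s * i"
      and j: "j \<in> supp y" "\<forall>k\<in>supp y. s * k \<le> s * j" using \<open>x \<noteq> 0\<close> \<open>y \<noteq> 0\<close> by meson
    have "hc (x * y) (i + j) = (\<Sum>k\<in>{i}. hc x k * hc y (i + j - k))"
      unfolding hcomp_mult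
    proof (rule sum.mono_neutral_right)
      show "\<forall>k\<in>supp x - {i}. hc x k * hc y (i + j - k) = 0"
      proof
        fix k assume k: "k \<in> supp x - {i}"
        have "i + j - k \<notin> supp y"
        proof
          assume "i + j - k \<in> supp y"
          then have "s * (i + j - k) \<le> s * j" "s * k \<le> s * i" "k \<noteq> i" using i j k by auto
          then show False using s by (elim disjE) auto
        qed
        then show "hc x k * hc y (i + j - k) = 0" by (simp add: supp_def)
      qed
    qed (use i in auto)
    then show ?thesis using i j by (intro bexI[of _ i] bexI[of _ j]) (auto simp: in_supp_iff)
  qed
  have nz: "x \<noteq> 0" "y \<noteq> 0" using assms by auto
  have one: "hc (x * y) k \<noteq> 0 \<Longrightarrow> k = 0" for k
    using assms hcomp_of_homogeneous[OF one_in, of k] by (auto split: if_splits)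
  obtain i j where i: "i \<in> supp x" "\<forall>k\<in>supp x. k \<le> i" and j: "j \<in> supp y" "\<forall>k\<in>supp y. k \<le> j" and ij: "i + j = 0"
    using ext[OF nz, of 1] one by auto
  obtain i' j' where i': "i' \<in> supp x" "\<forall>k\<in>supp x. k \<ge> i'" and j': "j' \<in> supp y" and ij': "i' + j' = 0"
    using ext[OF nz, of "-1"] one by auto
  have "i' \<le> i" "j' \<le> j" using i i' j j' by auto
  then have "i = i'" using ij ij' by linarith
  then have "supp x \<subseteq> {i}" using i i' by force
  then have "x = hc x i" using sum_hcomp[of "{i}" x] by simp
  then show ?thesis using hcomp_in by metis
qed

text \<open>Both x and 1 + x are 0 or units, hence homogeneous. A nonzero x of degree other than 0
  would give 1 + x two nonzero components.\<close>

lemma subfield_in_degree_0: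
  assumes "is_subfield K"
  shows "K \<subseteq> G 0"
proof
  fix x assume x: "x \<in> K"
  have h: "\<exists>i. y \<in> G i" if "y \<in> K" for y
    using that assms unit_homogeneous[of y] zero_in by (cases "y = 0") (auto simp: is_subfield_def)
  obtain i where i: "x \<in> G i" using h[OF x] by blast
  have "1 + x \<in> K" using x assms by (auto simp: is_subfield_def is_subring_def)
  then obtain j where j: "1 + x \<in> G j" using h by blast
  show "x \<in> G 0"
  proof (cases "i = 0 \<or> x = 0")
    case False
    have a: "hc (1 + x) 0 = 1" "hc (1 + x) i = x"
      using False i by (simp_all add: hcomp_add hcomp_of_homogeneous[OF i] hcomp_of_homogeneous[OF one_in])
    then show ?thesis using hcomp_of_homogeneous[OF j, of 0] hcomp_of_homogeneous[OF j, of i] False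
      by (auto split: if_splits)
  qed (use i in auto)
qed

end

section \<open>Locally nilpotent derivations\<close>

text \<open>The carrier is a subring because Veronese subrings and localizations occur as sets.
  Characteristic zero takes the form that also permits division by n! inside
  \<open>S\<close>.\<close>

locale lnd =
  fixes S :: "'a::idom set" and D :: "'a \<Rightarrow> 'a"
  assumes subring: "is_subring S" and lnd_on: "lnd_on S D"
    and of_nat_invertible: "n > 0 \<Longrightarrow> \<exists>y\<in>S. of_nat n * y = 1"
begin

lemma S_0 [simp]: "0 \<in> S" and S_1 [simp]: "1 \<in> S"
  and S_add: "x \<in> S \<Longrightarrow> y \<in> S \<Longrightarrow> x + y \<in> S"
  and S_mult: "x \<in> S \<Longrightarrow> y \<in> S \<Longrightarrow> x * y \<in> S"
  and S_uminus: "x \<in> S \<Longrightarrow> - x \<in> S"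
  using subring by (auto simp: is_subring_def)

lemma S_diff: "x \<in> S \<Longrightarrow> y \<in> S \<Longrightarrow> x - y \<in> S"
  using S_add[of x "- y"] S_uminus by simp

lemma S_power: "x \<in> S \<Longrightarrow> x ^ n \<in> S"
  by (induction n) (auto intro: S_mult)

lemma S_of_nat: "of_nat n \<in> S"
  by (induction n) (auto intro: S_add)

lemma S_sum: "(\<And>i. i \<in> I \<Longrightarrow> f i \<in> S) \<Longrightarrow> sum f I \<in> S"
  by (induction I rule: infinite_finite_induct) (auto intro: S_add)

lemmas S_intros = S_add S_mult S_diff S_power S_of_nat

lemma of_nat_neq_0: "n > 0 \<Longrightarrow> (of_nat n :: 'a) \<noteq> 0"
  using of_nat_invertible[of n] by auto

lemma D_in: "x \<in> S \<Longrightarrow> D x \<in> S"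
  and D_add: "x \<in> S \<Longrightarrow> y \<in> S \<Longrightarrow> D (x + y) = D x + D y"
  and D_mult: "x \<in> S \<Longrightarrow> y \<in> S \<Longrightarrow> D (x * y) = x * D y + y * D x"
  and D_nilpotent: "x \<in> S \<Longrightarrow> \<exists>n>0. (D ^^ n) x = 0"
  using lnd_on by (auto simp: lnd_on_def)

lemma D_0 [simp]: "D 0 = 0" 
  using D_add[of 0 0] by (simp only: S_0 add_0_right add_cancel_right_right simp_thms)

lemma D_1 [simp]: "D 1 = 0"
  using D_mult[of 1 1] by (simp only: S_1 mult_1_left add_cancel_right_right simp_thms)

lemma D_uminus: "x \<in> S \<Longrightarrow> D (- x) = - D x"
  using D_add[of x "- x"] S_uminus[of x] by (simp add: eq_neg_iff_add_eq_0 add.commute)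

lemma D_diff: "x \<in> S \<Longrightarrow> y \<in> S \<Longrightarrow> D (x - y) = D x - D y"
  using D_add[of x "- y"] S_uminus[of y] by (simp add: D_uminus)

lemma D_sum: "(\<And>i. i \<in> I \<Longrightarrow> f i \<in> S) \<Longrightarrow> D (sum f I) = (\<Sum>i\<in>I. D (f i))"
  by (induction I rule: infinite_finite_induct) (auto simp: D_add S_sum)

lemma D_of_nat [simp]: "D (of_nat n) = 0"
  by (induction n) (auto simp: D_add S_of_nat)

lemma D_power: "x \<in> S \<Longrightarrow> D (x ^ n) = of_nat n * x ^ (n - 1) * D x"
proof (induction n)
  case (Suc n)
  then have "D (x ^ Suc n) = x * (of_nat n * x ^ (n - 1) * D x) + x ^ n * D x"
    by (simp add: D_mult S_power)
  then show ?case by (cases n) (auto simp: algebra_simps)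
qed simp

lemma funpow_in: "x \<in> S \<Longrightarrow> (D ^^ n) x \<in> S"
  by (induction n) (auto intro: D_in)

lemma funpow_0 [simp]: "(D ^^ n) 0 = 0"
  by (induction n) auto

lemma funpow_add_arg: "x \<in> S \<Longrightarrow> y \<in> S \<Longrightarrow> (D ^^ n) (x + y) = (D ^^ n) x + (D ^^ n) y"
  by (induction n) (auto simp: D_add funpow_in)

lemma funpow_diff: "x \<in> S \<Longrightarrow> y \<in> S \<Longrightarrow> (D ^^ n) (x - y) = (D ^^ n) x - (D ^^ n) y"
  by (induction n) (auto simp: D_diff funpow_in)

lemma funpow_sum:
  "(\<And>i. i \<in> I \<Longrightarrow> f i \<in> S) \<Longrightarrow> (D ^^ n) (sum f I) = (\<Sum>i\<in>I. (D ^^ n) (f i))"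
  by (induction I rule: infinite_finite_induct) (auto simp: funpow_add_arg S_sum)

lemma funpow_eq_0_mono: "(D ^^ m) x = 0 \<Longrightarrow> m \<le> n \<Longrightarrow> (D ^^ n) x = 0"
  using funpow_add[of "n - m" m D] by simp

lemma funpow_mult_ker:
  assumes "c \<in> S" "D c = 0" "x \<in> S"
  shows "(D ^^ n) (c * x) = c * (D ^^ n) x"
  by (induction n) (auto simp: D_mult assms funpow_in)

lemma Leibniz:
  assumes "x \<in> S" "y \<in> S"
  shows "(D ^^ n) (x * y) = (\<Sum>k\<le>n. of_nat (n choose k) * (D ^^ k) x * (D ^^ (n - k)) y)"
proof (induction n)
  case (Suc n)
  let ?t = "\<lambda>a b. (D ^^ a) x * (D ^^ b) y"
  have Dt: "D (of_nat c * (D ^^ a) x * (D ^^ b) y) = of_nat c * ?t (Suc a) b + of_nat c * ?t a (Suc b)" for a b c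
    by (simp add: D_mult S_mult S_of_nat funpow_in assms algebra_simps)
  have "(D ^^ Suc n) (x * y)
      = (\<Sum>k\<le>n. of_nat (n choose k) * ?t (Suc k) (n - k) + of_nat (n choose k) * ?t k (Suc (n - k)))"
  proof -
    have "(D ^^ Suc n) (x * y) = D (\<Sum>k\<le>n. of_nat (n choose k) * (D ^^ k) x * (D ^^ (n - k)) y)"
      by (simp add: Suc.IH)
    then show ?thesis
      by (simp only: D_sum Dt S_mult S_of_nat funpow_in assms)
  qed
  also have "\<dots> = (\<Sum>k\<le>n. of_nat (n choose k) * ?t (Suc k) (n - k))
      + (\<Sum>k\<le>n. of_nat (n choose k) * ?t k (Suc n - k))"
    by (simp add: sum.distrib Suc_diff_le)
  also have "(\<Sum>k\<le>n. of_nat (n choose k) * ?t k (Suc n - k))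
      = ?t 0 (Suc n) + (\<Sum>k\<le>n. of_nat (n choose Suc k) * ?t (Suc k) (n - k))"
  proof -
    have "(\<Sum>k\<le>n. of_nat (n choose k) * ?t k (Suc n - k))
      = (\<Sum>k\<le>Suc n. of_nat (n choose k) * ?t k (Suc n - k))" by (simp add: binomial_eq_0)
    also have "\<dots> = ?t 0 (Suc n) + (\<Sum>k\<le>n. of_nat (n choose Suc k) * ?t (Suc k) (n - k))"
      by (subst sum.atMost_Suc_shift) simp
    finally show ?thesis .
  qed
  finally have "(D ^^ Suc n) (x * y) = ?t 0 (Suc n) + (\<Sum>k\<le>n. of_nat (Suc n choose Suc k) * ?t (Suc k) (n - k))"
    by (simp add: sum.distrib algebra_simps del: funpow.simps)
  also have "\<dots> = (\<Sum>k\<le>Suc n. of_nat (Suc n choose k) * ?t k (Suc n - k))"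
    by (subst sum.atMost_Suc_shift) simp
  finally show ?case by (simp add: mult.assoc del: funpow.simps)
qed simp

text \<open>The degree function of a locally nilpotent derivation, with value 0 instead of minus
  infinity at 0; hence additivity on products is stated for nonzero factors.\<close>

definition dg :: "'a \<Rightarrow> nat" where "dg x = (LEAST n. (D ^^ Suc n) x = 0)"

lemma dg_Suc: "x \<in> S \<Longrightarrow> (D ^^ Suc (dg x)) x = 0"
  unfolding dg_def
proof (rule LeastI_ex)
  assume "x \<in> S"
  then obtain n where "n > 0" "(D ^^ n) x = 0" using D_nilpotent by blast
  then show "\<exists>n. (D ^^ Suc n) x = 0" by (metis Suc_pred)
qed

lemma dg_nonzero: "x \<noteq> 0 \<Longrightarrow> (D ^^ dg x) x \<noteq> 0"
  using not_less_Least[of "dg x - 1" "\<lambda>n. (D ^^ Suc n) x = 0"]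
  unfolding dg_def[symmetric] by (cases "dg x") auto

lemma dg_eqI: "(D ^^ n) x \<noteq> 0 \<Longrightarrow> (D ^^ Suc n) x = 0 \<Longrightarrow> dg x = n"
  unfolding dg_def
proof (rule Least_equality)
  fix m assume "(D ^^ n) x \<noteq> 0" "(D ^^ Suc m) x = 0"
  then show "n \<le> m" using funpow_eq_0_mono[of "Suc m" x n] by (meson not_less_eq_eq)
qed

text \<open>In the Leibniz sum of order dg x + dg y every term except k = dg x differentiates one
  factor too often, and the binomial coefficient of the survivor is nonzero in characteristic zero.
  One order higher no term survives.\<close>

lemma dg_mult:
  assumes x: "x \<in> S" "x \<noteq> 0" and y: "y \<in> S" "y \<noteq> 0"
  shows "dg (x * y) = dg x + dg y"
proof (rule dg_eqI)
  have z: "(D ^^ k) x = 0" if "k > dg x" for k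
    using funpow_eq_0_mono[OF dg_Suc[OF x(1)]] that by simp
  have z': "(D ^^ k) y = 0" if "k > dg y" for k
    using funpow_eq_0_mono[OF dg_Suc[OF y(1)]] that by simp
  have "(D ^^ (dg x + dg y)) (x * y)
    = (\<Sum>k\<in>{dg x}. of_nat ((dg x + dg y) choose k) * (D ^^ k) x * (D ^^ (dg x + dg y - k)) y)"
    unfolding Leibniz[OF x(1) y(1)]
  proof (rule sum.mono_neutral_right)
    show "\<forall>i\<in>{..dg x + dg y} - {dg x}.
       of_nat (dg x + dg y choose i) * (D ^^ i) x * (D ^^ (dg x + dg y - i)) y = 0"
    proof
      fix i assume "i \<in> {..dg x + dg y} - {dg x}"
      then have "i > dg x \<or> dg x + dg y - i > dg y" by auto
      then show "of_nat (dg x + dg y choose i) * (D ^^ i) x * (D ^^ (dg x + dg y - i)) y = 0"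
        using z[of i] z'[of "dg x + dg y - i"] by auto
    qed
  qed auto
  then show "(D ^^ (dg x + dg y)) (x * y) \<noteq> 0"
    using dg_nonzero x y by (simp add: of_nat_neq_0)
  have "(D ^^ Suc (dg x + dg y)) (x * y)
    = (\<Sum>k\<le>Suc (dg x + dg y). of_nat (Suc (dg x + dg y) choose k) * (D ^^ k) x * (D ^^ (Suc (dg x + dg y) - k)) y)"
    using Leibniz[OF x(1) y(1)] by blast
  also have "\<dots> = 0"
  proof (rule sum.neutral, rule)
    fix i assume "i \<in> {..Suc (dg x + dg y)}"
    then have "i > dg x \<or> Suc (dg x + dg y) - i > dg y" by auto
    then show "of_nat (Suc (dg x + dg y) choose i) * (D ^^ i) x * (D ^^ (Suc (dg x + dg y) - i)) y = 0"
      using z[of i] z'[of "Suc (dg x + dg y) - i"] by (auto simp del: funpow.simps)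
  qed
  finally show "(D ^^ Suc (dg x + dg y)) (x * y) = 0" .
qed

lemma dg_eq_0_iff: "x \<in> S \<Longrightarrow> dg x = 0 \<longleftrightarrow> D x = 0"
proof
  assume "x \<in> S" "dg x = 0" then show "D x = 0" using dg_Suc[of x] by simp
next
  assume "x \<in> S" "D x = 0"
  then show "dg x = 0" unfolding dg_def by (intro Least_equality) auto
qed

lemma dg_D: "x \<in> S \<Longrightarrow> D x \<noteq> 0 \<Longrightarrow> dg x = Suc (dg (D x))"
proof (rule dg_eqI)
  assume "x \<in> S" "D x \<noteq> 0"
  then have "(D ^^ dg (D x)) (D x) \<noteq> 0" "(D ^^ Suc (dg (D x))) (D x) = 0"
    using dg_nonzero[of "D x"] dg_Suc[of "D x"] D_in by auto
  then show "(D ^^ Suc (dg (D x))) x \<noteq> 0" "(D ^^ Suc (Suc (dg (D x)))) x = 0"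
    by (metis funpow_Suc_right o_apply)+
qed

lemma dg_power: "x \<in> S \<Longrightarrow> x \<noteq> 0 \<Longrightarrow> dg (x ^ n) = n * dg x"
  by (induction n) (auto simp: dg_mult S_power dg_eq_0_iff)

lemma dg_1 [simp]: "dg 1 = 0" by (simp add: dg_eq_0_iff)

text \<open>D-degrees are natural numbers that add, so a nonzero product of D-degree 0 has factors
  of D-degree 0.\<close>

lemma ker_factorially_closed:
  assumes "x \<in> S" "y \<in> S" "x * y \<noteq> 0" "D (x * y) = 0"
  shows "D x = 0"
  using dg_mult[of x y] assms dg_eq_0_iff[of "x * y"] dg_eq_0_iff[of x] by (auto simp: S_mult)

lemma D_unit: "x \<in> S \<Longrightarrow> y \<in> S \<Longrightarrow> x * y = 1 \<Longrightarrow> D x = 0"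
  using ker_factorially_closed[of x y] by simp

lemma D_funpow_dg: "x \<in> S \<Longrightarrow> D ((D ^^ dg x) x) = 0"
  using dg_Suc[of x] by simp

end

section \<open>Finite generation of Veronese subrings\<close>

inductive_set additive_closure :: "'a::comm_ring_1 set \<Rightarrow> 'a set" for T where
  zero: "0 \<in> additive_closure T"
| add: "t \<in> T \<Longrightarrow> b \<in> additive_closure T \<Longrightarrow> t + b \<in> additive_closure T"

lemma additive_closure_add:
  "x \<in> additive_closure T \<Longrightarrow> y \<in> additive_closure T \<Longrightarrow> x + y \<in> additive_closure T"
  by (induction rule: additive_closure.induct) (auto intro: additive_closure.intros simp: add.assoc)

lemma additive_closure_base: "t \<in> T \<Longrightarrow> t \<in> additive_closure T"
  using additive_closure.add[OF _ additive_closure.zero] by force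

lemma additive_closure_sum:
  "(\<And>i. i \<in> I \<Longrightarrow> f i \<in> additive_closure T) \<Longrightarrow> sum f I \<in> additive_closure T"
  by (induction I rule: infinite_finite_induct) (auto intro: additive_closure.zero additive_closure_add)

text \<open>Finite sums from a set closed under products and negation already form a ring. Applied
  to scalar multiples of monomials, this gives every ring element a normal form as a sum of such
  terms.\<close>

lemma ring_gen_subset_additive_closure:
  assumes one: "1 \<in> T" and mult: "\<And>x y. x \<in> T \<Longrightarrow> y \<in> T \<Longrightarrow> x * y \<in> T"
    and neg: "\<And>x. x \<in> T \<Longrightarrow> - x \<in> T" and X: "X \<subseteq> additive_closure T"
  shows "ring_gen X \<subseteq> additive_closure T"
proof
  have m1: "x * y \<in> additive_closure T" if "y \<in> additive_closure T" "x \<in> T" for x y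
    using that by (induction rule: additive_closure.induct)
      (auto intro: additive_closure.intros mult simp: distrib_left)
  have m: "x * y \<in> additive_closure T" if "x \<in> additive_closure T" "y \<in> additive_closure T" for x y
    using that by (induction rule: additive_closure.induct)
      (auto intro: additive_closure.intros additive_closure_add m1 simp: distrib_right)
  have n: "- x \<in> additive_closure T" if "x \<in> additive_closure T" for x
    using m1[OF that neg[OF one]] by simp
  fix x assume "x \<in> ring_gen X"
  then show "x \<in> additive_closure T"
    using X by (induction rule: ring_gen.induct)
      (auto intro: additive_closure.zero additive_closure_base[OF one] additive_closure_add m n)
qed

text \<open>Generation with the degree recorded, where sums are formed only within one degree. Any
  bound that respects products and sums of equal degree then follows by induction over the
  generation. The clause \<open>zero\<close> covers degrees in which a summand has no
  component.\<close>

inductive homogeneously_generated :: "nat \<Rightarrow> 'a::comm_ring_1 set \<Rightarrow> (int \<times> 'a) set \<Rightarrow> int \<Rightarrow> 'a \<Rightarrow> bool"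
  for d K M where
  scalar: "k \<in> K \<Longrightarrow> homogeneously_generated d K M 0 k"
| gen: "(i, m) \<in> M \<Longrightarrow> homogeneously_generated d K M i m"
| mult: "homogeneously_generated d K M i x \<Longrightarrow> homogeneously_generated d K M j y \<Longrightarrow>
    homogeneously_generated d K M (i + j) (x * y)"
| add: "homogeneously_generated d K M i x \<Longrightarrow> homogeneously_generated d K M i y \<Longrightarrow>
    homogeneously_generated d K M i (x + y)"
| zero: "int d dvd i \<Longrightarrow> homogeneously_generated d K M i 0"

lemma (in graded_ring) homogeneously_generated_in:
  assumes "homogeneously_generated d K M i x" "K \<subseteq> G 0"
    "\<And>i m. (i, m) \<in> M \<Longrightarrow> int d dvd i \<and> m \<in> G i"
  shows "int d dvd i \<and> x \<in> G i"
  using assms by (induction rule: homogeneously_generated.induct) (auto intro: mult_in add_in)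

context graded_domain
begin

text \<open>Write each exponent of a monomial in the homogeneous generators as d * q + r with r < d.
  The part with exponents d * q is a product of d-th powers and has weight divisible by d, so the
  remaining monomial does too whenever the whole one does. Only finitely many remainders
  exist.\<close>

lemma veronese_finitely_generated:
  assumes K: "is_subfield K" and S: "finite S" "ring_gen (K \<union> S) = UNIV" and d: "d > 0"
  obtains M where "finite M" "\<And>i m. (i, m) \<in> M \<Longrightarrow> int d dvd i \<and> m \<in> G i"
    "\<And>i x. int d dvd i \<Longrightarrow> x \<in> G i \<Longrightarrow> homogeneously_generated d K M i x"
proof -
  define H where "H = (\<Union>s\<in>S. hc s ` supp s)"
  define dgr where "dgr h = (SOME i. h \<in> G i)" for h
  define mon where "mon a = (\<Prod>h\<in>H. h ^ a h)" for a :: "'b \<Rightarrow> nat"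
  define wt where "wt a = (\<Sum>h\<in>H. int (a h) * dgr h)" for a :: "'b \<Rightarrow> nat"
  define T where "T = {k * mon a | k a. k \<in> K}"
  define M where "M = (\<lambda>r. (wt r, mon r)) ` {r \<in> H \<rightarrow>\<^sub>E {..<d}. int d dvd wt r}
     \<union> (\<lambda>h. (int d * dgr h, h ^ d)) ` H"
  have Kr: "0 \<in> K" "1 \<in> K" "\<And>x y. x \<in> K \<Longrightarrow> y \<in> K \<Longrightarrow> x * y \<in> K" "\<And>x. x \<in> K \<Longrightarrow> - x \<in> K"
    using K by (auto simp: is_subfield_def is_subring_def)
  have K0: "K \<subseteq> G 0" by (rule subfield_in_degree_0[OF K])
  have finH: "finite H" unfolding H_def using S by auto
  have dgr: "h \<in> G (dgr h)" if "h \<in> H" for h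
    unfolding dgr_def by (rule someI_ex) (use that in \<open>auto simp: H_def intro: hcomp_in\<close>)
  have mon_in: "mon a \<in> G (wt a)" for a
    unfolding mon_def wt_def by (intro prod_in power_in dgr)
  have mon_mult: "mon a * mon b = mon (\<lambda>h. a h + b h)" for a b
    by (simp add: mon_def power_add prod.distrib)
  have wt_add: "wt (\<lambda>h. a h + b h) = wt a + wt b" for a b
    by (simp add: wt_def algebra_simps sum.distrib)
  have mon_cong: "mon a = mon b" "wt a = wt b" if "\<And>h. h \<in> H \<Longrightarrow> a h = b h" for a b
    using that by (auto simp: mon_def wt_def intro!: prod.cong sum.cong)
  have mon0: "mon (\<lambda>_. 0) = 1" by (simp add: mon_def)
  have KT: "K \<subseteq> T"
  proof
    fix k assume "k \<in> K"
    then show "k \<in> T" unfolding T_def using mon0 by (intro CollectI exI[of _ k] exI[of _ "\<lambda>_. 0"]) simp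
  qed
  have HT: "H \<subseteq> T"
  proof
    fix h assume h: "h \<in> H"
    have "mon (\<lambda>g. if g = h then 1 else 0) = (\<Prod>g\<in>H. if g = h then h else 1)"
      unfolding mon_def by (rule prod.cong) auto
    also have "\<dots> = h" using finH h by simp
    finally show "h \<in> T" unfolding T_def using Kr
      by (intro CollectI exI[of _ 1] exI[of _ "\<lambda>g. if g = h then 1 else 0"]) simp
  qed
  have "S \<subseteq> additive_closure T"
  proof
    fix s assume "s \<in> S"
    then have "sum (hc s) (supp s) \<in> additive_closure T"
      using HT by (intro additive_closure_sum additive_closure_base) (auto simp: H_def)
    then show "s \<in> additive_closure T" by (simp add: sum_supp)
  qed
  moreover have "K \<subseteq> additive_closure T" using KT additive_closure_base by blast
  ultimately have "ring_gen (K \<union> S) \<subseteq> additive_closure T"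
  proof (intro ring_gen_subset_additive_closure)
    show "1 \<in> T" using KT Kr by auto
    fix x y assume "x \<in> T"
    then obtain k a where x: "k \<in> K" "x = k * mon a" by (auto simp: T_def)
    show "- x \<in> T" unfolding T_def using x Kr by (intro CollectI exI[of _ "- k"] exI[of _ a]) simp
    assume "y \<in> T"
    then obtain l b where y: "l \<in> K" "y = l * mon b" by (auto simp: T_def)
    have "x * y = (k * l) * (mon a * mon b)" using x y by (simp add: algebra_simps)
    then show "x * y \<in> T" unfolding T_def mon_mult using x y Kr
      by (intro CollectI exI[of _ "k * l"] exI[of _ "\<lambda>h. a h + b h"]) simp
  qed auto
  then have AC: "b \<in> additive_closure T" for b using S by auto
  show ?thesis
  proof (rule that[of M])
    have "finite {r \<in> H \<rightarrow>\<^sub>E {..<d}. int d dvd wt r}"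
      by (rule finite_subset[of _ "H \<rightarrow>\<^sub>E {..<d}"]) (auto intro: finite_PiE finH)
    then show "finite M" unfolding M_def using finH by auto
    show "int d dvd i \<and> m \<in> G i" if "(i, m) \<in> M" for i m
      using that mon_in power_in[OF dgr] by (auto simp: M_def)
  next
    fix i x
    let ?P = "homogeneously_generated d K M"
    assume i: "int d dvd i" "x \<in> G i"
    note PK = homogeneously_generated.scalar and Pm = homogeneously_generated.mult
    have Ppow: "?P (int n * j) (y ^ n)" if "?P j y" for n j y
    proof (induction n)
      case (Suc n)
      have "?P (j + int n * j) (y * y ^ n)"
        by (rule Pm) (use that Suc in auto)
      then show ?case by (simp add: algebra_simps)
    qed (use PK Kr in auto)
    have Pprod: "?P (\<Sum>h\<in>I. int (q h) * (int d * dgr h)) (\<Prod>h\<in>I. (h ^ d) ^ q h)" if "I \<subseteq> H" for I q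
      using finite_subset[OF that finH] that
    proof (induction I rule: finite_induct)
      case (insert h I)
      have "?P (int d * dgr h) (h ^ d)"
        using insert by (auto intro!: homogeneously_generated.gen simp: M_def)
      then have "?P (int (q h) * (int d * dgr h) + (\<Sum>h\<in>I. int (q h) * (int d * dgr h)))
          ((h ^ d) ^ q h * (\<Prod>h\<in>I. (h ^ d) ^ q h))"
        by (rule Pm[OF Ppow insert.IH]) (use insert in auto)
      then show ?case using insert by simp
    qed (use PK Kr in auto)
    have Pmon: "?P (wt a) (mon a)" if "int d dvd wt a" for a
    proof -
      define q where "q h = a h div d" for h
      \<comment> \<open>Off \<open>H\<close> the function takes the default value of the extensional
        function space used in \<open>M\<close>; this space is finite.\<close>
      define r where "r = restrict (\<lambda>h. a h mod d) H"
      have a: "a h = d * q h + r h" if "h \<in> H" for h using that by (simp add: q_def r_def)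
      have ma: "mon a = mon (\<lambda>h. d * q h) * mon r" "wt a = wt (\<lambda>h. d * q h) + wt r"
        unfolding mon_mult wt_add[symmetric] by (rule mon_cong, rule a, assumption)+
      have q: "wt (\<lambda>h. d * q h) = (\<Sum>h\<in>H. int (q h) * (int d * dgr h))"
        "mon (\<lambda>h. d * q h) = (\<Prod>h\<in>H. (h ^ d) ^ q h)"
        by (simp_all add: wt_def mon_def power_mult algebra_simps)
      have dq: "int d dvd wt (\<lambda>h. d * q h)" unfolding q by (intro dvd_sum) auto
      then have dr: "int d dvd wt r" using that ma(2) by (simp add: dvd_add_right_iff)
      have "r \<in> H \<rightarrow>\<^sub>E {..<d}" using d by (auto simp: r_def)
      then have "?P (wt r) (mon r)" using dr by (auto intro!: homogeneously_generated.gen simp: M_def)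
      moreover have "?P (wt (\<lambda>h. d * q h)) (mon (\<lambda>h. d * q h))" using Pprod[of H q] q by simp
      ultimately show ?thesis unfolding ma by (intro Pm)
    qed
    have "int d dvd j \<Longrightarrow> ?P j (hc b j)" if "b \<in> additive_closure T" for b j
      using that
    proof (induction rule: additive_closure.induct)
      case (add t b)
      obtain k a where t: "k \<in> K" "t = k * mon a" using add by (auto simp: T_def)
      have tG: "t \<in> G (wt a)" using mult_in[of k 0 "mon a" "wt a"] K0 t mon_in by auto
      have "?P j (hc t j)"
      proof (cases "j = wt a")
        case True
        have "?P (0 + wt a) (k * mon a)"
          by (intro Pm PK t Pmon) (use True add in auto)
        then show ?thesis using hcomp_of_homogeneous[OF tG] True t by simp
      qed (use homogeneously_generated.zero add hcomp_of_homogeneous[OF tG] in auto)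
      then show ?case using add by (simp add: hcomp_add homogeneously_generated.add)
    qed (use homogeneously_generated.zero in auto)
    from this[OF AC i(1), of x] show "?P i x" using i hcomp_of_homogeneous[OF i(2)] by simp
  qed
qed

end

section \<open>Homogenization\<close>

context graded_domain
begin

lemma of_nat_invertible_veronese:
  assumes "fg_algebra_over_char0_field TYPE('b)" "n > 0"
  shows "\<exists>y\<in>V d. of_nat n * y = 1"
proof -
  obtain K :: "'b set" where K: "is_subfield K" "(of_nat n :: 'b) \<noteq> 0"
    using assms by (auto simp: fg_algebra_over_char0_field_def)
  have "of_nat m \<in> K" for m
    by (induction m) (use K(1) in \<open>auto simp: is_subfield_def is_subring_def\<close>)
  then obtain y where "y \<in> K" "of_nat n * y = 1" using K by (auto simp: is_subfield_def)
  then show ?thesis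
    using subfield_in_degree_0[OF K(1)] veronese_homogeneous[of y 0 d] by auto
qed

lemma lnd_veronese:
  "fg_algebra_over_char0_field TYPE('b) \<Longrightarrow> lnd_on (V d) D \<Longrightarrow> lnd (V d) D"
  by (simp add: lnd_def subring_veronese of_nat_invertible_veronese)

text \<open>The part to keep must have one shift for all homogeneous elements. The shifts on the
  finitely many generators are at most \<open>N0\<close>, the product rule propagates this bound,
  and the largest shift \<open>N\<close> that really occurs yields a nonzero derivation.\<close>

lemma exists_homogeneous_lnd:
  assumes fg: "fg_algebra_over_char0_field TYPE('b)" and d: "d > 0" and nr: "\<not> rigid (V d)"
  obtains D N where "lnd (V d) D" "\<And>i x. int d dvd i \<Longrightarrow> x \<in> G i \<Longrightarrow> D x \<in> G (i + N)"
    "\<exists>i x. int d dvd i \<and> x \<in> G i \<and> D x \<noteq> 0"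
proof -
  obtain D0 where D0: "lnd_on (V d) D0" and ne: "\<exists>x\<in>V d. D0 x \<noteq> 0"
    using nr by (auto simp: rigid_def)
  interpret lnd "V d" D0 by (rule lnd_veronese[OF fg D0])
  note vh = veronese_homogeneous
  obtain K S where K: "is_subfield K" and S: "finite S" "ring_gen (K \<union> S) = (UNIV :: 'b set)"
    using fg by (auto simp: fg_algebra_over_char0_field_def)
  obtain M where finM: "finite M" and M: "\<And>i m. (i, m) \<in> M \<Longrightarrow> int d dvd i \<and> m \<in> G i"
    and gen: "\<And>i x. int d dvd i \<Longrightarrow> x \<in> G i \<Longrightarrow> homogeneously_generated d K M i x"
    using veronese_finitely_generated[OF K S d] by metis
  have DK: "D0 k = 0" if k: "k \<in> K" for k
  proof (cases "k = 0")
    case False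
    then obtain y where "y \<in> K" "k * y = 1" using K k by (auto simp: is_subfield_def)
    moreover have "K \<subseteq> V d" using subfield_in_degree_0[OF K] vh[of _ 0 d] by auto
    ultimately show ?thesis using D_unit k by blast
  qed simp
  define N0 where "N0 = Max (insert 0 (\<Union>(i, m)\<in>M. (\<lambda>j. j - i) ` supp (D0 m)))"
  have N0: "hc (D0 m) j = 0" if "(i, m) \<in> M" "j > i + N0" for i m j
  proof (rule ccontr)
    assume "hc (D0 m) j \<noteq> 0"
    then have "j \<in> supp (D0 m)" by (simp add: supp_def)
    then have "j - i \<le> N0" unfolding N0_def
      using that(1) finM by (intro Max_ge) (auto intro!: bexI[of _ "(i, m)"])
    then show False using that(2) by simp
  qed
  have bounded: "\<forall>j>i + N0. hc (D0 x) j = 0" if "int d dvd i" "x \<in> G i" for i x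
    using gen[OF that]
  proof (induction rule: homogeneously_generated.induct)
    case (mult i x j y)
    then have xy: "x \<in> G i" "y \<in> G j" "x \<in> V d" "y \<in> V d"
      using homogeneously_generated_in[OF _ subfield_in_degree_0[OF K] M] vh by blast+
    show ?case
      using mult.IH by (simp add: D_mult xy hcomp_add hcomp_mult_left[OF xy(1)] hcomp_mult_left[OF xy(2)])
  next
    case (add i x y)
    then have "x \<in> V d" "y \<in> V d"
      using homogeneously_generated_in[OF _ subfield_in_degree_0[OF K] M] vh by blast+
    then show ?case using add.IH by (simp add: D_add hcomp_add)
  qed (use DK N0 in auto)
  have Dsupp: "D0 z = (\<Sum>j\<in>supp z. D0 (hc z j))" if "z \<in> V d" for z
    using D_sum[of "supp z" "hc z"] that by (simp add: hcomp_veronese sum_supp)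
  define Z where "Z = {n. \<exists>i x. int d dvd i \<and> x \<in> G i \<and> hc (D0 x) (i + n) \<noteq> 0}"
  have "\<exists>n. n \<in> Z"
  proof -
    obtain x where x: "x \<in> V d" "D0 x \<noteq> 0" using ne by blast
    then obtain i where i: "i \<in> supp x" "D0 (hc x i) \<noteq> 0"
      using Dsupp[OF x(1)] by (metis sum.neutral)
    then have "supp (D0 (hc x i)) \<noteq> {}" using sum_supp[of "D0 (hc x i)"] by auto
    then obtain j where "hc (D0 (hc x i)) (i + (j - i)) \<noteq> 0" by (auto simp: supp_def)
    then have "j - i \<in> Z" using i x unfolding Z_def
      by (intro CollectI exI[of _ i] exI[of _ "hc x i"]) (auto simp: veronese_def supp_def)
    then show ?thesis by blast
  qed
  \<comment> \<open>The set \<open>Z\<close> is bounded above by \<open>N0\<close>, so its maximum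
    is found by minimising the distance to \<open>N0\<close>, a natural number.\<close>
  then obtain N where N: "N \<in> Z" "\<And>n. n \<in> Z \<Longrightarrow> nat (N0 - N) \<le> nat (N0 - n)"
    using ex_has_least_nat[of "\<lambda>n. n \<in> Z" _ "\<lambda>n. nat (N0 - n)"] by blast
  have Zle: "n \<le> N" if "n \<in> Z" for n
  proof -
    have "n \<le> N0" using that bounded by (force simp: Z_def not_le)
    then show ?thesis using N(2)[OF that] by linarith
  qed
  have top: "hc (D0 x) j = 0" if "x \<in> V d" "x \<in> G i" "j > i + N" for i j x
  proof (rule ccontr)
    assume a: "hc (D0 x) j \<noteq> 0"
    then have "x \<noteq> 0" by auto
    then have "j - i \<in> Z" using a that homogeneous_veroneseD[of x d i]
      unfolding Z_def by (intro CollectI exI[of _ i] exI[of _ x]) auto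
    then show False using Zle that(3) by fastforce
  qed
  \<comment> \<open>The choice is ambiguous only for 0, and there every component of
    \<open>D0 0\<close> vanishes.\<close>
  define dgr where "dgr x = (SOME i. x \<in> G i)" for x
  define \<delta> where "\<delta> x = hc (D0 x) (dgr x + N)" for x
  have \<delta>: "\<delta> x = hc (D0 x) (i + N)" if "x \<in> G i" for x i
  proof (cases "x = 0")
    case False
    have "x \<in> G (dgr x)" unfolding dgr_def by (rule someI) (fact that)
    then have "dgr x = i" using homogeneous_degree_unique that False by blast
    then show ?thesis by (simp add: \<delta>_def)
  qed (simp add: \<delta>_def)
  \<comment> \<open>\<open>D0\<close> moves components of degree below i + n * N strictly below i +
    (n + 1) * N, so only the top component of an iterate influences the next top component.
    Nilpotency of \<open>D0\<close> at x therefore passes to \<delta>.\<close>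
  have pow: "(\<delta> ^^ n) x = hc ((D0 ^^ n) x) (i + int n * N) \<and> (\<forall>j > i + int n * N. hc ((D0 ^^ n) x) j = 0)"
    if x: "int d dvd i" "x \<in> G i" for i x n
  proof (induction n)
    case (Suc n)
    define z where "z = (D0 ^^ n) x"
    have z: "z \<in> V d" unfolding z_def by (rule funpow_in) (use x vh in auto)
    have hz: "hc (D0 z) k = (\<Sum>j\<in>supp z. hc (D0 (hc z j)) k)" for k
      unfolding Dsupp[OF z] hcomp_sum ..
    have top': "hc (D0 (hc z j)) k = 0" if "k > j + N" for j k
      by (rule top[OF hcomp_veronese[OF z] hcomp_in that])
    have s: "supp z \<subseteq> {.. i + int n * N}" using Suc by (auto simp: supp_def z_def not_le[symmetric])
    have 1: "hc (D0 z) k = 0" if "k > i + int (Suc n) * N" for k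
      unfolding hz
    proof (rule sum.neutral, rule)
      fix j assume "j \<in> supp z"
      then have "j + N < k" using s that by (auto simp: algebra_simps)
      then show "hc (D0 (hc z j)) k = 0" by (rule top')
    qed
    have "hc (D0 z) (i + int (Suc n) * N) = (\<Sum>j\<in>supp z. if j = i + int n * N then hc (D0 (hc z j)) (j + N) else 0)"
      unfolding hz
    proof (rule sum.cong)
      fix j assume "j \<in> supp z"
      then have "j = i + int n * N \<or> j < i + int n * N" using s by auto
      then show "hc (D0 (hc z j)) (i + int (Suc n) * N) = (if j = i + int n * N then hc (D0 (hc z j)) (j + N) else 0)"
        by (auto simp: algebra_simps intro!: top')
    qed simp
    also have "\<dots> = hc (D0 (hc z (i + int n * N))) (i + int n * N + N)"
      by (auto simp: sum.delta in_supp_iff)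
    also have "\<dots> = \<delta> ((\<delta> ^^ n) x)" using Suc \<delta>[OF hcomp_in] by (simp add: z_def)
    finally show ?case using 1 by (simp add: z_def)
  qed (use x in \<open>auto simp: hcomp_of_homogeneous\<close>)
  obtain D where D: "lnd_on (V d) D" "\<And>i x. int d dvd i \<Longrightarrow> x \<in> G i \<Longrightarrow> D x = \<delta> x"
  proof (rule lnd_of_homogeneous_pieces[of d \<delta> N])
    fix i x assume x: "int d dvd i" "x \<in> G i"
    show "\<delta> x \<in> V d" unfolding \<delta>_def by (intro hcomp_veronese D_in vh[OF x(2,1)])
    show "\<delta> x \<in> G (i + N)" by (simp add: \<delta>[OF x(2)])
    obtain n where "(D0 ^^ n) x = 0" using D_nilpotent vh[OF x(2,1)] by blast
    then show "\<exists>n. (\<delta> ^^ n) x = 0" using pow[OF x, of n] by (intro exI[of _ n]) simp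
    fix y assume y: "y \<in> G i"
    show "\<delta> (x + y) = \<delta> x + \<delta> y"
      using vh[OF x(2,1)] vh[OF y x(1)] by (simp add: \<delta>[OF add_in[OF x(2) y]] \<delta>[OF x(2)] \<delta>[OF y] D_add hcomp_add)
  next
    fix i j x y assume x: "int d dvd i" "x \<in> G i" and y: "int d dvd j" "y \<in> G j"
    show "\<delta> (x * y) = x * \<delta> y + y * \<delta> x"
      using vh[OF x(2,1)] vh[OF y(2,1)]
      by (simp add: \<delta>[OF mult_in[OF x(2) y(2)]] \<delta>[OF x(2)] \<delta>[OF y(2)] D_mult hcomp_add
          hcomp_mult_left[OF x(2)] hcomp_mult_left[OF y(2)] algebra_simps)
  next
    fix D assume *: "lnd_on (V d) D" "\<And>i x. int d dvd i \<Longrightarrow> x \<in> G i \<Longrightarrow> D x = \<delta> x"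
    show thesis by (rule that[OF *])
  qed
  show ?thesis
  proof (rule that[of D N])
    show "lnd (V d) D" by (rule lnd_veronese[OF fg D(1)])
    show "D x \<in> G (i + N)" if "int d dvd i" "x \<in> G i" for i x
      by (simp add: D(2)[OF that] \<delta>[OF that(2)])
    obtain i x where x: "int d dvd i" "x \<in> G i" "hc (D0 x) (i + N) \<noteq> 0" using N by (auto simp: Z_def)
    then have "D x \<noteq> 0" using D(2)[OF x(1,2)] \<delta>[OF x(2)] by simp
    with x show "\<exists>i x. int d dvd i \<and> x \<in> G i \<and> D x \<noteq> 0" by blast
  qed
qed

end

section \<open>From a cylinder to a derivation\<close>

lemma to_fract_power: "to_fract (x ^ n) = to_fract x ^ n"
  by (induction n) auto

lemma to_fract_sum: "to_fract (sum f I) = (\<Sum>i\<in>I. to_fract (f i))"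
  by (induction I rule: infinite_finite_induct) auto

lemma to_fract_of_nat: "to_fract (of_nat n) = of_nat n"
  by (induction n) auto

definition polys_over :: "'a::comm_ring_1 set \<Rightarrow> 'a poly set" where
  "polys_over A = {p. \<forall>i. coeff p i \<in> A}"

lemma subring_sum: "is_subring A \<Longrightarrow> (\<And>i. i \<in> I \<Longrightarrow> f i \<in> A) \<Longrightarrow> sum f I \<in> A"
  by (induction I rule: infinite_finite_induct) (auto simp: is_subring_def)

lemma subring_diff: "is_subring A \<Longrightarrow> x \<in> A \<Longrightarrow> y \<in> A \<Longrightarrow> x - y \<in> A"
  unfolding diff_conv_add_uminus by (auto simp: is_subring_def simp del: add_uminus_conv_diff)

lemma subring_polys_over: "is_subring A \<Longrightarrow> is_subring (polys_over A)"
proof -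
  assume A: "is_subring A"
  then have A': "0 \<in> A" "1 \<in> A" "\<And>x y. x \<in> A \<Longrightarrow> y \<in> A \<Longrightarrow> x + y \<in> A"
    "\<And>x y. x \<in> A \<Longrightarrow> y \<in> A \<Longrightarrow> x * y \<in> A" "\<And>x. x \<in> A \<Longrightarrow> - x \<in> A"
    by (auto simp: is_subring_def)
  show ?thesis
    unfolding is_subring_def polys_over_def
    by (auto simp: A' coeff_mult intro!: subring_sum[OF A])
qed

lemma pCons_in_polys_over: "a \<in> A \<Longrightarrow> p \<in> polys_over A \<Longrightarrow> pCons a p \<in> polys_over A"
  by (auto simp: polys_over_def coeff_pCons split: nat.split)

text \<open>Independence of t makes the representing polynomial unique, so formal differentiation
  transfers to \<open>C\<close>, and the falling degree gives local nilpotency. The value 1 at t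
  will later witness that the derivation built from it is nonzero.\<close>

lemma poly_ring_one_var_lnd:
  fixes C :: "'a::idom set"
  assumes "poly_ring_one_var C"
  obtains \<Delta> t where "is_subring C" "lnd_on C \<Delta>" "t \<in> C" "\<Delta> t = 1"
proof -
  obtain A t where *: "is_subring A \<and> A \<subseteq> C \<and> t \<in> C \<and>
     (\<forall>p. (\<forall>i. coeff p i \<in> A) \<longrightarrow> poly p t \<in> C) \<and>
     (\<forall>c\<in>C. \<exists>p. (\<forall>i. coeff p i \<in> A) \<and> c = poly p t) \<and>
     (\<forall>p. (\<forall>i. coeff p i \<in> A) \<and> poly p t = 0 \<longrightarrow> p = 0)"
    using assms unfolding poly_ring_one_var_def by (elim exE) (rule that)
  then have A: "is_subring A" and t: "t \<in> C"
    and into: "\<And>p. \<forall>i. coeff p i \<in> A \<Longrightarrow> poly p t \<in> C"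
    and onto: "\<And>c. c \<in> C \<Longrightarrow> \<exists>p. (\<forall>i. coeff p i \<in> A) \<and> c = poly p t"
    and indep: "\<And>p. \<forall>i. coeff p i \<in> A \<Longrightarrow> poly p t = 0 \<Longrightarrow> p = 0"
    by simp_all
  define PA where "PA p \<longleftrightarrow> p \<in> polys_over A" for p
  have PA: "PA 0" "PA 1" "\<And>p q. PA p \<Longrightarrow> PA q \<Longrightarrow> PA (p + q)"
      "\<And>p q. PA p \<Longrightarrow> PA q \<Longrightarrow> PA (p * q)" "\<And>p. PA p \<Longrightarrow> PA (- p)"
    using subring_polys_over[OF A] by (auto simp: PA_def is_subring_def)
  have PA_X: "PA [:0, 1:]"
    using PA(1) A by (auto simp: PA_def is_subring_def intro!: pCons_in_polys_over)
  have A_of_nat: "of_nat n \<in> A" for n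
    using A by (induction n) (auto simp: is_subring_def)
  have PA_pderiv: "PA (pderiv p)" if "PA p" for p
  proof -
    have "coeff (pderiv p) n \<in> A" for n
      using that A A_of_nat[of "Suc n"] unfolding PA_def polys_over_def coeff_pderiv is_subring_def by blast
    then show ?thesis by (simp add: PA_def polys_over_def)
  qed
  have uniq: "p = q" if "PA p" "PA q" "poly p t = poly q t" for p q
    using indep[of "p + - q"] PA(3)[OF that(1) PA(5)[OF that(2)]] that(3)
    by (auto simp: PA_def polys_over_def)
  define \<Delta> where "\<Delta> c = poly (pderiv (THE p. PA p \<and> c = poly p t)) t" for c
  have \<Delta>: "\<Delta> (poly p t) = poly (pderiv p) t" if "PA p" for p
  proof -
    have "(THE q. PA q \<and> poly p t = poly q t) = p" using that uniq by (intro the_equality) auto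
    then show ?thesis by (simp add: \<Delta>_def)
  qed
  have onto': "\<exists>p. PA p \<and> c = poly p t" if "c \<in> C" for c using onto[OF that] by (simp add: PA_def polys_over_def)
  have into': "poly p t \<in> C" if "PA p" for p using into that by (simp add: PA_def polys_over_def)
  have pow: "PA ((pderiv ^^ n) p) \<and> (\<Delta> ^^ n) (poly p t) = poly ((pderiv ^^ n) p) t" if "PA p" for n p
    by (induction n) (auto simp: that \<Delta> PA_pderiv)
  have nil: "(pderiv ^^ n) p = 0" if "degree p < n" for n and p :: "'a poly"
    using that
  proof (induction n arbitrary: p)
    case (Suc n)
    show ?case
    proof (cases "degree p = 0")
      case True
      then obtain c where "p = [:c:]" by (rule degree_eq_zeroE)
      then have "pderiv p = 0" by (simp add: pderiv_pCons)
      moreover have "(pderiv ^^ n) 0 = (0 :: 'a poly)" by (induction n) auto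
      ultimately show ?thesis by (simp add: funpow_Suc_right del: funpow.simps)
    next
      case False
      have "degree (pderiv p) \<le> degree p - 1"
        by (rule degree_le) (simp add: coeff_pderiv coeff_eq_0)
      then have "degree (pderiv p) < n" using Suc.prems False by linarith
      then show ?thesis using Suc.IH by (simp add: funpow_Suc_right del: funpow.simps)
    qed
  qed simp
  have "is_subring C"
    unfolding is_subring_def
  proof (intro conjI ballI)
    show "0 \<in> C" "1 \<in> C" using into'[OF PA(1)] into'[OF PA(2)] by auto
    fix x assume "x \<in> C"
    then obtain p where p: "PA p" "x = poly p t" using onto' by blast
    show "- x \<in> C" using into'[OF PA(5)[OF p(1)]] p by simp
    fix y assume "y \<in> C"
    then obtain q where q: "PA q" "y = poly q t" using onto' by blast
    show "x + y \<in> C" "x * y \<in> C"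
      using into'[OF PA(3)[OF p(1) q(1)]] into'[OF PA(4)[OF p(1) q(1)]] p q by auto
  qed
  moreover have "lnd_on C \<Delta>"
    unfolding lnd_on_def
  proof (intro conjI ballI)
    fix x assume "x \<in> C"
    then obtain p where p: "PA p" "x = poly p t" using onto' by blast
    show "\<Delta> x \<in> C" using p \<Delta> into' PA_pderiv by auto
    show "\<exists>n>0. (\<Delta> ^^ n) x = 0"
      using pow[OF p(1), of "Suc (degree p)"] nil[of p "Suc (degree p)"] p
      by (intro exI[of _ "Suc (degree p)"]) (simp del: funpow.simps)
    fix y assume "y \<in> C"
    then obtain q where q: "PA q" "y = poly q t" using onto' by blast
    show "\<Delta> (x + y) = \<Delta> x + \<Delta> y"
      using \<Delta>[OF PA(3)[OF p(1) q(1)]] p q \<Delta> by (simp add: pderiv_add)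
    show "\<Delta> (x * y) = x * \<Delta> y + y * \<Delta> x"
      using \<Delta>[OF PA(4)[OF p(1) q(1)]] p q \<Delta> by (simp add: pderiv_mult)
  qed
  moreover have "\<Delta> t = 1" using \<Delta>[OF PA_X] by (simp add: pderiv_pCons)
  ultimately show ?thesis using that t by blast
qed

lemma loc_deg0_alt:
  "loc_deg0 H f e = {to_fract b / to_fract f ^ n | b n. b \<in> H (int n * e)}"
  unfolding loc_deg0_def by (simp add: Fract_conv_to_fract to_fract_power)

context graded_domain
begin

lemma cylindrical_imp_nonrigid_veronese:
  assumes fg: "fg_algebra_over_char0_field TYPE('b)" and cyl: "cylindrical G f"
  shows "\<exists>d\<ge>1. \<not> rigid (V d)"
proof -
  obtain e where f0: "f \<noteq> 0" and e: "e \<noteq> 0" and f: "f \<in> G e"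
    and C: "poly_ring_one_var (loc_deg0 G f e)"
    using cyl by (auto simp: cylindrical_def)
  define C where "C = loc_deg0 G f e"
  define F where "F = to_fract f"
  define d where "d = nat \<bar>e\<bar>"
  have F0: "F \<noteq> 0" using f0 by (simp add: F_def)
  have d: "d > 0" and dvd: "int d dvd i \<longleftrightarrow> e dvd i" for i using e by (auto simp: d_def)
  obtain \<Delta> t where sub: "is_subring C" and \<Delta>: "lnd_on C \<Delta>" and t: "t \<in> C" "\<Delta> t = 1"
    using poly_ring_one_var_lnd[OF C] unfolding C_def by metis
  have C_alt: "C = {to_fract b / F ^ n | b n. b \<in> G (int n * e)}"
    unfolding C_def F_def by (rule loc_deg0_alt)
  \<comment> \<open>Dividing by f^n moves the piece of degree n * e into \<open>C\<close>. The
    Veronese subring may have pieces on both sides of 0, hence the integer exponent.\<close>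
  define \<phi> where "\<phi> n x = to_fract x * F powi (- n)" for n x
  have \<phi>_C: "\<phi> n x \<in> C" if x: "x \<in> G (n * e)" for n x
  proof (cases "n \<ge> 0")
    case True
    then have "\<phi> n x = to_fract x / F ^ nat n" by (simp add: \<phi>_def power_int_def divide_inverse power_inverse)
    then show ?thesis unfolding C_alt using x True
      by (intro CollectI exI[of _ x] exI[of _ "nat n"]) auto
  next
    case False
    then have "\<phi> n x = to_fract (x * f ^ nat (- n)) / F ^ 0"
      by (simp add: \<phi>_def power_int_def to_fract_power F_def)
    moreover have "x * f ^ nat (- n) \<in> G (int 0 * e)"
      using mult_in[OF x power_in[OF f, of "nat (- n)"]] False by simp
    ultimately show ?thesis unfolding C_alt by blast
  qed
  have C_\<phi>: "\<exists>m b. b \<in> G (int m * e) \<and> c = \<phi> (int m) b" if "c \<in> C" for c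
    using that unfolding C_alt \<phi>_def by (auto simp: power_int_minus field_simps)
  have \<phi>_to: "F powi n * \<phi> n x = to_fract x" for n x
    using F0 by (simp add: \<phi>_def power_int_minus)
  have \<phi>_mult: "\<phi> (m + n) (x * y) = \<phi> m x * \<phi> n y" for m n x y
    using F0 by (simp add: \<phi>_def power_int_diff power_int_minus field_simps power_int_add)
  have \<phi>_add: "\<phi> n (x + y) = \<phi> n x + \<phi> n y" for n x y by (simp add: \<phi>_def algebra_simps)
  have \<phi>_0: "\<phi> n x = 0 \<longleftrightarrow> x = 0" for n x using F0 by (simp add: \<phi>_def)
  obtain K S where K: "is_subfield K" and S: "finite S" "ring_gen (K \<union> S) = (UNIV :: 'b set)"
    using fg by (auto simp: fg_algebra_over_char0_field_def)
  note K0 = subfield_in_degree_0[OF K]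
  interpret lnd C \<Delta>
  proof
    fix n :: nat assume "n > 0"
    then obtain y where y: "y \<in> V 0" "of_nat n * y = 1"
      using of_nat_invertible_veronese[OF fg] by blast
    have "y \<in> G 0"
    proof (cases "y = 0")
      case False
      obtain i where i: "y \<in> G i" using unit_homogeneous[of y "of_nat n"] y by (auto simp: mult.commute)
      then show ?thesis using homogeneous_veroneseD[OF y(1) i False] by simp
    qed simp
    then have "\<phi> 0 y \<in> C" using \<phi>_C[of y 0] by simp
    moreover have "of_nat n * \<phi> 0 y = 1"
      using arg_cong[OF y(2), of to_fract] by (simp add: \<phi>_def to_fract_of_nat)
    ultimately show "\<exists>y\<in>C. of_nat n * y = 1" by blast
  qed (fact sub \<Delta>)+
  obtain M where finM: "finite M" and M: "\<And>i m. (i, m) \<in> M \<Longrightarrow> int d dvd i \<and> m \<in> G i"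
    and gen: "\<And>i x. int d dvd i \<Longrightarrow> x \<in> G i \<Longrightarrow> homogeneously_generated d K M i x"
    using veronese_finitely_generated[OF K S d] by metis
  \<comment> \<open>On the piece of degree n * e the extension of d/dt that kills f sends x to f^n *
    \<open>\<Delta>\<close> (x / f^n). \<open>W m n x\<close> says that f^m times this value lies in
    the ring, in degree (n + m) * e.\<close>
  define W where "W m n x \<longleftrightarrow> (\<exists>b\<in>G ((n + int m) * e). to_fract b = F powi (n + int m) * \<Delta> (\<phi> n x))"
    for m n x
  have Wex: "\<exists>m0. \<forall>m\<ge>m0. W m n x" if x: "x \<in> G (n * e)" for n x
  proof -
    obtain l c where c: "c \<in> G (int l * e)" "\<Delta> (\<phi> n x) = \<phi> (int l) c"
      using C_\<phi>[OF D_in[OF \<phi>_C[OF x]]] by blast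
    \<comment> \<open>The exponent of the denominator is l; the threshold makes n + m - l
      nonnegative, so the numerator c is multiplied by a genuine power of f.\<close>
    have "W m n x" if m: "m \<ge> l + nat \<bar>n\<bar>" for m
      unfolding W_def
    proof (rule bexI)
      let ?k = "nat (n + int m - int l)"
      have k: "int ?k = n + int m - int l" using m by auto
      have "F powi (n + int m) = F ^ ?k * F powi (int l)"
        using k F0 by (metis diff_add_cancel power_int_add power_int_of_nat)
      then show "to_fract (f ^ ?k * c) = F powi (n + int m) * \<Delta> (\<phi> n x)"
        using \<phi>_to[of "int l" c] by (simp add: c to_fract_power F_def mult.assoc)
      have "f ^ ?k * c \<in> G (int ?k * e + int l * e)" by (intro mult_in power_in f c)
      also have "int ?k * e + int l * e = (n + int m) * e" unfolding k by (simp add: algebra_simps)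
      finally show "f ^ ?k * c \<in> G ((n + int m) * e)" .
    qed
    then show ?thesis by blast
  qed
  have "\<exists>m0. \<forall>m\<ge>m0. \<forall>p\<in>M. W m (fst p div e) (snd p)"
  proof -
    have "\<exists>m0. \<forall>m\<ge>m0. W m (fst p div e) (snd p)" if "p \<in> M" for p
      by (rule Wex) (use M[of "fst p" "snd p"] that dvd in auto)
    then obtain m0 where "\<And>p m. p \<in> M \<Longrightarrow> m \<ge> m0 p \<Longrightarrow> W m (fst p div e) (snd p)" by metis
    \<comment> \<open>The sum of the finitely many thresholds dominates each of them, so one m
      serves all generators.\<close>
    moreover have "m0 p \<le> sum m0 M" if "p \<in> M" for p using that finM by (simp add: member_le_sum)
    ultimately show ?thesis by (meson order_trans)
  qed
  then obtain m where Wm: "\<And>p. p \<in> M \<Longrightarrow> W m (fst p div e) (snd p)" by blast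
  have Wall: "W m (i div e) x" if "int d dvd i" "x \<in> G i" for i x
    using gen[OF that]
  proof (induction rule: homogeneously_generated.induct)
    case (scalar k)
    have "\<phi> 0 k \<in> C" using \<phi>_C[of k 0] K0 scalar by auto
    have "\<Delta> (\<phi> 0 k) = 0"
    proof (cases "k = 0")
      case False
      then obtain y where y: "y \<in> K" "k * y = 1" using K scalar by (auto simp: is_subfield_def)
      have "\<phi> 0 k * \<phi> 0 y = 1" using y \<phi>_mult[of 0 0 k y] by (simp add: \<phi>_def)
      then show ?thesis using D_unit \<open>\<phi> 0 k \<in> C\<close> \<phi>_C[of y 0] K0 y by auto
    qed (simp add: \<phi>_def)
    then show ?case unfolding W_def by (intro bexI[of _ 0]) auto
  next
    case (gen i g)
    then show ?case using Wm[of "(i, g)"] by simp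
  next
    case (mult i x j y)
    have xy: "e dvd i" "x \<in> G i" "e dvd j" "y \<in> G j"
      using homogeneously_generated_in[OF _ K0 M] mult.hyps dvd by blast+
    then obtain p q where pq: "i = p * e" "j = q * e" by (metis dvd_div_mult_self)
    then have ij: "i div e = p" "j div e = q" "(i + j) div e = p + q"
      using e by (simp_all add: distrib_right[symmetric])
    have C': "\<phi> p x \<in> C" "\<phi> q y \<in> C" using \<phi>_C xy pq by auto
    obtain b where b: "b \<in> G ((p + int m) * e)" "to_fract b = F powi (p + int m) * \<Delta> (\<phi> p x)"
      using mult.IH(1) unfolding W_def ij by blast
    obtain c where c: "c \<in> G ((q + int m) * e)" "to_fract c = F powi (q + int m) * \<Delta> (\<phi> q y)"
      using mult.IH(2) unfolding W_def ij by blast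
    show ?case unfolding W_def ij
    proof (rule bexI)
      have "F powi (p + q + int m) * \<Delta> (\<phi> (p + q) (x * y))
        = (F powi p * \<phi> p x) * (F powi (q + int m) * \<Delta> (\<phi> q y))
         + (F powi q * \<phi> q y) * (F powi (p + int m) * \<Delta> (\<phi> p x))"
        using F0 by (simp add: \<phi>_mult D_mult C' power_int_add algebra_simps)
      then show "to_fract (x * c + y * b) = F powi (p + q + int m) * \<Delta> (\<phi> (p + q) (x * y))"
        by (simp add: \<phi>_to b c)
      show "x * c + y * b \<in> G ((p + q + int m) * e)"
        using mult_in[OF xy(2) c(1)] mult_in[OF xy(4) b(1)] pq
        by (intro add_in) (simp_all add: algebra_simps)
    qed
  next
    case (add i x y)
    have xy: "e dvd i" "x \<in> G i" "y \<in> G i"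
      using homogeneously_generated_in[OF _ K0 M] add.hyps dvd by blast+
    then obtain p where p: "i = p * e" by (metis dvd_div_mult_self)
    then have i: "i div e = p" using e by simp
    obtain b where b: "b \<in> G ((p + int m) * e)" "to_fract b = F powi (p + int m) * \<Delta> (\<phi> p x)"
      using add.IH(1) unfolding W_def i by blast
    obtain c where c: "c \<in> G ((p + int m) * e)" "to_fract c = F powi (p + int m) * \<Delta> (\<phi> p y)"
      using add.IH(2) unfolding W_def i by blast
    show ?case unfolding W_def i
      by (rule bexI[of _ "b + c"])
        (use b c xy p \<phi>_C in \<open>simp_all add: \<phi>_add D_add add_in algebra_simps\<close>)
  next
    case (zero i)
    show ?case unfolding W_def by (rule bexI[of _ 0]) (auto simp: \<phi>_def)
  qed
  \<comment> \<open>The degree index n is unique for nonzero x, and for x = 0 every choice gives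
    0.\<close>
  define \<delta> where "\<delta> x = (THE b. \<exists>n. x \<in> G (n * e) \<and> to_fract b = F powi (n + int m) * \<Delta> (\<phi> n x))" for x
  have \<delta>: "\<delta> x \<in> G ((n + int m) * e) \<and> to_fract (\<delta> x) = F powi (n + int m) * \<Delta> (\<phi> n x)"
    if x: "x \<in> G (n * e)" for n x
  proof -
    obtain b where b: "b \<in> G ((n + int m) * e)" "to_fract b = F powi (n + int m) * \<Delta> (\<phi> n x)"
      using Wall[of "n * e" x] x e unfolding W_def by (auto simp: dvd)
    have "\<delta> x = b" unfolding \<delta>_def
    proof (rule the_equality)
      fix c assume "\<exists>k. x \<in> G (k * e) \<and> to_fract c = F powi (k + int m) * \<Delta> (\<phi> k x)"
      then obtain k where k: "x \<in> G (k * e)" "to_fract c = F powi (k + int m) * \<Delta> (\<phi> k x)" by blast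
      show "c = b"
      proof (cases "x = 0")
        case True
        then have "\<phi> j x = 0" for j by (simp add: \<phi>_def)
        then show ?thesis using b k by simp
      next
        case False
        then have "k = n" using homogeneous_degree_unique[OF k(1) x] e by simp
        then show ?thesis using b(2) k(2) by (metis to_fract_eq_iff)
      qed
    qed (use b x in blast)
    then show ?thesis using b by simp
  qed
  \<comment> \<open>Division by powers of f turns \<delta> into \<open>\<Delta>\<close>, so the
    iterates of \<delta> vanish as soon as those of \<open>\<Delta>\<close> do.\<close>
  have \<phi>\<delta>: "\<phi> (n + int m) (\<delta> x) = \<Delta> (\<phi> n x)" if "x \<in> G (n * e)" for n x
    unfolding \<phi>_def[of "n + int m"] using \<delta>[OF that] F0
    by (simp add: power_int_minus del: minus_add_distrib)
  have pow: "(\<delta> ^^ k) x \<in> G ((n + int k * int m) * e) \<and> \<phi> (n + int k * int m) ((\<delta> ^^ k) x) = (\<Delta> ^^ k) (\<phi> n x)"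
    if "x \<in> G (n * e)" for n x k
  proof (induction k)
    case (Suc k)
    then show ?case using \<delta>[of "(\<delta> ^^ k) x" "n + int k * int m"] \<phi>\<delta>[of "(\<delta> ^^ k) x" "n + int k * int m"]
      by (simp add: algebra_simps)
  qed (use that in simp)
  have cancel: "a = b" if "to_fract a = to_fract b" for a b :: 'b using that by simp
  obtain D where D: "lnd_on (V d) D" "\<And>i x. int d dvd i \<Longrightarrow> x \<in> G i \<Longrightarrow> D x = \<delta> x"
  proof (rule lnd_of_homogeneous_pieces[of d \<delta> "int m * e"])
    fix i x assume "int d dvd i" and x: "x \<in> G i"
    then obtain n where n: "i = n * e" using dvd by (metis dvd_div_mult_self)
    note xn = x[unfolded n]
    show h: "\<delta> x \<in> G (i + int m * e)" using \<delta>[OF xn] by (simp add: n algebra_simps)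
    then show "\<delta> x \<in> V d" by (rule veronese_homogeneous) (simp add: dvd n)
    obtain k where "(\<Delta> ^^ k) (\<phi> n x) = 0" using D_nilpotent[OF \<phi>_C[OF xn]] by blast
    then show "\<exists>k. (\<delta> ^^ k) x = 0" using pow[OF xn, of k] \<phi>_0 by metis
    fix y assume "y \<in> G i"
    then have yn: "y \<in> G (n * e)" by (simp add: n)
    show "\<delta> (x + y) = \<delta> x + \<delta> y"
      by (rule cancel) (simp add: \<delta>[OF xn] \<delta>[OF yn] \<delta>[OF add_in[OF xn yn]] \<phi>_add D_add \<phi>_C[OF xn] \<phi>_C[OF yn] algebra_simps)
  next
    fix i j x y assume "int d dvd i" "int d dvd j" "x \<in> G i" "y \<in> G j"
    then obtain p q where pq: "i = p * e" "j = q * e" using dvd by (metis dvd_div_mult_self)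
    then have x: "x \<in> G (p * e)" and y: "y \<in> G (q * e)" and xy: "x * y \<in> G ((p + q) * e)"
      using \<open>x \<in> G i\<close> \<open>y \<in> G j\<close> mult_in[of x i y j] by (auto simp: algebra_simps)
    have "F powi (p + q + int m) * \<Delta> (\<phi> (p + q) (x * y))
        = (F powi p * \<phi> p x) * (F powi (q + int m) * \<Delta> (\<phi> q y))
         + (F powi q * \<phi> q y) * (F powi (p + int m) * \<Delta> (\<phi> p x))"
      using F0 by (simp add: \<phi>_mult D_mult \<phi>_C[OF x] \<phi>_C[OF y] power_int_add algebra_simps)
    then show "\<delta> (x * y) = x * \<delta> y + y * \<delta> x"
      by (intro cancel) (simp add: \<delta>[OF x] \<delta>[OF y] \<delta>[OF xy] \<phi>_to)
  next
    fix D assume *: "lnd_on (V d) D" "\<And>i x. int d dvd i \<Longrightarrow> x \<in> G i \<Longrightarrow> D x = \<delta> x"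
    show thesis by (rule that[OF *])
  qed
  \<comment> \<open>The numerator b of t witnesses that the derivation is nonzero: from
    \<open>\<Delta> t = 1\<close> its image is f^(l + m).\<close>
  obtain l b where b: "b \<in> G (int l * e)" "t = \<phi> (int l) b" using C_\<phi>[OF t(1)] by blast
  have "to_fract (\<delta> b) \<noteq> 0" using \<delta>[OF b(1)] b(2) t(2) F0 by simp
  then have "D b \<noteq> 0" using D(2)[OF _ b(1)] by (simp add: dvd)
  moreover have "b \<in> V d" by (rule veronese_homogeneous[OF b(1)]) (simp add: dvd)
  ultimately have "\<not> rigid (V d)" using D(1) by (auto simp: rigid_def)
  then show ?thesis using d by (intro exI[of _ d]) auto
qed

end

section \<open>From a derivation to a cylinder\<close>

lemma int_subgroup_mult:
  fixes Z :: "int set"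
  assumes "0 \<in> Z" "\<And>x y. x \<in> Z \<Longrightarrow> y \<in> Z \<Longrightarrow> x + y \<in> Z" "\<And>x. x \<in> Z \<Longrightarrow> - x \<in> Z" "z \<in> Z"
  shows "n * z \<in> Z"
proof -
  have nat: "int k * z \<in> Z" for k
    by (induction k) (use assms in \<open>auto simp: algebra_simps\<close>)
  show ?thesis
  proof (cases "n \<ge> 0")
    case True
    then show ?thesis using nat[of "nat n"] by simp
  next
    case False
    then show ?thesis using assms(3)[OF nat[of "nat (- n)"]] by simp
  qed
qed

lemma subring_poly:
  assumes "is_subring C" "t \<in> C" "\<And>i. coeff p i \<in> C"
  shows "poly p t \<in> C"
  using assms(3)
proof (induction p)
  case (pCons a p)
  have "a \<in> C" "coeff p i \<in> C" for i
    using pCons.prems[of 0] pCons.prems[of "Suc i"] by auto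
  then show ?case using pCons.IH assms(1,2) by (auto simp: is_subring_def)
qed (use assms in \<open>auto simp: is_subring_def\<close>)

text \<open>The family \<open>H\<close> is abstract because the lemma serves both the pieces of the
  ring and those of the kernel.\<close>

lemma subring_loc_deg0:
  fixes H :: "int \<Rightarrow> 'b::idom set"
  assumes H: "\<And>i. 0 \<in> H i" "1 \<in> H 0" "\<And>i x y. x \<in> H i \<Longrightarrow> y \<in> H i \<Longrightarrow> x + y \<in> H i"
      "\<And>i x. x \<in> H i \<Longrightarrow> - x \<in> H i" "\<And>i j x y. x \<in> H i \<Longrightarrow> y \<in> H j \<Longrightarrow> x * y \<in> H (i + j)"
    and f: "f \<in> H e" "f \<noteq> 0"
  shows "is_subring (loc_deg0 H f e)"
proof -
  have pow: "f ^ n \<in> H (int n * e)" for n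
  proof (induction n)
    case (Suc n)
    then show ?case using H(5)[OF f(1) Suc] by (simp add: algebra_simps)
  qed (use H in simp)
  have I: "x \<in> loc_deg0 H f e" if "b \<in> H (int n * e)" "x = to_fract b / to_fract f ^ n" for x b n
    using that unfolding loc_deg0_def by (auto simp: Fract_conv_to_fract to_fract_power)
  have E: "\<exists>b n. b \<in> H (int n * e) \<and> x = to_fract b / to_fract f ^ n" if "x \<in> loc_deg0 H f e" for x
    using that unfolding loc_deg0_def by (auto simp: Fract_conv_to_fract to_fract_power)
  show ?thesis unfolding is_subring_def
  proof (intro conjI ballI)
    show "0 \<in> loc_deg0 H f e" by (rule I[of 0 0]) (use H in auto)
    show "1 \<in> loc_deg0 H f e" by (rule I[of 1 0]) (use H in auto)
    fix x assume "x \<in> loc_deg0 H f e"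
    then obtain b n where b: "b \<in> H (int n * e)" "x = to_fract b / to_fract f ^ n" using E by blast
    show "- x \<in> loc_deg0 H f e" by (rule I[of "- b" n]) (use b H in auto)
    fix y assume "y \<in> loc_deg0 H f e"
    then obtain c m where c: "c \<in> H (int m * e)" "y = to_fract c / to_fract f ^ m" using E by blast
    show "x + y \<in> loc_deg0 H f e"
    proof (rule I)
      show "b * f ^ m + c * f ^ n \<in> H (int (n + m) * e)"
        using H(3)[OF H(5)[OF b(1) pow[of m]], of "c * f ^ n"] H(5)[OF c(1) pow[of n]]
        by (simp add: algebra_simps)
      show "x + y = to_fract (b * f ^ m + c * f ^ n) / to_fract f ^ (n + m)"
        using f by (simp add: b c to_fract_power field_simps power_add)
    qed
    show "x * y \<in> loc_deg0 H f e"
    proof (rule I)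
      show "b * c \<in> H (int (n + m) * e)" using H(5)[OF b(1) c(1)] by (simp add: algebra_simps)
      show "x * y = to_fract (b * c) / to_fract f ^ (n + m)" by (simp add: b c power_add)
    qed
  qed
qed

text \<open>Applying D exactly n * dg x times kills all terms of exponent below n and turns the last
  one into c n times a nonzero element.\<close>

lemma (in lnd) ker_independent:
  assumes x: "x \<in> S" "D x \<noteq> 0"
  shows "(\<And>l. l < n \<Longrightarrow> c l \<in> S \<and> D (c l) = 0) \<Longrightarrow> (\<Sum>l<n. c l * x ^ l) = 0 \<Longrightarrow> l < n \<Longrightarrow> c l = 0"
proof (induction n arbitrary: l)
  case (Suc n)
  have x0: "x \<noteq> 0" using x by auto
  have dgx: "dg x > 0" using x dg_eq_0_iff by (metis gr0I)
  let ?k = "n * dg x"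
  have c: "c l \<in> S" "D (c l) = 0" if "l \<le> n" for l using Suc.prems(1)[of l] that by auto
  have "(D ^^ ?k) (c l * x ^ l) = 0" if "l < n" for l
  proof -
    have "Suc (dg (x ^ l)) \<le> ?k"
      using mult_le_mono1[of "Suc l" n "dg x"] that dgx by (simp add: dg_power x x0)
    then have "(D ^^ ?k) (x ^ l) = 0" using dg_Suc[of "x ^ l"] funpow_eq_0_mono S_power x(1) by blast
    then show ?thesis using c[of l] that by (simp add: funpow_mult_ker S_power x)
  qed
  then have "(D ^^ ?k) (\<Sum>l<Suc n. c l * x ^ l) = (D ^^ ?k) (c n * x ^ n)"
    by (subst funpow_sum) (auto intro!: S_intros c x)
  then have "c n * (D ^^ ?k) (x ^ n) = 0"
    using Suc.prems(2) c[of n] by (simp add: funpow_mult_ker S_power x)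
  moreover have "(D ^^ ?k) (x ^ n) \<noteq> 0" using dg_nonzero[of "x ^ n"] dg_power[OF x(1) x0] x0 by simp
  ultimately have "c n = 0" by simp
  then show ?case using Suc.IH[of l] Suc.prems by (cases "l = n") auto
qed simp

section \<open>Homogeneous derivations: graded kernel, slice expansion and cylinders\<close>

locale homogeneous_lnd = graded_domain G + lnd "veronese G d" D
  for G :: "int \<Rightarrow> 'b::idom set" and d D +
  fixes N :: int
  assumes D_homogeneous: "int d dvd i \<Longrightarrow> x \<in> G i \<Longrightarrow> D x \<in> G (i + N)"
    and d_pos: "d > 0"
begin

lemma D_degree: "x \<in> V d \<Longrightarrow> x \<in> G i \<Longrightarrow> D x \<in> G (i + N)"
  using D_homogeneous homogeneous_veroneseD by (cases "x = 0") auto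

lemma funpow_degree: "x \<in> V d \<Longrightarrow> x \<in> G i \<Longrightarrow> (D ^^ n) x \<in> G (i + int n * N)"
proof (induction n)
  case (Suc n)
  then show ?case using D_degree[of "(D ^^ n) x" "i + int n * N"] funpow_in by (simp add: algebra_simps)
qed simp

definition Ker :: "int \<Rightarrow> 'b set" where "Ker i = {x \<in> V d. x \<in> G i \<and> D x = 0}"

lemma KerD: "x \<in> Ker i \<Longrightarrow> x \<in> V d" "x \<in> Ker i \<Longrightarrow> x \<in> G i" "x \<in> Ker i \<Longrightarrow> D x = 0"
  by (auto simp: Ker_def)

lemma Ker_0 [simp]: "0 \<in> Ker i" and Ker_1 [simp]: "1 \<in> Ker 0"
  and Ker_add: "x \<in> Ker i \<Longrightarrow> y \<in> Ker i \<Longrightarrow> x + y \<in> Ker i"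
  and Ker_uminus: "x \<in> Ker i \<Longrightarrow> - x \<in> Ker i"
  and Ker_mult: "x \<in> Ker i \<Longrightarrow> y \<in> Ker j \<Longrightarrow> x * y \<in> Ker (i + j)"
  by (auto simp: Ker_def D_add D_mult D_uminus intro: S_intros S_uminus add_in uminus_in mult_in)

lemma Ker_power: "x \<in> Ker i \<Longrightarrow> x ^ n \<in> Ker (int n * i)"
  by (induction n) (auto simp: algebra_simps dest: Ker_mult[of x i])

text \<open>The inverse of an integer is a unit, hence homogeneous and killed by D; its degree is 0
  because integers have degree 0. This allows division by n! without leaving the graded
  kernel.\<close>

lemma inverse_of_nat_Ker:
  assumes "n > 0"
  shows "\<exists>y\<in>Ker 0. of_nat n * y = 1"
proof -
  obtain y where y: "y \<in> V d" "of_nat n * y = 1" using of_nat_invertible assms by blast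
  then obtain i where i: "y \<in> G i" using unit_homogeneous[of y "of_nat n"] by (auto simp: mult.commute)
  have "(of_nat n * y) \<in> G (0 + i)" using i by (intro mult_in of_nat_in)
  then have "i = 0" using homogeneous_degree_unique[of 1 0 "0 + i"] y by simp
  moreover have "D y = 0" using D_unit[of y "of_nat n"] y S_of_nat by (simp add: mult.commute)
  ultimately show ?thesis using y i by (auto simp: Ker_def)
qed

lemma funpow_slice_power:
  assumes s: "s \<in> V d" and a: "D (D s) = 0"
  shows "(D ^^ n) (s ^ n) = of_nat (fact n) * D s ^ n"
proof (induction n)
  case (Suc n)
  have "D (s ^ Suc n) = (of_nat (Suc n) * D s) * s ^ n"
    using D_power[OF s, of "Suc n"] by (simp add: algebra_simps)
  then have "(D ^^ Suc n) (s ^ Suc n) = (D ^^ n) ((of_nat (Suc n) * D s) * s ^ n)"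
    by (simp only: funpow_Suc_right o_apply)
  also have "\<dots> = (of_nat (Suc n) * D s) * (D ^^ n) (s ^ n)"
    by (rule funpow_mult_ker) (use s a D_mult[OF S_of_nat D_in[OF s]] in \<open>auto intro!: S_mult S_of_nat S_power D_in simp del: of_nat_Suc\<close>)
  finally show ?case using Suc by (simp add: algebra_simps)
qed simp

text \<open>A Taylor expansion in the local slice s. Since D^n (s^n) = n! * (D s)^n is a kernel
  element, a kernel multiple of s^n cancels the last derivative of (D s)^n * b. Each such step costs
  a power of D s, collected in \<open>M\<close>; the degrees of the coefficients later decide which
  powers of s can occur.\<close>

lemma slice_expansion:
  assumes s: "s \<in> V d" "s \<in> G m" and a: "D (D s) = 0"
  shows "b \<in> V d \<Longrightarrow> b \<in> G j \<Longrightarrow> (D ^^ n) b = 0 \<Longrightarrow>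
    \<exists>M c. (\<forall>i<n. c i \<in> Ker (j + int M * (m + N) - int i * m)) \<and>
      D s ^ M * b = (\<Sum>i<n. c i * s ^ i)"
proof (induction n arbitrary: b j)
  case (Suc n)
  define c0 where "c0 = (D ^^ n) b"
  have c0: "c0 \<in> Ker (j + int n * N)"
    using Suc.prems funpow_degree funpow_in by (auto simp: Ker_def c0_def)
  obtain q where q: "q \<in> Ker 0" "of_nat (fact n) * q = 1"
    using inverse_of_nat_Ker[of "fact n"] by auto
  have as: "D s \<in> Ker (m + N)" using D_in D_degree s a by (auto simp: Ker_def)
  note pow = Ker_power[OF as]
  \<comment> \<open>Here \<open>q\<close> is 1 / n! and \<open>c0\<close> is D^n b, so both terms
    have the same n-th derivative.\<close>
  define b' where "b' = D s ^ n * b - (q * c0) * s ^ n"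
  have qc: "q * c0 \<in> Ker (j + int n * N)" using Ker_mult[OF q(1) c0] by simp
  have "(q * c0) * s ^ n \<in> G (j + int n * N + int n * m)" by (intro mult_in power_in KerD(2)[OF qc] s)
  moreover have "D s ^ n * b \<in> G (int n * (m + N) + j)" by (intro mult_in KerD(2)[OF pow] Suc.prems)
  ultimately have b'G: "b' \<in> G (j + int n * (m + N))"
    unfolding b'_def by (intro diff_in) (simp_all add: algebra_simps)
  have b'V: "b' \<in> V d" unfolding b'_def by (intro S_intros KerD(1)[OF qc] D_in s Suc.prems)
  have "(D ^^ n) b' = D s ^ n * c0 - (q * c0) * (of_nat (fact n) * D s ^ n)"
  proof -
    have "(D ^^ n) (D s ^ n * b) = D s ^ n * c0"
      unfolding c0_def by (rule funpow_mult_ker[OF KerD(1)[OF pow] KerD(3)[OF pow] Suc.prems(1)])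
    moreover have "(D ^^ n) ((q * c0) * s ^ n) = (q * c0) * (of_nat (fact n) * D s ^ n)"
      using funpow_mult_ker[OF KerD(1)[OF qc] KerD(3)[OF qc] S_power[OF s(1)]] funpow_slice_power[OF s(1) a]
      by metis
    ultimately show ?thesis unfolding b'_def
      by (subst funpow_diff) (auto intro!: S_intros KerD(1)[OF qc] D_in s Suc.prems(1))
  qed
  also have "\<dots> = (1 - of_nat (fact n) * q) * (D s ^ n * c0)" by (simp add: algebra_simps)
  finally have "(D ^^ n) b' = 0" using q by simp
  then obtain M c where c: "\<And>i. i < n \<Longrightarrow> c i \<in> Ker (j + int n * (m + N) + int M * (m + N) - int i * m)"
    and sum: "D s ^ M * b' = (\<Sum>i<n. c i * s ^ i)"
    using Suc.IH[OF b'V b'G] by blast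
  define c' where "c' i = (if i < n then c i else D s ^ M * (q * c0))" for i
  have "D s ^ (M + n) * b = D s ^ M * b' + (D s ^ M * (q * c0)) * s ^ n"
    by (simp add: b'_def algebra_simps power_add)
  also have "\<dots> = (\<Sum>i<Suc n. c' i * s ^ i)" by (simp add: sum c'_def)
  finally have "D s ^ (M + n) * b = (\<Sum>i<Suc n. c' i * s ^ i)" .
  moreover have "c' i \<in> Ker (j + int (M + n) * (m + N) - int i * m)" if "i < Suc n" for i
  proof (cases "i < n")
    case True
    then show ?thesis using c[OF True] by (simp add: c'_def algebra_simps)
  next
    case False
    then have "i = n" using that by simp
    then show ?thesis using Ker_mult[OF pow[of M] qc] by (simp add: c'_def algebra_simps)
  qed
  ultimately show ?case by blast
qed (auto intro: exI[of _ 0])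

text \<open>The slice s may have nonzero degree, so a power of it is corrected by a ratio of kernel
  elements. The least exponent \<open>i0\<close> that admits such a correction divides every
  exponent of s occurring in a degree-0 element, and this is why no other powers of s are
  needed.\<close>

lemma cylindrical_of_kernel_element:
  assumes s: "s \<in> V d" "s \<in> G m" and Ds: "D s \<noteq> 0" "D (D s) = 0"
    and w: "w \<in> Ker k" "w \<noteq> 0" "k \<noteq> 0"
  shows "\<exists>f. cylindrical G f"
proof -
  let ?a = "D s"
  have a: "?a \<in> Ker (m + N)" using D_in D_degree s Ds by (auto simp: Ker_def)
  define E where "E = {i. \<exists>c\<in>Ker i. c \<noteq> 0}"
  have E: "0 \<in> E" "\<And>i j. i \<in> E \<Longrightarrow> j \<in> E \<Longrightarrow> i + j \<in> E" "k \<in> E"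
  proof -
    show "0 \<in> E" unfolding E_def using Ker_1 zero_neq_one by (metis (mono_tags, lifting) mem_Collect_eq)
    show "k \<in> E" unfolding E_def using w by blast
    fix i j assume "i \<in> E" "j \<in> E"
    then obtain x y where "x \<in> Ker i" "y \<in> Ker j" "x \<noteq> 0" "y \<noteq> 0" unfolding E_def by blast
    then show "i + j \<in> E" unfolding E_def using Ker_mult[of x i y j] by (intro CollectI bexI[of _ "x * y"]) auto
  qed
  \<comment> \<open>The group generated by the semigroup \<open>E\<close> of kernel degrees, that
    is, the degrees of ratios of homogeneous kernel elements.\<close>
  define Z where "Z = {i - j | i j. i \<in> E \<and> j \<in> E}"
  have Z0: "0 \<in> Z" and EZ: "\<And>i. i \<in> E \<Longrightarrow> i \<in> Z"
    unfolding Z_def using E(1) by (metis (mono_tags, lifting) diff_0_right mem_Collect_eq)+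
  have Zneg: "- x \<in> Z" if xZ: "x \<in> Z" for x
  proof -
    obtain i j where "x = i - j" "i \<in> E" "j \<in> E" using xZ unfolding Z_def by blast
    then show ?thesis unfolding Z_def by (intro CollectI exI[of _ j] exI[of _ i]) auto
  qed
  have Zadd: "x + y \<in> Z" if x: "x \<in> Z" and y: "y \<in> Z" for x y
  proof -
    obtain i j i' j' where "x = i - j" "y = i' - j'" "i \<in> E" "j \<in> E" "i' \<in> E" "j' \<in> E"
      using x y unfolding Z_def by blast
    then show ?thesis unfolding Z_def using E(2)
      by (intro CollectI exI[of _ "i + i'"] exI[of _ "j + j'"]) auto
  qed
  have Zmult: "n * z \<in> Z" if "z \<in> Z" for n z
    by (rule int_subgroup_mult) (use Z0 Zadd Zneg that in auto)
  define I where "I n \<longleftrightarrow> n > 0 \<and> - (int n * m) \<in> Z" for n :: nat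
  \<comment> \<open>A positive exponent exists because |k| * m is a multiple of the nonzero kernel
    degree k.\<close>
  have "I (nat \<bar>k\<bar>)"
  proof -
    have "- (int (nat \<bar>k\<bar>) * m) = - (sgn k * m) * k" by (cases "k \<ge> 0") (auto simp: sgn_if)
    then show ?thesis
      unfolding I_def using Zmult[OF EZ[OF E(3)], of "- (sgn k * m)"] w(3) by (simp only:) simp
  qed
  define i0 where "i0 = (LEAST n. I n)"
  have i0: "i0 > 0" "- (int i0 * m) \<in> Z"
    using LeastI[of I, OF \<open>I (nat \<bar>k\<bar>)\<close>] unfolding i0_def I_def by auto
  have i0_dvd: "i0 dvd n" if "- (int n * m) \<in> Z" for n
  proof (rule ccontr)
    assume "\<not> i0 dvd n"
    then have r: "n mod i0 > 0" "n mod i0 < i0" using i0 by (auto simp: dvd_eq_mod_eq_0)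
    have "int n = int i0 * int (n div i0) + int (n mod i0)" by (metis mult_div_mod_eq of_nat_add of_nat_mult)
    then have "- (int (n mod i0) * m) = - (int n * m) + - (int (n div i0) * (- (int i0 * m)))"
      by (simp add: algebra_simps)
    also have "\<dots> \<in> Z" by (intro Zadd Zneg Zmult that i0)
    finally have "I (n mod i0)" using r by (simp add: I_def)
    then show False using not_less_Least r(2) unfolding i0_def by blast
  qed
  obtain j j' h h' where hh: "h \<in> Ker j" "h \<noteq> 0" "h' \<in> Ker j'" "h' \<noteq> 0" and jj: "- (int i0 * m) = j - j'"
    using i0(2) unfolding Z_def E_def by blast
  \<comment> \<open>The product of D s, h and h' may have degree 0; in that case the factor w
    corrects the degree of f.\<close>
  obtain v kv where v: "v \<in> Ker kv" "v \<noteq> 0" "m + N + j + j' + kv \<noteq> 0"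
  proof (cases "m + N + j + j' = 0")
    case True
    then show ?thesis using that[of w k] w by simp
  next
    case False
    then show ?thesis using that[of 1 0] by simp
  qed
  define f where "f = ?a * h * h' * v"
  define e where "e = m + N + j + j' + kv"
  have f: "f \<in> Ker e" "f \<noteq> 0" unfolding f_def e_def using hh v Ds by (auto intro!: Ker_mult a)
  \<comment> \<open>These are the cofactors of D s, h and h' in f. Thus 1 / h is u2 / f, and
    similarly for the others.\<close>
  define u1 where "u1 = h * h' * v"
  define u2 where "u2 = ?a * h' * v"
  define u3 where "u3 = ?a * h * v"
  have u1: "u1 \<in> Ker (e - (m + N))" "f = ?a * u1"
    using Ker_mult[OF Ker_mult[OF hh(1) hh(3)] v(1)] by (simp_all add: f_def u1_def e_def algebra_simps)
  have u2: "u2 \<in> Ker (e - j)" "f = h * u2"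
    using Ker_mult[OF Ker_mult[OF a hh(3)] v(1)] by (simp_all add: f_def u2_def e_def algebra_simps)
  have u3: "u3 \<in> Ker (e - j')" "f = h' * u3"
    using Ker_mult[OF Ker_mult[OF a hh(1)] v(1)] by (simp_all add: f_def u3_def e_def algebra_simps)
  define F where "F = to_fract f"
  have F0: "F \<noteq> 0" using f by (simp add: F_def)
  define T where "T = to_fract (s ^ i0) * to_fract h / to_fract h'"
  define C where "C = loc_deg0 G f e"
  define A where "A = loc_deg0 Ker f e"
  have loc: "loc_deg0 H f e = {to_fract b / F ^ n | b n. b \<in> H (int n * e)}" for H
    unfolding F_def by (rule loc_deg0_alt)
  have subA: "is_subring A" unfolding A_def
    by (rule subring_loc_deg0) (use f Ker_add Ker_uminus Ker_mult in auto)
  have subC: "is_subring C" unfolding C_def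
    by (rule subring_loc_deg0) (use f KerD(2)[OF f(1)] add_in uminus_in mult_in in auto)
  have AC: "A \<subseteq> C" unfolding A_def C_def loc using KerD(2) by blast
  have TC: "T \<in> C"
  proof -
    have "u3 * h * s ^ i0 \<in> G (e - j' + j + int i0 * m)"
      by (intro mult_in power_in s KerD(2)[OF u3(1)] KerD(2)[OF hh(1)])
    then have "u3 * h * s ^ i0 \<in> G (int 1 * e)" using jj by (simp add: algebra_simps)
    moreover have "T = to_fract (u3 * h * s ^ i0) / F ^ 1"
      using hh(4) F0 by (simp add: T_def F_def u3(2) field_simps)
    ultimately show ?thesis unfolding C_def loc by blast
  qed
  have onto: "\<exists>p. (\<forall>i. coeff p i \<in> A) \<and> x = poly p T" if xC: "x \<in> C" for x
  proof -
    obtain b n where b: "b \<in> G (int n * e)" and x: "x = to_fract b / F ^ n"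
      using xC unfolding C_def loc by blast
    have "b \<in> V d"
    proof (rule veronese_homogeneous[OF b])
      show "int d dvd int n * e" using homogeneous_veroneseD[OF KerD(1)[OF f(1)] KerD(2)[OF f(1)] f(2)] by simp
    qed
    moreover obtain L where "(D ^^ L) b = 0" using D_nilpotent[OF \<open>b \<in> V d\<close>] by blast
    ultimately obtain M c where c: "\<And>i. i < L \<Longrightarrow> c i \<in> Ker (int n * e + int M * (m + N) - int i * m)"
      and sum: "?a ^ M * b = (\<Sum>i<L. c i * s ^ i)"
      using slice_expansion[OF s Ds(2) _ b] by blast
    \<comment> \<open>The coefficients are continued by 0 because the exponents i0 * l with l < L
      may exceed L.\<close>
    define c' where "c' i = (if i < L then u1 ^ M * c i else 0)" for i
    have c': "c' i \<in> Ker (int (n + M) * e - int i * m)" for i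
      using Ker_mult[OF Ker_power[OF u1(1), of M] c[of i]] by (simp add: c'_def algebra_simps)
    have fb: "f ^ M * b = (\<Sum>i<L. c' i * s ^ i)"
    proof -
      have "f ^ M * b = u1 ^ M * (?a ^ M * b)" by (simp add: u1(2) power_mult_distrib)
      then show ?thesis by (simp add: sum sum_distrib_left c'_def mult.assoc)
    qed
    \<comment> \<open>A nonzero coefficient at s^i has degree (n + M) * e - i * m. As e is a kernel
      degree too, i * m lies in \<open>Z\<close>, and minimality of \<open>i0\<close> gives
      divisibility.\<close>
    have c'0: "c' i = 0" if "\<not> i0 dvd i" for i
    proof (rule ccontr)
      assume "c' i \<noteq> 0"
      then have 1: "int (n + M) * e - int i * m \<in> E" using c' by (auto simp: E_def)
      have 2: "e \<in> Z" using f EZ by (auto simp: E_def)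
      have "- (int i * m) = (int (n + M) * e - int i * m) + - (int (n + M) * e)" by simp
      also have "\<dots> \<in> Z" by (intro Zadd Zneg Zmult EZ 1 2)
      finally show False using i0_dvd that by blast
    qed
    \<comment> \<open>This is c' (i0 * l) * (h' / h)^l / f^(n + M), with 1 / h written as u2 /
      f.\<close>
    define \<beta> where "\<beta> l = to_fract (c' (i0 * l) * h' ^ l * u2 ^ l) / F ^ (n + M + l)" for l
    have \<beta>A: "\<beta> l \<in> A" for l
    proof -
      have "c' (i0 * l) * h' ^ l * u2 ^ l \<in> Ker (int (n + M) * e - int (i0 * l) * m + int l * j' + int l * (e - j))"
        by (intro Ker_mult Ker_power c' hh u2)
      also have "int (n + M) * e - int (i0 * l) * m + int l * j' + int l * (e - j)
        = int (n + M) * e + int l * (- (int i0 * m)) + int l * j' + int l * (e - j)" by (simp add: algebra_simps)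
      also have "\<dots> = int (n + M + l) * e" unfolding jj by (simp add: algebra_simps)
      finally show ?thesis unfolding A_def loc \<beta>_def by blast
    qed
    have \<beta>T: "\<beta> l * T ^ l = to_fract (c' (i0 * l) * s ^ (i0 * l)) / F ^ (n + M)" for l
    proof -
      have "F ^ l = to_fract h ^ l * to_fract u2 ^ l" by (simp add: F_def u2(2) power_mult_distrib)
      then show ?thesis using F0 hh(2,4) u2(2) f(2)
        by (simp add: \<beta>_def T_def to_fract_power power_mult power_add power_mult_distrib field_simps)
    qed
    define p where "p = (\<Sum>l<L. monom (\<beta> l) l)"
    have "coeff p i \<in> A" for i
      using \<beta>A subA by (simp add: p_def coeff_sum is_subring_def)
    moreover have "x = poly p T"
    proof -
      have "(\<Sum>l<L. c' (i0 * l) * s ^ (i0 * l)) = (\<Sum>i\<in>(\<lambda>l. i0 * l) ` {..<L}. c' i * s ^ i)"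
        using i0(1) by (subst sum.reindex) (auto simp: inj_on_def)
      also have "\<dots> = (\<Sum>i<L. c' i * s ^ i)"
      proof (rule sum.mono_neutral_cong)
        show "c' i * s ^ i = 0" if "i \<in> {..<L} - (\<lambda>l. i0 * l) ` {..<L}" for i
        proof -
          have "\<not> i0 dvd i"
          proof
            assume "i0 dvd i"
            then obtain l where l: "i = i0 * l" by blast
            then have "l \<le> i" using i0(1) by simp
            moreover have "i < L" using that by simp
            ultimately have "l < L" by linarith
            then have "i \<in> (\<lambda>l. i0 * l) ` {..<L}" using that l by (intro image_eqI[of _ _ l]) auto
            then show False using that by blast
          qed
          then show ?thesis using c'0 by simp
        qed
        show "c' i * s ^ i = 0" if "i \<in> (\<lambda>l. i0 * l) ` {..<L} - {..<L}" for i
          using that by (simp add: c'_def)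
      qed auto
      finally have *: "(\<Sum>l<L. c' (i0 * l) * s ^ (i0 * l)) = f ^ M * b" by (simp add: fb)
      have "poly p T = (\<Sum>l<L. \<beta> l * T ^ l)" by (simp add: p_def poly_sum poly_monom)
      also have "\<dots> = to_fract (\<Sum>l<L. c' (i0 * l) * s ^ (i0 * l)) / F ^ (n + M)"
        by (simp add: \<beta>T to_fract_sum sum_divide_distrib)
      also have "\<dots> = x" unfolding * using F0 by (simp add: x to_fract_power F_def power_add)
      finally show ?thesis by simp
    qed
    ultimately show ?thesis by blast
  qed
  have indep: "p = 0" if pA: "\<forall>i. coeff p i \<in> A" and p0: "poly p T = 0" for p
  proof -
    have "\<forall>i. \<exists>c n. c \<in> Ker (int n * e) \<and> coeff p i = to_fract c / F ^ n"
      using pA unfolding A_def loc by blast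
    then obtain c n where c: "\<And>i. c i \<in> Ker (int (n i) * e)" "\<And>i. coeff p i = to_fract (c i) / F ^ n i"
      by metis
    define L where "L = Suc (degree p)"
    define n' where "n' = sum n {..<L}"
    have n': "n i \<le> n'" if "i < L" for i unfolding n'_def by (rule member_le_sum) (use that in auto)
    \<comment> \<open>The coefficient of (s^i0)^i after multiplying the relation by f^n' * h'^L: the
      first factor clears the denominators of all coefficients, the second those of the powers of
      \<open>T\<close>.\<close>
    define g where "g i = c i * f ^ (n' - n i) * h ^ i * h' ^ (L - i)" for i
    have fK: "f \<in> V d" "D f = 0" "\<And>i. c i \<in> V d" "\<And>i. D (c i) = 0"
      using KerD f c(1) by blast+
    have kp: "x ^ i \<in> V d \<and> D (x ^ i) = 0" if "x \<in> V d" "D x = 0" for x i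
      using that D_power[of x i] by (auto intro: S_power)
    have km: "x * y \<in> V d \<and> D (x * y) = 0" if "x \<in> V d \<and> D x = 0" "y \<in> V d \<and> D y = 0" for x y
      using that by (auto intro: S_mult simp: D_mult)
    have g: "g i \<in> V d \<and> D (g i) = 0" for i
      unfolding g_def by (intro km kp fK conjI KerD[OF hh(1)] KerD[OF hh(3)])
    have gT: "to_fract (g i * (s ^ i0) ^ i) = F ^ n' * to_fract h' ^ L * (coeff p i * T ^ i)" if "i < L" for i
    proof -
      have 1: "F ^ n' = F ^ n i * F ^ (n' - n i)" using n'[OF that] by (simp flip: power_add)
      have 2: "to_fract h' ^ L = to_fract h' ^ i * to_fract h' ^ (L - i)" using that by (simp flip: power_add)
      show ?thesis unfolding 1 2 g_def c(2) T_def
        using F0 hh(4) by (simp add: to_fract_power F_def power_mult_distrib power_divide)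
    qed
    have "to_fract (\<Sum>i<L. g i * (s ^ i0) ^ i) = F ^ n' * to_fract h' ^ L * (\<Sum>i<L. coeff p i * T ^ i)"
      by (simp add: to_fract_sum gT sum_distrib_left del: to_fract_mult)
    also have "(\<Sum>i<L. coeff p i * T ^ i) = poly p T"
      by (simp add: poly_altdef L_def lessThan_Suc_atMost)
    finally have sum0: "(\<Sum>i<L. g i * (s ^ i0) ^ i) = 0"
      unfolding p0 mult_zero_right to_fract_eq_0_iff .
    have "D (s ^ i0) \<noteq> 0"
      using D_power[OF s(1), of i0] Ds of_nat_neq_0[OF i0(1)] by auto
    then have "g i = 0" if "i < L" for i
      using ker_independent[OF S_power[OF s(1)] _ g sum0 that] by blast
    then have "c i = 0" if "i < L" for i using that f(2) hh by (simp add: g_def)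
    then have "coeff p i = 0" if "i < L" for i using c(2)[of i] that by simp
    then show "p = 0" by (metis L_def leading_coeff_0_iff lessI)
  qed
  have "poly_ring_one_var C"
    unfolding poly_ring_one_var_def
    using subA AC TC subring_poly[OF subC TC] onto indep
    by (intro exI[of _ A] exI[of _ T]) blast
  then have "cylindrical G f" unfolding cylindrical_def
    using f KerD(2)[OF f(1)] v(3) by (auto simp: C_def e_def)
  then show ?thesis by blast
qed

end

section \<open>Linear algebra over a subfield and the transcendence degree bound\<close>

lemma homogeneous_system_nontrivial_solution:
  fixes F :: "'a::field set"
  assumes F: "is_subring F" "\<And>x. x \<in> F \<Longrightarrow> inverse x \<in> F"
  shows "finite J \<Longrightarrow> finite I \<Longrightarrow> card J < card I \<Longrightarrow> (\<And>i j. i \<in> I \<Longrightarrow> j \<in> J \<Longrightarrow> M i j \<in> F) \<Longrightarrow>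
    \<exists>c. (\<forall>i\<in>I. c i \<in> F) \<and> (\<exists>i\<in>I. c i \<noteq> 0) \<and> (\<forall>j\<in>J. (\<Sum>i\<in>I. c i * M i j) = 0)"
proof (induction J arbitrary: I M rule: finite_induct)
  case empty
  then obtain i where "i \<in> I" by fastforce
  then show ?case using F by (intro exI[of _ "\<lambda>_. 1"]) (auto simp: is_subring_def)
next
  case (insert j J)
  have F': "0 \<in> F" "\<And>x y. x \<in> F \<Longrightarrow> y \<in> F \<Longrightarrow> x + y \<in> F" "\<And>x y. x \<in> F \<Longrightarrow> y \<in> F \<Longrightarrow> x * y \<in> F"
      "\<And>x. x \<in> F \<Longrightarrow> - x \<in> F" using F(1) by (auto simp: is_subring_def)
  have Fsum: "sum f A \<in> F" if "\<And>i. i \<in> A \<Longrightarrow> f i \<in> F" for f A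
    using that by (induction A rule: infinite_finite_induct) (auto simp: F')
  have Fdiv: "x / y \<in> F" if "x \<in> F" "y \<in> F" for x y
    using that F F' by (simp add: divide_inverse)
  show ?case
  proof (cases "\<forall>i\<in>I. M i j = 0")
    case True
    then have "\<exists>c. (\<forall>i\<in>I. c i \<in> F) \<and> (\<exists>i\<in>I. c i \<noteq> 0) \<and> (\<forall>j\<in>J. (\<Sum>i\<in>I. c i * M i j) = 0)"
      using insert by (intro insert.IH) auto
    then show ?thesis using True by auto
  next
    case False
    then obtain i0 where i0: "i0 \<in> I" "M i0 j \<noteq> 0" by blast
    define I' where "I' = I - {i0}"
    have I': "I = insert i0 I'" "i0 \<notin> I'" "finite I'" using i0 insert by (auto simp: I'_def)
    \<comment> \<open>Gaussian elimination with pivot \<open>M i0 j\<close>: equation j determines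
      the unknown at \<open>i0\<close>, and substituting it into the other equations changes their
      coefficients to \<open>M'\<close>.\<close>
    define M' where "M' i k = M i k - M i j / M i0 j * M i0 k" for i k
    have "\<exists>c. (\<forall>i\<in>I'. c i \<in> F) \<and> (\<exists>i\<in>I'. c i \<noteq> 0) \<and> (\<forall>k\<in>J. (\<Sum>i\<in>I'. c i * M' i k) = 0)"
    proof (rule insert.IH)
      show "card J < card I'" using insert I' by simp
      show "M' i k \<in> F" if "i \<in> I'" "k \<in> J" for i k
        unfolding M'_def diff_conv_add_uminus
        by (intro F' Fdiv insert.prems) (use that i0 I' in auto)
    qed (use I' in auto)
    then obtain c where c: "\<And>i. i \<in> I' \<Longrightarrow> c i \<in> F" "\<exists>i\<in>I'. c i \<noteq> 0"
      "\<And>k. k \<in> J \<Longrightarrow> (\<Sum>i\<in>I'. c i * M' i k) = 0" by blast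
    define c0 where "c0 = - (\<Sum>i\<in>I'. c i * (M i j / M i0 j))"
    define c' where "c' = c(i0 := c0)"
    have c'I: "(\<Sum>i\<in>I. c' i * M i k) = c0 * M i0 k + (\<Sum>i\<in>I'. c i * M i k)" for k
      using I' by (auto simp: c'_def intro!: sum.cong)
    have "c i * (M i j / M i0 j) \<in> F" if "i \<in> I'" for i
      by (rule F'(3)[OF c(1)[OF that] Fdiv[OF insert.prems(3) insert.prems(3)]]) (use that i0 I' in auto)
    then have "c0 \<in> F" unfolding c0_def by (intro F'(4) Fsum)
    then have "\<forall>i\<in>I. c' i \<in> F" using c I' by (auto simp: c'_def)
    moreover have "\<exists>i\<in>I. c' i \<noteq> 0" using c(2) I' by (auto simp: c'_def)
    moreover have "(\<Sum>i\<in>I. c' i * M i k) = 0" if "k \<in> insert j J" for k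
    proof (cases "k = j")
      case True
      have "c0 * M i0 j = - (\<Sum>i\<in>I'. c i * M i j)"
        using i0(2) by (simp add: c0_def sum_distrib_right)
      then show ?thesis using True by (simp add: c'I)
    next
      case False
      have "(\<Sum>i\<in>I'. c i * M' i k) = (\<Sum>i\<in>I'. c i * M i k) + c0 * M i0 k"
        by (simp add: M'_def c0_def right_diff_distrib sum_subtractf sum_distrib_right mult.assoc)
      then show ?thesis using c(3)[of k] False that by (simp add: c'I add.commute)
    qed
    ultimately show ?thesis by blast
  qed
qed

context graded_domain
begin

lemma frac_deg0_alt: "frac_deg0 G = {to_fract a / to_fract b | a b. a \<in> G 0 \<and> b \<in> G 0 \<and> b \<noteq> 0}"
  unfolding frac_deg0_def by (simp add: Fract_conv_to_fract)

lemma subring_frac_deg0: "is_subring (frac_deg0 G)"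
  and inverse_frac_deg0: "x \<in> frac_deg0 G \<Longrightarrow> inverse x \<in> frac_deg0 G"
proof -
  have I: "x \<in> frac_deg0 G" if "a \<in> G 0" "b \<in> G 0" "b \<noteq> 0" "x = to_fract a / to_fract b" for x a b
    using that unfolding frac_deg0_alt by blast
  have E: "\<exists>a b. a \<in> G 0 \<and> b \<in> G 0 \<and> b \<noteq> 0 \<and> x = to_fract a / to_fract b" if "x \<in> frac_deg0 G" for x
    using that unfolding frac_deg0_alt by blast
  show "is_subring (frac_deg0 G)" unfolding is_subring_def
  proof (intro conjI ballI)
    show "0 \<in> frac_deg0 G" by (rule I[of 0 1]) auto
    show "1 \<in> frac_deg0 G" by (rule I[of 1 1]) auto
    fix x assume "x \<in> frac_deg0 G"
    then obtain a b where x: "a \<in> G 0" "b \<in> G 0" "b \<noteq> 0" "x = to_fract a / to_fract b" using E by blast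
    show "- x \<in> frac_deg0 G" by (rule I[of "- a" b]) (use x uminus_in in auto)
    fix y assume "y \<in> frac_deg0 G"
    then obtain a' b' where y: "a' \<in> G 0" "b' \<in> G 0" "b' \<noteq> 0" "y = to_fract a' / to_fract b'" using E by blast
    have m: "u * v \<in> G 0" if "u \<in> G 0" "v \<in> G 0" for u v using mult_in[OF that] by simp
    show "x + y \<in> frac_deg0 G"
      by (rule I[of "a * b' + a' * b" "b * b'"]) (use x y in \<open>auto intro!: add_in m simp: field_simps\<close>)
    show "x * y \<in> frac_deg0 G"
      by (rule I[of "a * a'" "b * b'"]) (use x y in \<open>auto intro!: m\<close>)
  qed
  show "inverse x \<in> frac_deg0 G" if x: "x \<in> frac_deg0 G"
  proof -
    obtain a b where x: "a \<in> G 0" "b \<in> G 0" "b \<noteq> 0" "x = to_fract a / to_fract b" using E[OF x] by blast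
    show ?thesis
    proof (cases "a = 0")
      case True
      then show ?thesis using x I[of 0 1] by simp
    next
      case False
      then show ?thesis by (intro I[of b a]) (use x in auto)
    qed
  qed
qed

lemma supp_mult_bound:
  assumes "supp x \<subseteq> {- k..k}" "supp y \<subseteq> {- l..l}"
  shows "supp (x * y) \<subseteq> {- (k + l)..k + l}"
proof
  fix i assume "i \<in> supp (x * y)"
  then have "(\<Sum>j\<in>supp x. hc x j * hc y (i - j)) \<noteq> 0" by (simp add: in_supp_iff hcomp_mult)
  then obtain j where "j \<in> supp x" "hc y (i - j) \<noteq> 0" by (metis (no_types, lifting) mult_zero_right sum.neutral)
  then have "j \<in> {- k..k}" "i - j \<in> {- l..l}" using assms by (auto simp: supp_def)
  then show "i \<in> {- (k + l)..k + l}" by auto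
qed

lemma supp_power_bound:
  assumes "supp x \<subseteq> {- k..k}"
  shows "supp (x ^ n) \<subseteq> {- (int n * k)..int n * k}"
proof (induction n)
  case 0
  show ?case using supp_homogeneous[OF one_in] by simp
next
  case (Suc n)
  then show ?case using supp_mult_bound[OF assms Suc] by (simp add: algebra_simps)
qed

text \<open>When every graded piece spans a line over the fraction field of the degree-0 part, the n^2
  monomials of bidegree below n in two fractions lie, after clearing denominators, in a space whose
  dimension grows linearly in n.\<close>

lemma not_trdeg_ge2:
  assumes ratio: "\<And>i x y. x \<in> G i \<Longrightarrow> y \<in> G i \<Longrightarrow> x \<noteq> 0 \<Longrightarrow> y \<noteq> 0 \<Longrightarrow>
    \<exists>\<alpha>\<in>G 0. \<exists>\<beta>\<in>G 0. \<alpha> \<noteq> 0 \<and> \<beta> \<noteq> 0 \<and> \<alpha> * y = \<beta> * x"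
  shows "\<not> trdeg_ge2 G"
proof
  assume "trdeg_ge2 G"
  then obtain u v :: "'b fract" where ind: "alg_indep2 (frac_deg0 G) u v" by (auto simp: trdeg_ge2_def)
  let ?F = "frac_deg0 G"
  obtain a1 b1 where u: "u = to_fract a1 / to_fract b1" "b1 \<noteq> 0"
    by (cases u) (auto simp: Fract_conv_to_fract)
  obtain a2 b2 where v: "v = to_fract a2 / to_fract b2" "b2 \<noteq> 0"
    by (cases v) (auto simp: Fract_conv_to_fract)
  define a b c where "a = a1 * b2" and "b = a2 * b1" and "c = b1 * b2"
  have c0: "c \<noteq> 0" using u v by (simp add: c_def)
  have uv: "u = to_fract a / to_fract c" "v = to_fract b / to_fract c"
    using u v by (auto simp: a_def b_def c_def)
  obtain L :: nat where L: "supp a \<subseteq> {- int L..int L}" "supp b \<subseteq> {- int L..int L}" "supp c \<subseteq> {- int L..int L}"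
  proof -
    let ?A = "supp a \<union> supp b \<union> supp c"
    define L where "L = (\<Sum>i\<in>?A. nat \<bar>i\<bar>)"
    have "nat \<bar>i\<bar> \<le> L" if "i \<in> ?A" for i unfolding L_def by (rule member_le_sum) (use that in auto)
    then have "?A \<subseteq> {- int L..int L}" by fastforce
    then show thesis using that[of L] by blast
  qed
  \<comment> \<open>There are 4 * L * n + 1 degrees in \<open>J\<close> and n * n monomials in
    \<open>I\<close>. With this n the difference n * n - 4 * L * n is 2 * n, which exceeds 1 even
    for L = 0.\<close>
  define n where "n = 4 * L + 2"
  \<comment> \<open>This is c^(2 * n) * u^i * v^j; the common factor clears all denominators, since
    i + j < 2 * n.\<close>
  define z where "z = (\<lambda>(i, j). a ^ i * b ^ j * c ^ (2 * n - i - j))"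
  define J where "J = {- int (2 * n * L)..int (2 * n * L)}"
  define I where "I = {..<n} \<times> {..<n}"
  have zJ: "supp (z p) \<subseteq> J" if pI: "p \<in> I" for p
  proof -
    obtain i j where p: "p = (i, j)" "i < n" "j < n" using pI by (auto simp: I_def)
    have "supp (z p) \<subseteq> {- (int i * int L + int j * int L + int (2 * n - i - j) * int L)..
        int i * int L + int j * int L + int (2 * n - i - j) * int L}"
      unfolding p z_def prod.case by (intro supp_mult_bound supp_power_bound L)
    also have "int i * int L + int j * int L + int (2 * n - i - j) * int L = int (i + j + (2 * n - i - j)) * int L"
      by (simp add: algebra_simps)
    also have "i + j + (2 * n - i - j) = 2 * n" using p by simp
    finally show ?thesis by (simp add: J_def)
  qed
  \<comment> \<open>A spanning vector for each nonzero piece. By \<open>ratio\<close>, every element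
    of \<open>G k\<close> is a multiple of it over Frac(B_0).\<close>
  define g where "g k = (if G k = {0} then 0 else SOME x. x \<in> G k \<and> x \<noteq> 0)" for k
  have g: "\<exists>\<phi>\<in>?F. to_fract x = \<phi> * to_fract (g k)" if x: "x \<in> G k" for x k
  proof (cases "x = 0")
    case True
    then show ?thesis using subring_frac_deg0 by (auto simp: is_subring_def)
  next
    case False
    then have "g k = (SOME x. x \<in> G k \<and> x \<noteq> 0)" "\<exists>x. x \<in> G k \<and> x \<noteq> 0" using x by (auto simp: g_def)
    then have gk: "g k \<in> G k" "g k \<noteq> 0" using someI_ex[of "\<lambda>x. x \<in> G k \<and> x \<noteq> 0"] by auto
    then obtain \<alpha> \<beta> where ab: "\<alpha> \<in> G 0" "\<beta> \<in> G 0" "\<beta> \<noteq> 0" "\<alpha> * g k = \<beta> * x"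
      using ratio[OF x gk(1) False] by blast
    have "to_fract \<alpha> * to_fract (g k) = to_fract \<beta> * to_fract x" using ab(4) by (metis to_fract_mult)
    then have "to_fract x = (to_fract \<alpha> / to_fract \<beta>) * to_fract (g k)" using ab(3) by (simp add: field_simps)
    then show ?thesis using ab unfolding frac_deg0_alt by blast
  qed
  then have "\<forall>p k. \<exists>\<phi>\<in>?F. to_fract (hc (z p) k) = \<phi> * to_fract (g k)" by simp
  then obtain M where M: "\<And>p k. M p k \<in> ?F" "\<And>p k. to_fract (hc (z p) k) = M p k * to_fract (g k)" by metis
  have "card J < card I"
  proof -
    have "card J = nat (int (4 * L * n + 1))" unfolding J_def card_atLeastAtMost_int by (simp add: algebra_simps)
    also have "\<dots> = 4 * L * n + 1" by (rule nat_int)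
    also have "\<dots> < n * n" unfolding n_def by (simp add: algebra_simps)
    finally show ?thesis by (simp add: I_def card_cartesian_product)
  qed
  then obtain q where q: "\<And>p. p \<in> I \<Longrightarrow> q p \<in> ?F" "\<exists>p\<in>I. q p \<noteq> 0" "\<And>k. k \<in> J \<Longrightarrow> (\<Sum>p\<in>I. q p * M p k) = 0"
  proof -
    have "finite J" "finite I" by (simp_all add: I_def J_def)
    then have "\<exists>q. (\<forall>p\<in>I. q p \<in> ?F) \<and> (\<exists>p\<in>I. q p \<noteq> 0) \<and> (\<forall>k\<in>J. (\<Sum>p\<in>I. q p * M p k) = 0)"
      by (intro homogeneous_system_nontrivial_solution[OF subring_frac_deg0]
          inverse_frac_deg0 \<open>card J < card I\<close> M(1))
    then show thesis using that by blast
  qed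
  have "(\<Sum>p\<in>I. q p * to_fract (z p)) = (\<Sum>p\<in>I. q p * (\<Sum>k\<in>J. M p k * to_fract (g k)))"
  proof (rule sum.cong)
    fix p assume "p \<in> I"
    then have "to_fract (z p) = to_fract (\<Sum>k\<in>J. hc (z p) k)" using zJ by (simp add: sum_hcomp J_def)
    then show "q p * to_fract (z p) = q p * (\<Sum>k\<in>J. M p k * to_fract (g k))" by (simp add: to_fract_sum M)
  qed simp
  also have "\<dots> = (\<Sum>k\<in>J. (\<Sum>p\<in>I. q p * M p k) * to_fract (g k))"
    by (simp add: sum_distrib_left sum_distrib_right mult.assoc) (rule sum.swap)
  also have "\<dots> = 0" using q(3) by simp
  finally have sum0: "(\<Sum>p\<in>I. q p * to_fract (z p)) = 0" .
  have "to_fract (z (i, j)) = to_fract c ^ (2 * n) * (u ^ i * v ^ j)" if "i < n" "j < n" for i j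
  proof -
    have "to_fract c ^ (2 * n) = to_fract c ^ i * to_fract c ^ j * to_fract c ^ (2 * n - i - j)"
      using that by (simp flip: power_add)
    then show ?thesis using c0 by (simp add: z_def uv to_fract_power power_divide)
  qed
  then have "to_fract c ^ (2 * n) * (\<Sum>i<n. \<Sum>j<n. q (i, j) * u ^ i * v ^ j) = 0"
    using sum0 unfolding I_def sum.cartesian_product' by (simp add: sum_distrib_left algebra_simps)
  then have "(\<Sum>i<n. \<Sum>j<n. q (i, j) * u ^ i * v ^ j) = 0" using c0 by simp
  moreover have "\<forall>i<n. \<forall>j<n. q (i, j) \<in> ?F" using q(1) by (auto simp: I_def)
  ultimately have "\<forall>i<n. \<forall>j<n. q (i, j) = 0"
    using ind[unfolded alg_indep2_def, THEN spec[of _ n], THEN spec[of _ "\<lambda>i j. q (i, j)"]] by blast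
  then show False using q(2) by (auto simp: I_def)
qed

end

section \<open>Kernel elements of nonzero degree\<close>

context homogeneous_lnd
begin

lemma top_in_Ker:
  assumes "x \<in> V d" "x \<in> G i"
  shows "(D ^^ dg x) x \<in> Ker (i + int (dg x) * N)"
  using funpow_in funpow_degree D_funpow_dg assms by (simp add: Ker_def)

lemma kernel_has_nonzero_degree:
  assumes cond: "trdeg_ge2 G \<or> (\<exists>i j. i < 0 \<and> 0 < j \<and> G i \<noteq> {0} \<and> G j \<noteq> {0})"
  shows "\<exists>i c. c \<in> Ker i \<and> c \<noteq> 0 \<and> i \<noteq> 0"
proof (rule ccontr)
  assume "\<not> ?thesis"
  then have deg0: "i = 0" if "c \<in> Ker i" "c \<noteq> 0" for i c using that by blast
  have top0: "i + int (dg x) * N = 0" if "x \<in> V d" "x \<in> G i" "x \<noteq> 0" for x i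
    using deg0[OF top_in_Ker[OF that(1,2)]] dg_nonzero[OF that(3)] by blast
  have pV: "x ^ d \<in> V d" "x ^ d \<in> G (int d * i)" if "x \<in> G i" for x i
    using power_in[OF that, of d] by (auto intro!: veronese_homogeneous[OF power_in[OF that]])
  from cond show False
  proof
    assume "trdeg_ge2 G"
    moreover have "\<not> trdeg_ge2 G"
    proof (rule not_trdeg_ge2)
      fix i x y assume xy: "x \<in> G i" "y \<in> G i" "x \<noteq> 0" "y \<noteq> 0"
      show "\<exists>\<alpha>\<in>G 0. \<exists>\<beta>\<in>G 0. \<alpha> \<noteq> 0 \<and> \<beta> \<noteq> 0 \<and> \<alpha> * y = \<beta> * x"
      proof (cases "i = 0")
        case True
        then show ?thesis using xy by (metis mult.commute)
      next
        case False
        \<comment> \<open>Multiplying x and y by the same y^(d - 1) moves both into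
          \<open>V d\<close> and preserves their ratio.\<close>
        define x' where "x' = x * y ^ (d - 1)"
        define y' where "y' = y ^ d"
        have "i + int (d - 1) * i = int d * i" using d_pos by (simp add: algebra_simps of_nat_diff)
        then have x': "x' \<in> G (int d * i)" unfolding x'_def
          using mult_in[OF xy(1) power_in[OF xy(2), of "d - 1"]] by simp
        then have x'V: "x' \<in> V d" by (rule veronese_homogeneous) simp
        note y' = pV[OF xy(2), folded y'_def]
        have nz: "x' \<noteq> 0" "y' \<noteq> 0" using xy by (auto simp: x'_def y'_def)
        have "N \<noteq> 0" using top0[OF x'V x' nz(1)] False d_pos by auto
        have same: "dg z = dg y'" if "z \<in> V d" "z \<in> G (int d * i)" "z \<noteq> 0" for z
        proof -
          have "int (dg z) * N = int (dg y') * N" using top0[OF that] top0[OF y' nz(2)] by linarith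
          then show ?thesis using \<open>N \<noteq> 0\<close> by simp
        qed
        define \<alpha> where "\<alpha> = (D ^^ dg y') x'"
        define \<beta> where "\<beta> = (D ^^ dg y') y'"
        have ab: "\<alpha> \<in> Ker 0" "\<beta> \<in> Ker 0" "\<alpha> \<noteq> 0" "\<beta> \<noteq> 0"
          using top_in_Ker[OF x'V x'] top_in_Ker[OF y'] top0[OF x'V x' nz(1)] top0[OF y' nz(2)]
            dg_nonzero[OF nz(1)] dg_nonzero[OF nz(2)] same[OF x'V x' nz(1)]
          by (simp_all add: \<alpha>_def \<beta>_def)
        \<comment> \<open>The last nonzero derivatives of x' and y' cancel here, while by
          \<open>same\<close> a nonzero element of this degree would have D-degree dg y'. Hence z =
          0.\<close>
        define z where "z = \<alpha> * y' - \<beta> * x'"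
        have "z \<in> G (0 + int d * i)" unfolding z_def by (intro diff_in mult_in KerD ab x' y')
        moreover have "z \<in> V d" unfolding z_def by (intro S_intros KerD(1)[OF ab(1)] KerD(1)[OF ab(2)] x'V y')
        moreover have "(D ^^ dg y') z = 0"
          unfolding z_def by (simp add: funpow_diff S_mult KerD[OF ab(1)] KerD[OF ab(2)] x'V y'
              funpow_mult_ker \<alpha>_def[symmetric] \<beta>_def[symmetric] mult.commute)
        ultimately have "z = 0" using same[of z] dg_nonzero[of z] by auto
        then have "(\<alpha> * y) * y ^ (d - 1) = (\<beta> * x) * y ^ (d - 1)"
          using d_pos by (simp add: z_def x'_def y'_def mult.assoc flip: power_Suc)
        then have "\<alpha> * y = \<beta> * x" using xy by simp
        then show ?thesis using ab KerD(2) by blast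
      qed
    qed
    ultimately show False by simp
  next
    assume "\<exists>i j. i < 0 \<and> 0 < j \<and> G i \<noteq> {0} \<and> G j \<noteq> {0}"
    then obtain i j where ij: "i < 0" "0 < j" "G i \<noteq> {0}" "G j \<noteq> {0}" by blast
    obtain x where x: "x \<in> G i" "x \<noteq> 0" using ij(3) zero_in by blast
    obtain y where y: "y \<in> G j" "y \<noteq> 0" using ij(4) zero_in by blast
    note xV = pV[OF x(1)] and yV = pV[OF y(1)]
    have nz: "x ^ d \<noteq> 0" "y ^ d \<noteq> 0" using x y by auto
    define p q where "p = (x ^ d) ^ nat j" and "q = (y ^ d) ^ nat (- i)"
    have pq: "p \<in> V d" "q \<in> V d" "p * q \<noteq> 0" using nz xV yV by (auto simp: p_def q_def intro: S_power)
    have "p * q \<in> G (int (nat j) * (int d * i) + int (nat (- i)) * (int d * j))"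
      unfolding p_def q_def by (intro mult_in power_in xV yV)
    then have pq0: "p * q \<in> G 0" using ij by (simp add: algebra_simps)
    have "D (x ^ d) = 0"
    proof (cases "D (p * q) = 0")
      case True
      then have "D p = 0" using ker_factorially_closed[OF pq] by blast
      then have "nat j * dg (x ^ d) = 0"
        using dg_power[OF xV(1) nz(1), of "nat j"] dg_eq_0_iff[OF pq(1)] by (simp add: p_def)
      then show ?thesis using ij dg_eq_0_iff[OF xV(1)] by simp
    next
      case False
      \<comment> \<open>With degree 0 and positive D-degree, p * q forces N = 0 through
        \<open>top0\<close>; then \<open>top0\<close> at x^d gives i = 0.\<close>
      have "dg (p * q) > 0" using False dg_eq_0_iff[OF S_mult[OF pq(1,2)]] by (meson gr0I)
      then have "N = 0" using top0[OF S_mult[OF pq(1,2)] pq0 pq(3)] by simp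
      then have "i = 0" using top0[OF xV nz(1)] d_pos by simp
      then show ?thesis using ij by simp
    qed
    then have "x ^ d \<in> Ker (int d * i)" using xV by (simp add: Ker_def)
    then show False using deg0 nz ij d_pos by fastforce
  qed
qed

text \<open>If x has D-degree n + 1, then D^n x is a local slice: its derivative is nonzero and
  killed by D.\<close>

lemma exists_cylindrical:
  assumes ne: "\<exists>i x. int d dvd i \<and> x \<in> G i \<and> D x \<noteq> 0"
    and cond: "trdeg_ge2 G \<or> (\<exists>i j. i < 0 \<and> 0 < j \<and> G i \<noteq> {0} \<and> G j \<noteq> {0})"
  shows "\<exists>f. cylindrical G f"
proof -
  obtain i x where x: "int d dvd i" "x \<in> G i" "D x \<noteq> 0" using ne by blast
  have xV: "x \<in> V d" using veronese_homogeneous x by blast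
  obtain n where n: "dg x = Suc n" using dg_D[OF xV x(3)] by blast
  have "x \<noteq> 0" using x by auto
  then have "D ((D ^^ n) x) \<noteq> 0" using dg_nonzero[of x] n by simp
  moreover have "D (D ((D ^^ n) x)) = 0" using dg_Suc[OF xV] n by simp
  ultimately show ?thesis
    using cylindrical_of_kernel_element[OF funpow_in[OF xV] funpow_degree[OF xV x(2)]]
      kernel_has_nonzero_degree[OF cond] by blast
qed

end

section \<open>Noetherian rings and divisibility in codimension one\<close>

definition adjoin :: "'a::comm_ring_1 set \<Rightarrow> 'a \<Rightarrow> 'a set" where
  "adjoin A x = (\<lambda>p. poly p x) ` polys_over A"

lemma subring_adjoin:
  assumes "is_subring A"
  shows "is_subring (adjoin A x)"
proof -
  have P: "0 \<in> polys_over A" "1 \<in> polys_over A" 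
    "\<And>p q. p \<in> polys_over A \<Longrightarrow> q \<in> polys_over A \<Longrightarrow> p + q \<in> polys_over A \<and> p * q \<in> polys_over A"
    "\<And>p. p \<in> polys_over A \<Longrightarrow> - p \<in> polys_over A"
    using subring_polys_over[OF assms] by (auto simp: is_subring_def)
  have I: "y \<in> adjoin A x" if "p \<in> polys_over A" "y = poly p x" for p y
    using that by (auto simp: adjoin_def)
  show ?thesis unfolding is_subring_def
  proof (intro conjI ballI)
    show "0 \<in> adjoin A x" by (rule I[OF P(1)]) simp
    show "1 \<in> adjoin A x" by (rule I[OF P(2)]) simp
    fix y assume "y \<in> adjoin A x"
    then obtain p where p: "p \<in> polys_over A" "y = poly p x" by (auto simp: adjoin_def)
    show "- y \<in> adjoin A x" by (rule I[OF P(4)[OF p(1)]]) (simp add: p)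
    fix z assume "z \<in> adjoin A x"
    then obtain q where q: "q \<in> polys_over A" "z = poly q x" by (auto simp: adjoin_def)
    note pq = P(3)[OF p(1) q(1)]
    show "y + z \<in> adjoin A x" by (rule I[OF conjunct1[OF pq]]) (simp add: p q)
    show "y * z \<in> adjoin A x" by (rule I[OF conjunct2[OF pq]]) (simp add: p q)
  qed
qed

definition ideal_of :: "'a::comm_ring_1 set \<Rightarrow> 'a set \<Rightarrow> bool" where
  "ideal_of A I \<longleftrightarrow> I \<subseteq> A \<and> 0 \<in> I \<and> (\<forall>x\<in>I. \<forall>y\<in>I. x + y \<in> I) \<and> (\<forall>a\<in>A. \<forall>x\<in>I. a * x \<in> I)"

definition noetherian :: "'a::comm_ring_1 set \<Rightarrow> bool" where
  "noetherian A \<longleftrightarrow> (\<forall>I. (\<forall>n::nat. ideal_of A (I n) \<and> I n \<subseteq> I (Suc n)) \<longrightarrow> (\<exists>N. \<forall>n\<ge>N. I n = I N))"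

lemma ideal_of_minus:
  assumes "is_subring A" "ideal_of A I" "x \<in> I"
  shows "- x \<in> I"
proof -
  have "- 1 \<in> A" using assms by (auto simp: is_subring_def)
  then have "- 1 * x \<in> I" using assms unfolding ideal_of_def by blast
  then show ?thesis by simp
qed

lemma noetherian_subfield:
  assumes K: "is_subfield K"
  shows "noetherian K"
  unfolding noetherian_def
proof (intro allI impI)
  fix I :: "nat \<Rightarrow> 'a set"
  assume I: "\<forall>n. ideal_of K (I n) \<and> I n \<subseteq> I (Suc n)"
  have mono: "I m \<subseteq> I n" if "m \<le> n" for m n by (rule lift_Suc_mono_le[OF _ that]) (use I in auto)
  show "\<exists>N. \<forall>n\<ge>N. I n = I N"
  proof (cases "\<forall>n. I n = {0}")
    case False
    then obtain N where "I N \<noteq> {0}" by blast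
    moreover have "0 \<in> I N" using I by (simp add: ideal_of_def)
    ultimately obtain x where x: "x \<in> I N" "x \<noteq> 0" by blast
    then obtain y where y: "y \<in> K" "x * y = 1" using K I unfolding is_subfield_def ideal_of_def by blast
    have "I n = K" if "n \<ge> N" for n
    proof
      show "K \<subseteq> I n"
      proof
        fix k assume "k \<in> K"
        then have "k * y \<in> K" using K y by (auto simp: is_subfield_def is_subring_def)
        moreover have "x \<in> I n" using mono[OF that] x by blast
        ultimately have "k * y * x \<in> I n" using I by (auto simp: ideal_of_def)
        moreover have "k * y * x = k" using y(2) by (simp add: mult.assoc mult.commute[of y])
        ultimately show "k \<in> I n" by simp
      qed
    qed (use I in \<open>auto simp: ideal_of_def\<close>)
    then show ?thesis by (intro exI[of _ N]) auto
  qed auto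
qed

definition lead_ideal :: "'a::comm_ring_1 set \<Rightarrow> 'a \<Rightarrow> 'a set \<Rightarrow> nat \<Rightarrow> 'a set" where
  "lead_ideal A x J n = {coeff p n | p. p \<in> polys_over A \<and> degree p \<le> n \<and> poly p x \<in> J}"

lemma ideal_lead_ideal:
  assumes A: "is_subring A" and J: "ideal_of (adjoin A x) J"
  shows "ideal_of A (lead_ideal A x J n)"
proof -
  have P: "0 \<in> polys_over A" 
    "\<And>p q. p \<in> polys_over A \<Longrightarrow> q \<in> polys_over A \<Longrightarrow> p + q \<in> polys_over A \<and> p * q \<in> polys_over A"
    using subring_polys_over[OF A] by (auto simp: is_subring_def)
  have I: "a \<in> lead_ideal A x J n" if "p \<in> polys_over A" "degree p \<le> n" "poly p x \<in> J" "a = coeff p n" for p a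
    using that unfolding lead_ideal_def by blast
  show ?thesis unfolding ideal_of_def
  proof (intro conjI ballI)
    show "lead_ideal A x J n \<subseteq> A" by (auto simp: lead_ideal_def polys_over_def)
    show "0 \<in> lead_ideal A x J n" by (rule I[OF P(1)]) (use J in \<open>auto simp: ideal_of_def\<close>)
    fix a assume "a \<in> lead_ideal A x J n"
    then obtain p where p: "p \<in> polys_over A" "degree p \<le> n" "poly p x \<in> J" "a = coeff p n"
      by (auto simp: lead_ideal_def)
    {
      fix b assume "b \<in> lead_ideal A x J n"
      then obtain q where q: "q \<in> polys_over A" "degree q \<le> n" "poly q x \<in> J" "b = coeff q n"
        by (auto simp: lead_ideal_def)
      show "a + b \<in> lead_ideal A x J n"
        by (rule I[of "p + q"]) (use p q P(2)[OF p(1) q(1)] J in \<open>auto simp: ideal_of_def degree_add_le\<close>)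
    }
    fix c assume c: "c \<in> A"
    have cp: "[:c:] \<in> polys_over A" using c P by (auto intro: pCons_in_polys_over)
    then have "c \<in> adjoin A x" unfolding adjoin_def by force
    then have "c * poly p x \<in> J" using J p by (auto simp: ideal_of_def)
    then show "c * a \<in> lead_ideal A x J n"
      by (intro I[of "[:c:] * p"]) (use p P(2)[OF cp p(1)] in \<open>auto intro: degree_smult_le[THEN order_trans]\<close>)
  qed
qed

lemma lead_ideal_Suc:
  assumes A: "is_subring A" and J: "ideal_of (adjoin A x) J"
  shows "lead_ideal A x J n \<subseteq> lead_ideal A x J (Suc n)"
proof
  fix a assume "a \<in> lead_ideal A x J n"
  then obtain p where p: "p \<in> polys_over A" "degree p \<le> n" "poly p x \<in> J" "a = coeff p n"
    by (auto simp: lead_ideal_def)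
  have A': "0 \<in> A" "1 \<in> A" "0 \<in> polys_over A" using A subring_polys_over[OF A] by (auto simp: is_subring_def)
  have "[:0, 1:] \<in> polys_over A" by (intro pCons_in_polys_over A')
  then have "x \<in> adjoin A x" unfolding adjoin_def by force
  then have "x * poly p x \<in> J" using J p by (auto simp: ideal_of_def)
  moreover have "pCons 0 p \<in> polys_over A" by (intro pCons_in_polys_over A' p)
  ultimately show "a \<in> lead_ideal A x J (Suc n)" unfolding lead_ideal_def
    using p by (intro CollectI exI[of _ "pCons 0 p"]) (auto intro: degree_pCons_le[THEN order_trans])
qed

text \<open>Given a polynomial with value in J', one with value in J shares its top coefficient. The
  difference has smaller degree and value in J', so descent on the degree finishes.\<close>

lemma ideal_eq_of_lead_ideal_eq:
  assumes A: "is_subring A" and J: "ideal_of (adjoin A x) J" and J': "ideal_of (adjoin A x) J'"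
    and sub: "J \<subseteq> J'" and eq: "\<And>n. lead_ideal A x J n = lead_ideal A x J' n"
  shows "J = J'"
proof
  have "poly p x \<in> J" if "p \<in> polys_over A" "degree p < n" "poly p x \<in> J'" for n p
    using that
  proof (induction n arbitrary: p)
    case (Suc n)
    have "coeff p n \<in> lead_ideal A x J' n" using Suc.prems unfolding lead_ideal_def
      by (intro CollectI exI[of _ p]) auto
    then obtain q where q: "q \<in> polys_over A" "degree q \<le> n" "poly q x \<in> J" "coeff p n = coeff q n"
      unfolding eq[symmetric] by (auto simp: lead_ideal_def)
    define r where "r = p - q"
    have r: "r \<in> polys_over A" unfolding r_def
      by (intro subring_diff subring_polys_over A Suc.prems q)
    have "coeff r n = 0" using q by (simp add: r_def)
    moreover have "degree r \<le> n" unfolding r_def using Suc.prems q by (intro degree_diff_le) auto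
    ultimately have "r = 0 \<or> degree r < n" by (metis le_neq_implies_less leading_coeff_0_iff)
    moreover have "poly r x \<in> J'"
    proof -
      have "- poly q x \<in> J'"
        by (rule ideal_of_minus[OF subring_adjoin[OF A] J']) (use q sub in auto)
      with J' Suc.prems(3) have "poly p x + - poly q x \<in> J'" unfolding ideal_of_def by blast
      then show ?thesis by (simp add: r_def)
    qed
    ultimately have "poly r x \<in> J" using Suc.IH[OF r] J by (auto simp: ideal_of_def)
    then have "poly r x + poly q x \<in> J" using q J by (auto simp: ideal_of_def)
    then show ?case by (simp add: r_def)
  qed simp
  then show "J' \<subseteq> J" using J' unfolding ideal_of_def adjoin_def by blast
qed (fact sub)

lemma noetherian_adjoin:
  assumes A: "is_subring A" and noeth: "noetherian A"
  shows "noetherian (adjoin A x)"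
  unfolding noetherian_def
proof (intro allI impI)
  fix J :: "nat \<Rightarrow> 'a set"
  assume "\<forall>n. ideal_of (adjoin A x) (J n) \<and> J n \<subseteq> J (Suc n)"
  then have J: "ideal_of (adjoin A x) (J n)" and JS: "J n \<subseteq> J (Suc n)" for n by auto
  let ?L = "\<lambda>k n. lead_ideal A x (J k) n"
  have Jm: "J k \<subseteq> J l" if "k \<le> l" for k l by (rule lift_Suc_mono_le[OF _ that]) (use JS in auto)
  have L1: "?L k n \<subseteq> ?L l n" if "k \<le> l" for k l n
    using Jm[OF that] by (auto simp: lead_ideal_def)
  have L2: "?L k m \<subseteq> ?L k n" if "m \<le> n" for k m n
    by (rule lift_Suc_mono_le[OF _ that]) (rule lead_ideal_Suc[OF A J])
  have I: "ideal_of A (?L k n)" for k n by (rule ideal_lead_ideal[OF A J])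
  have stab: "\<exists>N. \<forall>n\<ge>N. F n = F N" if "\<And>n. ideal_of A (F n)" "\<And>n. F n \<subseteq> F (Suc n)" for F :: "nat \<Rightarrow> 'a set"
    using noeth that unfolding noetherian_def by blast
  have "?L n n \<subseteq> ?L (Suc n) (Suc n)" for n using L1[of n "Suc n" n] L2[of n "Suc n" "Suc n"] by simp
  then obtain N1 where N1: "\<And>n. n \<ge> N1 \<Longrightarrow> ?L n n = ?L N1 N1"
    using stab[of "\<lambda>n. ?L n n"] I by blast
  have "\<exists>N. \<forall>k\<ge>N. ?L k n = ?L N n" for n
    by (rule stab) (use I L1 in auto)
  then obtain K where K: "\<And>n k. k \<ge> K n \<Longrightarrow> ?L k n = ?L (K n) n" by metis
  \<comment> \<open>The family is increasing in both indices. Its diagonal is constant from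
    \<open>N1\<close> on, and for each of the finitely many n < \<open>N1\<close> the sequence in k
    is constant from \<open>K n\<close> on.\<close>
  define N where "N = N1 + sum K {..<N1}"
  have "J k = J N" if k: "k \<ge> N" for k
  proof (rule ideal_eq_of_lead_ideal_eq[OF A J J Jm[OF k], symmetric])
    fix n
    show "?L N n = ?L k n"
    proof (cases "n < N1")
      case True
      then have "K n \<le> sum K {..<N1}" by (intro member_le_sum) auto
      then have "K n \<le> N" by (simp add: N_def)
      then show ?thesis using K[of n N] K[of n k] k by simp
    next
      case False
      \<comment> \<open>For n >= \<open>N1\<close> both sets are squeezed between the diagonal term
        at \<open>N1\<close> and a later diagonal term, which is equal to it.\<close>
      then have "?L N1 N1 \<subseteq> ?L N n" using L1[of N1 N N1] L2[of N1 n N] by (auto simp: N_def)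
      moreover have "?L k n \<subseteq> ?L N1 N1"
        using N1[of "max k n"] L1[of k "max k n" n] L2[of n "max k n" "max k n"] False by auto
      ultimately show ?thesis using L1[OF k] by blast
    qed
  qed
  then show "\<exists>N. \<forall>n\<ge>N. J n = J N" by blast
qed

lemma noetherian_of_fg_algebra:
  assumes "fg_algebra_over_char0_field TYPE('b::idom)"
  shows "noetherian (UNIV :: 'b set)"
proof -
  obtain K S where K: "is_subfield K" and S: "finite S" "ring_gen (K \<union> S) = (UNIV :: 'b set)"
    using assms by (auto simp: fg_algebra_over_char0_field_def)
  from S(1) have "\<exists>R. is_subring R \<and> noetherian R \<and> K \<union> S \<subseteq> R"
  proof (induction S rule: finite_induct)
    case empty
    then show ?case using K noetherian_subfield[OF K] by (auto simp: is_subfield_def)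
  next
    case (insert x S)
    then obtain R where R: "is_subring R" "noetherian R" "K \<union> S \<subseteq> R" by blast
    have R': "0 \<in> R" "1 \<in> R" "0 \<in> polys_over R"
      using R subring_polys_over[OF R(1)] by (auto simp: is_subring_def)
    have "r \<in> adjoin R x" if "r \<in> R" for r
      unfolding adjoin_def using that R' by (intro image_eqI[of _ _ "[:r:]"] pCons_in_polys_over) auto
    moreover have "x \<in> adjoin R x"
      unfolding adjoin_def using R' by (intro image_eqI[of _ _ "[:0, 1:]"] pCons_in_polys_over) auto
    ultimately show ?case using R subring_adjoin[OF R(1), of x] noetherian_adjoin[OF R(1,2), of x]
      by (intro exI[of _ "adjoin R x"]) auto
  qed
  then obtain R where R: "is_subring R" "noetherian R" "K \<union> S \<subseteq> R" by blast
  have "x \<in> R" if "x \<in> ring_gen (K \<union> S)" for x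
    using that by (induction rule: ring_gen.induct) (use R in \<open>auto simp: is_subring_def\<close>)
  then have "R = UNIV" using S by auto
  then show ?thesis using R by simp
qed

section \<open>Maximal conductors and divisibility tested at primes of height one\<close>

lemma ideal_of_UNIV: "ideal_of UNIV I \<longleftrightarrow> is_ideal I"
  by (auto simp: ideal_of_def is_ideal_def)

lemma noetherian_maximal:
  assumes noeth: "noetherian (UNIV :: 'a::comm_ring_1 set)"
    and X: "I0 \<in> X" "\<And>I. I \<in> X \<Longrightarrow> is_ideal I"
  shows "\<exists>M\<in>X. \<forall>I\<in>X. M \<subseteq> I \<longrightarrow> I = (M :: 'a set)"
proof (rule ccontr)
  assume "\<not> ?thesis"
  then have "\<forall>M\<in>X. \<exists>I\<in>X. M \<subset> I" by blast
  then obtain f where f: "\<And>M. M \<in> X \<Longrightarrow> f M \<in> X \<and> M \<subset> f M" by metis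
  have F: "(f ^^ n) I0 \<in> X" for n by (induction n) (use X f in auto)
  have "\<exists>N. \<forall>n\<ge>N. (f ^^ n) I0 = (f ^^ N) I0"
    using noeth[unfolded noetherian_def, THEN spec[of _ "\<lambda>n. (f ^^ n) I0"]] X(2) F f
    by (auto simp: ideal_of_UNIV)
  then obtain N where "(f ^^ Suc N) I0 = (f ^^ N) I0" using le_Suc_eq by blast
  then show False using f[OF F[of N]] by auto
qed

text \<open>The fraction y = c / z maps Q into itself, so every q * y^n lies in the ring: y is
  almost integral. The ideals generated by the first n of these elements stabilise, which after
  division by q is a monic equation for y, and normality puts y into the ring.\<close>

lemma dvd_of_stable_set:
  fixes z c :: "'b::idom"
  assumes noeth: "noetherian (UNIV :: 'b set)" and normal: "normal_domain TYPE('b)"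
    and z: "z \<noteq> 0" and q: "q \<in> Q" "q \<noteq> 0" and stable: "\<And>r. r \<in> Q \<Longrightarrow> \<exists>r'\<in>Q. z * r' = c * r"
  shows "z dvd c"
proof -
  obtain g where g: "\<And>r. r \<in> Q \<Longrightarrow> g r \<in> Q \<and> z * g r = c * r" using stable by metis
  define s where "s n = (g ^^ n) q" for n
  have sQ: "s n \<in> Q" for n unfolding s_def by (induction n) (use q g in auto)
  define y where "y = to_fract c / to_fract z"
  have s: "to_fract (s n) = to_fract q * y ^ n" for n
  proof (induction n)
    case (Suc n)
    have "to_fract z * to_fract (s (Suc n)) = to_fract c * to_fract (s n)"
      using g[OF sQ[of n]] by (simp add: s_def flip: to_fract_mult)
    then show ?case using Suc z by (simp add: y_def field_simps)
  qed (simp add: s_def)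
  define I where "I n = {\<Sum>i<n. b i * s i | b. True}" for n
  have "is_ideal (I n)" for n unfolding is_ideal_def
  proof (intro conjI ballI allI)
    show "0 \<in> I n" unfolding I_def by (intro CollectI exI[of _ "\<lambda>_. 0"]) simp
    fix u assume "u \<in> I n"
    then obtain b where b: "u = (\<Sum>i<n. b i * s i)" by (auto simp: I_def)
    show "k * u \<in> I n" for k unfolding I_def
      by (intro CollectI exI[of _ "\<lambda>i. k * b i"]) (simp add: b sum_distrib_left mult.assoc)
    fix v assume "v \<in> I n"
    then obtain b' where b': "v = (\<Sum>i<n. b' i * s i)" by (auto simp: I_def)
    show "u + v \<in> I n" unfolding I_def
      by (intro CollectI exI[of _ "\<lambda>i. b i + b' i"]) (simp add: b b' sum.distrib distrib_right)
  qed
  moreover have "I n \<subseteq> I (Suc n)" for n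
  proof
    fix u assume "u \<in> I n"
    then obtain b where b: "u = (\<Sum>i<n. b i * s i)" by (auto simp: I_def)
    show "u \<in> I (Suc n)" unfolding I_def
      by (intro CollectI exI[of _ "\<lambda>i. if i < n then b i else 0"]) (simp add: b)
  qed
  ultimately have "\<exists>N. \<forall>n\<ge>N. I n = I N"
    using noeth[unfolded noetherian_def, THEN spec[of _ I]] by (simp add: ideal_of_UNIV)
  then obtain N where N: "I (Suc N) = I N" using le_Suc_eq by blast
  have "s N \<in> I (Suc N)" unfolding I_def
    by (intro CollectI exI[of _ "\<lambda>i. if i = N then 1 else 0"]) simp
  then obtain b where b: "s N = (\<Sum>i<N. b i * s i)" unfolding N by (auto simp: I_def)
  have "to_fract q * y ^ N = to_fract q * (\<Sum>i<N. to_fract (b i) * y ^ i)"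
    using arg_cong[OF b, of to_fract] by (simp add: to_fract_sum s sum_distrib_left mult.left_commute)
  then have y: "y ^ N = (\<Sum>i<N. to_fract (b i) * y ^ i)" using q by simp
  define p where "p = monom 1 N - (\<Sum>i<N. monom (b i) i)"
  have cp: "coeff p k = (if k = N then 1 else if k < N then - b k else 0)" for k
    by (simp add: p_def coeff_sum)
  have "degree p = N"
    by (rule antisym) (auto intro!: degree_le le_degree simp: cp)
  then have lead: "lead_coeff p = 1" by (simp add: cp)
  have "map_poly to_fract p = monom 1 N - (\<Sum>i<N. monom (to_fract (b i)) i)"
    by (rule poly_eqI) (simp add: coeff_map_poly cp coeff_sum)
  then have "poly (map_poly to_fract p) y = 0" by (simp add: poly_sum poly_monom y)
  moreover have "to_fract = (\<lambda>a. Fraction_Field.Fract a 1 :: 'b fract)" by (simp add: fun_eq_iff to_fract_def)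
  ultimately obtain k where "y = Fraction_Field.Fract k 1"
    using normal lead unfolding normal_domain_def by metis
  then have "to_fract c = to_fract (z * k)" using z by (simp add: y_def field_simps flip: to_fract_def)
  then show ?thesis unfolding to_fract_eq_iff by simp
qed

context graded_domain
begin

text \<open>A maximal proper conductor ideal (z : c h) is prime; normality forces it to have height one,
  because a stable nonzero subset would make the fraction c h / z almost integral.\<close>

lemma dvd_of_height_one_primes:
  assumes noeth: "noetherian (UNIV :: 'b set)" and normal: "normal_domain TYPE('b)"
    and z: "z \<in> G i" "z \<noteq> 0" and c: "c \<in> G j"
    and loc: "\<And>P. homogeneous_ideal G P \<Longrightarrow> is_prime_ideal P \<Longrightarrow> height_one P \<Longrightarrow> \<exists>w. w \<notin> P \<and> z dvd w * c"
  shows "z dvd c"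
proof (rule ccontr)
  assume nd: "\<not> z dvd c"
  define cond where "cond c = {w. z dvd w * c}" for c
  have idc: "is_ideal (cond c)" for c
    by (auto simp: is_ideal_def cond_def distrib_right mult.assoc)
  define X where "X = {cond (c * h) | h k. h \<in> G k \<and> \<not> z dvd c * h}"
  have "cond (c * 1) \<in> X" unfolding X_def using nd
    by (intro CollectI exI[of _ 1] exI[of _ 0]) simp
  then have "\<exists>M\<in>X. \<forall>I\<in>X. M \<subseteq> I \<longrightarrow> I = M"
    by (rule noetherian_maximal[OF noeth]) (use idc in \<open>auto simp: X_def\<close>)
  then obtain h k where h: "h \<in> G k" "\<not> z dvd c * h"
    and maxi: "\<And>I. I \<in> X \<Longrightarrow> cond (c * h) \<subseteq> I \<Longrightarrow> I = cond (c * h)"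
  proof (elim bexE)
    fix M assume M: "M \<in> X" "\<forall>I\<in>X. M \<subseteq> I \<longrightarrow> I = M"
    obtain h k where h: "M = cond (c * h)" "h \<in> G k" "\<not> z dvd c * h" using M(1) unfolding X_def by blast
    show thesis by (rule that[OF h(2,3)]) (use M(2) h(1) in blast)
  qed
  define c' where "c' = c * h"
  define P where "P = cond c'"
  have c': "c' \<in> G (j + k)" unfolding c'_def by (intro mult_in c h)
  have P_iff: "w \<in> P \<longleftrightarrow> z dvd w * c'" for w by (simp add: P_def cond_def)
  have idP: "is_ideal P" unfolding P_def by (rule idc)
  have hP: "hc w l \<in> P" if w: "w \<in> P" for w l
  proof -
    obtain v where v: "w * c' = z * v" using w by (auto simp: P_iff dvd_def)
    have "hc (w * c') (l + (j + k)) = hc w l * c'" by (simp add: hcomp_mult_right[OF c'])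
    moreover have "hc (w * c') (l + (j + k)) = z * hc v (l + (j + k) - i)"
      unfolding v by (rule hcomp_mult_left[OF z(1)])
    ultimately show ?thesis unfolding P_iff by (metis dvd_triv_left)
  qed
  then have homP: "homogeneous_ideal G P" using idP by (simp add: homogeneous_ideal_def)
  \<comment> \<open>For homogeneous a outside P, the conductor belonging to c * h * a is again in
    \<open>X\<close> and contains P, so by maximality it equals P.\<close>
  have prime_hom: "b \<in> P" if a: "a \<in> G l" "a \<notin> P" and ab: "a * b \<in> P" for a b l
  proof -
    have "\<not> z dvd c * (h * a)" using a(2) by (simp add: P_iff c'_def mult_ac)
    then have "cond (c * (h * a)) \<in> X" unfolding X_def using mult_in[OF h(1) a(1)] by blast
    moreover have "cond (c * h) \<subseteq> cond (c * (h * a))"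
      by (auto simp: cond_def mult.assoc[symmetric])
    ultimately have "cond (c * (h * a)) = P" using maxi by (simp add: P_def c'_def)
    moreover have "b \<in> cond (c * (h * a))" using ab by (simp add: cond_def P_iff c'_def mult_ac)
    ultimately show ?thesis by simp
  qed
  have Psum: "sum f I \<in> P" if "\<And>i. i \<in> I \<Longrightarrow> f i \<in> P" for f and I :: "int set"
    using that idP by (induction I rule: infinite_finite_induct) (auto simp: is_ideal_def)
  have Pmult: "x * y \<in> P" "y * x \<in> P" if "y \<in> P" for x y
    using that idP by (auto simp: is_ideal_def mult.commute)
  have Pdiff: "x - y \<in> P" if "x \<in> P" "y \<in> P" for x y
    using that by (simp add: P_iff left_diff_distrib)
  \<comment> \<open>Primality for arbitrary factors reduces to their highest components outside P:
    in the degree of the product of these two, all other contributions lie in P.\<close>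
  have top: "\<exists>l. hc x l \<notin> P \<and> (\<forall>k>l. hc x k \<in> P)" if "x \<notin> P" for x
  proof -
    define T where "T = {l \<in> supp x. hc x l \<notin> P}"
    have fT: "finite T" by (simp add: T_def)
    have "T \<noteq> {}"
    proof
      assume "T = {}"
      then have "sum (hc x) (supp x) \<in> P" by (intro Psum) (auto simp: T_def)
      then show False using that by (simp add: sum_supp)
    qed
    then have "Max T \<in> T" using fT by simp
    moreover have "hc x k \<in> P" if "k > Max T" for k
    proof (rule ccontr)
      assume a: "hc x k \<notin> P"
      moreover have "0 \<in> P" using idP by (simp add: is_ideal_def)
      ultimately have "hc x k \<noteq> 0" by metis
      then have "k \<in> T" using a by (simp add: T_def supp_def)
      then have "k \<le> Max T" by (rule Max_ge[OF fT])
      then show False using that by simp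
    qed
    ultimately show ?thesis unfolding T_def by blast
  qed
  have "1 \<notin> P" using h by (simp add: P_iff c'_def)
  have primeP: "is_prime_ideal P" unfolding is_prime_ideal_def
  proof (intro conjI allI impI)
    fix a b assume ab: "a * b \<in> P"
    show "a \<in> P \<or> b \<in> P"
    proof (rule ccontr)
      assume n: "\<not> (a \<in> P \<or> b \<in> P)"
      obtain l where l: "hc a l \<notin> P" "\<And>k. k > l \<Longrightarrow> hc a k \<in> P" using top[of a] n by blast
      obtain m where m: "hc b m \<notin> P" "\<And>k. k > m \<Longrightarrow> hc b k \<in> P" using top[of b] n by blast
      have "l \<in> supp a" using l(1) idP by (auto simp: supp_def is_ideal_def)
      then have "hc (a * b) (l + m) = hc a l * hc b m + (\<Sum>k\<in>supp a - {l}. hc a k * hc b (l + m - k))"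
        unfolding hcomp_mult by (subst sum.remove[of _ l]) auto
      then have "hc a l * hc b m = hc (a * b) (l + m) - (\<Sum>k\<in>supp a - {l}. hc a k * hc b (l + m - k))" by simp
      also have "\<dots> \<in> P"
      proof (intro Pdiff hP[OF ab] Psum)
        fix k assume "k \<in> supp a - {l}"
        then have "k > l \<or> l + m - k > m" by auto
        then show "hc a k * hc b (l + m - k) \<in> P" using l(2)[of k] m(2)[of "l + m - k"] Pmult by blast
      qed
      finally show False using prime_hom[OF hcomp_in l(1)] m(1) by blast
    qed
  qed (use idP \<open>1 \<notin> P\<close> in auto)
  have zP: "z \<in> P" by (simp add: P_iff)
  have quot: "\<exists>v. c' * p = z * v" if "p \<in> P" for p using that by (auto simp: P_iff dvd_def mult.commute)
  \<comment> \<open>If c' / z mapped P into itself, then z would divide c'. So c' / z sends some p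
    in P to an element w outside P.\<close>
  have "\<exists>p\<in>P. \<exists>w. w \<notin> P \<and> z * w = c' * p"
  proof (rule ccontr)
    assume *: "\<not> ?thesis"
    have "z dvd c'"
    proof (rule dvd_of_stable_set[OF noeth normal z(2) zP z(2)])
      fix r assume r: "r \<in> P"
      then obtain v where "c' * r = z * v" using quot by blast
      then show "\<exists>r'\<in>P. z * r' = c' * r" using * r by metis
    qed
    then show False using h by (simp add: c'_def)
  qed
  then obtain p w where pw: "p \<in> P" "w \<notin> P" "z * w = c' * p" by blast
  have "\<not> (\<exists>Q. is_prime_ideal Q \<and> {0} \<subset> Q \<and> Q \<subset> P)"
  proof
    assume "\<exists>Q. is_prime_ideal Q \<and> {0} \<subset> Q \<and> Q \<subset> P"
    then obtain Q where Q: "is_prime_ideal Q" "{0} \<subset> Q" "Q \<subset> P" by blast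
    have Qm: "x * y \<in> Q" if "y \<in> Q" for x y using that Q by (auto simp: is_prime_ideal_def is_ideal_def)
    have Qp: "x \<in> Q \<or> y \<in> Q" if "x * y \<in> Q" for x y using that Q by (auto simp: is_prime_ideal_def)
    \<comment> \<open>With v = (c' / z) * r this shows that p generates P once w is inverted: P is
      locally principal.\<close>
    have wv: "w * r = p * v" if "c' * r = z * v" for r v
    proof -
      have "z * (w * r) = p * (c' * r)" using pw(3) by (metis mult.assoc mult.left_commute)
      also have "\<dots> = z * (p * v)" by (simp add: that mult_ac)
      finally show ?thesis using z(2) by simp
    qed
    \<comment> \<open>If p is in Q, then so is w * r for every r in P, which gives P = Q. Otherwise
      p * v in Q implies v in Q, so Q is stable under c' / z and z divides c'.\<close>
    show False
    proof (cases "p \<in> Q")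
      case True
      have "r \<in> Q" if r: "r \<in> P" for r
      proof -
        obtain v where "c' * r = z * v" using quot[OF r] by blast
        then have "w * r \<in> Q" using wv[of r v] Qm[OF True, of v] by (simp add: mult.commute)
        then show ?thesis using Qp pw(2) Q(3) by blast
      qed
      then show False using Q(3) by blast
    next
      case False
      obtain q where q: "q \<in> Q" "q \<noteq> 0" using Q(2) by blast
      have "z dvd c'"
      proof (rule dvd_of_stable_set[OF noeth normal z(2) q])
        fix r assume r: "r \<in> Q"
        then obtain v where v: "c' * r = z * v" using quot Q(3) by blast
        then have "p * v \<in> Q" using wv[OF v] Qm[OF r, of w] by simp
        then have "v \<in> Q" using Qp False by blast
        then show "\<exists>r'\<in>Q. z * r' = c' * r" using v by metis
      qed
      then show False using h by (simp add: c'_def)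
    qed
  qed
  moreover have "P \<noteq> {0}" using zP z(2) by auto
  ultimately have "height_one P" using primeP by (simp add: height_one_def)
  then obtain u where u: "u \<notin> P" "z dvd u * c" using loc[OF homP primeP] by blast
  then have "u \<in> P" by (simp add: P_iff c'_def mult.assoc[symmetric])
  then show False using u by blast
qed

end

section \<open>Extending derivations\<close>

text \<open>Modulo d the semigroup is a group, because (d - 1) * s is congruent to -s. Hence E + d *
  Z is a subgroup of the integers; it contains the gcd of E and therefore -i.\<close>

lemma semigroup_meets_residue_class:
  fixes E :: "int set"
  assumes E: "0 \<in> E" "\<And>x y. x \<in> E \<Longrightarrow> y \<in> E \<Longrightarrow> x + y \<in> E" and i: "Gcd E dvd i" and d: "d > 0"
  shows "\<exists>j\<in>E. int d dvd i + j"
proof -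
  define H where "H = {j. \<exists>s\<in>E. int d dvd s - j}"
  have H: "j \<in> H" if "s \<in> E" "int d dvd s - j" for s j using that by (auto simp: H_def)
  have H0: "0 \<in> H" by (rule H[of 0]) (use E in auto)
  have Hadd: "x + y \<in> H" if x: "x \<in> H" and y: "y \<in> H" for x y
  proof -
    obtain s t where st: "s \<in> E" "int d dvd s - x" "t \<in> E" "int d dvd t - y"
      using x y unfolding H_def by blast
    have "int d dvd (s - x) + (t - y)" using st by (intro dvd_add)
    then show ?thesis by (intro H[of "s + t"] E st) (simp add: algebra_simps)
  qed
  have Hneg: "- x \<in> H" if x: "x \<in> H" for x
  proof -
    obtain s where s: "s \<in> E" "int d dvd s - x" using x unfolding H_def by blast
    have mult: "int n * s \<in> E" for n by (induction n) (use E s in \<open>auto simp: algebra_simps\<close>)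
    have "int (d - 1) * s - (- x) = int d * s - (s - x)" using d by (simp add: algebra_simps of_nat_diff)
    then have "int d dvd int (d - 1) * s - (- x)" using dvd_diff[OF dvd_triv_left s(2)] by metis
    then show ?thesis by (rule H[OF mult])
  qed
  have Hmult: "n * z \<in> H" if "z \<in> H" for n z
    by (rule int_subgroup_mult) (use H0 Hadd Hneg that in auto)
  have EH: "E \<subseteq> H" using H by auto
  have "Gcd E \<in> H"
  proof (cases "\<exists>n>0. int n \<in> H")
    case True
    define g where "g = (LEAST n. n > 0 \<and> int n \<in> H)"
    have g: "g > 0" "int g \<in> H" using LeastI_ex[OF True] by (auto simp: g_def)
    have "int g dvd x" if "x \<in> H" for x
    proof (rule ccontr)
      assume "\<not> int g dvd x"
      then have r: "x mod int g > 0" "x mod int g < int g"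
        using g by (auto simp: dvd_eq_mod_eq_0 pos_mod_bound intro: le_neq_trans[OF pos_mod_sign])
      have "x mod int g = x + - (x div int g * int g)" by (simp add: minus_div_mult_eq_mod)
      also have "\<dots> \<in> H" by (intro Hadd Hneg Hmult that g)
      finally have "int (nat (x mod int g)) \<in> H" using r by simp
      moreover have "nat (x mod int g) < g" "nat (x mod int g) > 0" using r by auto
      ultimately show False using not_less_Least unfolding g_def by blast
    qed
    then have "int g dvd Gcd E" using EH by (intro Gcd_greatest) auto
    then show ?thesis using Hmult[OF g(2)] by (metis dvd_div_mult_self)
  next
    case False
    have "x = 0" if "x \<in> E" for x
    proof (rule ccontr)
      assume "x \<noteq> 0"
      have "x \<in> H" "- x \<in> H" using EH Hneg that by auto
      then have "int (nat \<bar>x\<bar>) \<in> H" by (cases "x \<ge> 0") auto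
      then show False using False \<open>x \<noteq> 0\<close> by (metis zero_less_abs_iff zero_less_nat_eq)
    qed
    then have "E \<subseteq> {0}" by auto
    then have "Gcd E = 0" by simp
    then show ?thesis using H0 by metis
  qed
  then have "- i \<in> H" using i Hmult Hneg by (metis dvd_div_mult_self)
  then show ?thesis by (auto simp: H_def add.commute)
qed

context homogeneous_lnd
begin

text \<open>A derivation extending D must send x to D(x^d) / (d * x^(d - 1)). That this value lies
  in the ring is a divisibility between homogeneous elements, so it may be tested at homogeneous
  primes of height one.\<close>

lemma homogeneous_derivative_of_power_dvd:
  assumes noeth: "noetherian (UNIV :: 'b set)" and normal: "normal_domain TYPE('b)"
    and sat: "saturated_codim1 G" and x: "x \<in> G i" "x \<noteq> 0"
  shows "of_nat d * x ^ (d - 1) dvd D (x ^ d)"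
proof (rule dvd_of_height_one_primes[OF noeth normal])
  have pV: "y ^ d \<in> V d" if "y \<in> G k" for y k
    by (rule veronese_homogeneous[OF power_in[OF that]]) simp
  have pd: "y ^ d = y ^ (d - 1) * y" for y :: 'b using d_pos by (cases d) (simp_all add: mult.commute)
  show "of_nat d * x ^ (d - 1) \<in> G (0 + int (d - 1) * i)" by (intro mult_in of_nat_in power_in x)
  show "of_nat d * x ^ (d - 1) \<noteq> 0" using x of_nat_neq_0[OF d_pos] by simp
  show "D (x ^ d) \<in> G (int d * i + N)" by (intro D_degree pV[OF x(1)] power_in x)
  fix P assume P: "homogeneous_ideal G P" "is_prime_ideal P" "height_one P"
  define E where "E = {i. \<not> G i \<subseteq> P}"
  have prime: "a \<in> P \<or> b \<in> P" if "a * b \<in> P" for a b using that P(2) by (auto simp: is_prime_ideal_def)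
  have "1 \<notin> P"
  proof
    assume "1 \<in> P"
    then have "b * 1 \<in> P" for b using P(2) unfolding is_prime_ideal_def is_ideal_def by blast
    then show False using P(2) by (auto simp: is_prime_ideal_def)
  qed
  then have E0: "0 \<in> E" using subsetD[OF _ one_in, of P] by (auto simp: E_def)
  have E_add: "k + l \<in> E" if kl: "k \<in> E" "l \<in> E" for k l
  proof -
    obtain a b where "a \<in> G k" "a \<notin> P" "b \<in> G l" "b \<notin> P" using kl unfolding E_def by blast
    then have "a * b \<in> G (k + l)" "a * b \<notin> P" using mult_in prime by blast+
    then show ?thesis unfolding E_def by blast
  qed
  have "Gcd E = sat_index G"
    using sat P unfolding saturated_codim1_def sat_index_quot_def E_def by blast
  moreover have "sat_index G dvd i" unfolding sat_index_def using x by (intro Gcd_dvd) auto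
  \<comment> \<open>The degrees of elements outside the prime P form a semigroup \<open>E\<close>.
    By saturation its gcd is that of the whole grading, which divides i, so some j in
    \<open>E\<close> completes i to a multiple of d.\<close>
  ultimately obtain j where j: "j \<in> E" "int d dvd i + j"
    using semigroup_meets_residue_class[OF E0 E_add _ d_pos, of i] by auto
  then obtain u where u: "u \<in> G j" "u \<notin> P" unfolding E_def by blast
  define r where "r = x * u"
  have r: "r \<in> V d" unfolding r_def by (rule veronese_homogeneous[OF mult_in[OF x(1) u(1)] j(2)])
  obtain q where q: "of_nat d * q = (1 :: 'b)" using of_nat_invertible[OF d_pos] by blast
  \<comment> \<open>D((x * u)^d) is computed in two ways, as the derivative of a d-th power in
    \<open>V d\<close> and by the product rule. This isolates u^d * D(x^d); inserting d * q = 1 lets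
    the factor d be extracted from the other summand.\<close>
  have "of_nat d * r ^ (d - 1) * D r = D (x ^ d * u ^ d)"
    using D_power[OF r, of d] by (simp add: r_def power_mult_distrib)
  also have "\<dots> = x ^ d * D (u ^ d) + u ^ d * D (x ^ d)" by (rule D_mult[OF pV[OF x(1)] pV[OF u(1)]])
  finally have "u ^ d * D (x ^ d) = of_nat d * r ^ (d - 1) * D r - x ^ d * (of_nat d * q) * D (u ^ d)"
    by (simp add: q)
  also have "\<dots> = (of_nat d * x ^ (d - 1)) * (u ^ (d - 1) * D r - x * q * D (u ^ d))"
    unfolding pd[of x] by (simp add: r_def power_mult_distrib algebra_simps)
  finally have "of_nat d * x ^ (d - 1) dvd u ^ d * D (x ^ d)" by simp
  moreover have "u ^ n \<notin> P" for n by (induction n) (use \<open>1 \<notin> P\<close> u prime in auto)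
  ultimately show "\<exists>w. w \<notin> P \<and> of_nat d * x ^ (d - 1) dvd w * D (x ^ d)" by blast
qed

text \<open>The extension of D to the whole ring is forced to be x \<mapsto> D(x^d) / (d x^(d-1)) on homogeneous
  elements. It is locally nilpotent because it lowers the D-degree of x^d by d.\<close>

lemma nonrigid_extension:
  assumes noeth: "noetherian (UNIV :: 'b set)" and normal: "normal_domain TYPE('b)"
    and sat: "saturated_codim1 G" and ne: "\<exists>i x. int d dvd i \<and> x \<in> G i \<and> D x \<noteq> 0"
  shows "\<not> rigid (UNIV :: 'b set)"
proof -
  have pV: "y ^ d \<in> V d" if "y \<in> G k" for y k
    by (rule veronese_homogeneous[OF power_in[OF that]]) simp
  have pd: "y ^ d = y ^ (d - 1) * y" for y :: 'b using d_pos by (cases d) (simp_all add: mult.commute)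
  have d0: "(of_nat d :: 'b) \<noteq> 0" using of_nat_neq_0[OF d_pos] .
  define \<delta> where "\<delta> x = (if x = 0 then 0 else THE b. of_nat d * x ^ (d - 1) * b = D (x ^ d))" for x
  have \<delta>I: "\<delta> x = b" if "x \<noteq> 0" "of_nat d * x ^ (d - 1) * b = D (x ^ d)" for x b
  proof -
    have "(THE b. of_nat d * x ^ (d - 1) * b = D (x ^ d)) = b"
    proof (rule the_equality)
      fix b' assume "of_nat d * x ^ (d - 1) * b' = D (x ^ d)"
      then have "of_nat d * x ^ (d - 1) * b' = of_nat d * x ^ (d - 1) * b" using that(2) by simp
      then show "b' = b" using that(1) d0 by simp
    qed (fact that(2))
    then show ?thesis using that(1) by (simp add: \<delta>_def)
  qed
  have \<delta>: "\<delta> x \<in> G (i + N) \<and> of_nat d * x ^ (d - 1) * \<delta> x = D (x ^ d)" if x: "x \<in> G i" for x i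
  proof (cases "x = 0")
    case True
    then show ?thesis using d_pos by (simp add: \<delta>_def power_0_left)
  next
    case False
    define z where "z = of_nat d * x ^ (d - 1)"
    have z: "z \<in> G (0 + int (d - 1) * i)" unfolding z_def by (intro mult_in of_nat_in power_in x)
    obtain b where b: "D (x ^ d) = z * b"
      using homogeneous_derivative_of_power_dvd[OF noeth normal sat x False] by (auto simp: z_def dvd_def)
    have "D (x ^ d) \<in> G (int d * i + N)" by (intro D_degree pV[OF x] power_in x)
    \<comment> \<open>The quotient b is replaced by its component of degree i + N, which makes the
      value of \<delta> homogeneous.\<close>
    then have "D (x ^ d) = hc (D (x ^ d)) (int d * i + N)" by (simp add: hcomp_of_homogeneous)
    also have "\<dots> = z * hc b (int d * i + N - (0 + int (d - 1) * i))"
      unfolding b by (rule hcomp_mult_left[OF z])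
    also have "int d * i + N - (0 + int (d - 1) * i) = i + N"
      using d_pos by (simp add: algebra_simps of_nat_diff)
    finally have "of_nat d * x ^ (d - 1) * hc b (i + N) = D (x ^ d)" by (simp add: z_def)
    moreover from this have "\<delta> x = hc b (i + N)" by (rule \<delta>I[OF False])
    ultimately show ?thesis by simp
  qed
  have \<delta>_mult: "\<delta> (x * y) = x * \<delta> y + y * \<delta> x" if x: "x \<in> G i" and y: "y \<in> G j" for x y i j
  proof (cases "x = 0 \<or> y = 0")
    case True
    then show ?thesis by (auto simp: \<delta>_def)
  next
    case False
    have "of_nat d * (x * y) ^ (d - 1) * (x * \<delta> y + y * \<delta> x)
      = x ^ d * (of_nat d * y ^ (d - 1) * \<delta> y) + y ^ d * (of_nat d * x ^ (d - 1) * \<delta> x)"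
      unfolding pd[of x] pd[of y] by (simp add: power_mult_distrib algebra_simps)
    also have "\<dots> = D ((x * y) ^ d)"
      using D_mult[OF pV[OF x] pV[OF y]] \<delta>[OF x] \<delta>[OF y] by (simp add: power_mult_distrib)
    finally show ?thesis using \<delta>I False by simp
  qed
  have \<delta>_D: "\<delta> x = D x" if "x \<in> V d" "x \<in> G i" for x i
  proof (cases "x = 0")
    case False
    then show ?thesis by (rule \<delta>I) (simp add: D_power that)
  qed (simp add: \<delta>_def)
  \<comment> \<open>The formula with d-th powers hides additivity. Multiplication by x^(d - 1)
    carries x, y and x + y into \<open>V d\<close>, where \<delta> agrees with D; by the product
    rule the factor can then be cancelled.\<close>
  have \<delta>_add: "\<delta> (x + y) = \<delta> x + \<delta> y" if x: "x \<in> G i" and y: "y \<in> G i" for x y i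
  proof (cases "x = 0")
    case False
    define v where "v = x ^ (d - 1)"
    have v: "v \<in> G (int (d - 1) * i)" unfolding v_def by (rule power_in[OF x])
    have v0: "v \<noteq> 0" using False by (simp add: v_def)
    have deg: "int (d - 1) * i + i = int d * i" using d_pos by (simp add: algebra_simps of_nat_diff)
    have vw: "v * w \<in> V d" "v * w \<in> G (int d * i)" if "w \<in> G i" for w
      using mult_in[OF v that] unfolding deg by (auto intro: veronese_homogeneous)
    have "\<delta> (v * (x + y)) = \<delta> (v * x) + \<delta> (v * y)"
      using vw[OF x] vw[OF y] vw[OF add_in[OF x y]] \<delta>_D D_add[of "v * x" "v * y"]
      by (simp add: distrib_left)
    then have "v * \<delta> (x + y) = v * (\<delta> x + \<delta> y)"
      unfolding \<delta>_mult[OF v x] \<delta>_mult[OF v y] \<delta>_mult[OF v add_in[OF x y]] by (simp add: algebra_simps)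
    then show ?thesis using v0 by simp
  qed (simp add: \<delta>_def)
  have \<delta>_nil: "\<exists>n. (\<delta> ^^ n) x = 0" if "x \<in> G i" for x i
    using that
  proof (induction "dg (x ^ d)" arbitrary: x i rule: less_induct)
    case less
    note x = less.prems
    show ?case
    proof (cases "\<delta> x = 0")
      case True
      then show ?thesis by (intro exI[of _ 1]) simp
    next
      case False
      then have x0: "x \<noteq> 0" by (auto simp: \<delta>_def)
      have \<delta>x: "\<delta> x \<in> G (i + N)" and eq: "of_nat d * x ^ (d - 1) * \<delta> x = D (x ^ d)"
        using \<delta>[OF x] by auto
      have nz: "x ^ d \<noteq> 0" "\<delta> x ^ d \<noteq> 0" "D (x ^ d) \<noteq> 0"
        using x0 False d0 by (auto simp: eq[symmetric])
      \<comment> \<open>\<delta> x need not lie in \<open>V d\<close>, so the defining equation is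
        raised to the power d before D-degrees are compared. Applying D lowers the D-degree of x^d
        by 1, so the left side loses d, and this loss falls entirely on
        \<open>\<delta> x ^ d\<close>.\<close>
      have "D (x ^ d) ^ d = of_nat d ^ d * ((x ^ d) ^ (d - 1) * \<delta> x ^ d)"
        unfolding eq[symmetric] by (simp add: power_mult_distrib mult.assoc flip: power_mult) (simp add: mult.commute)
      moreover have "dg (D (x ^ d) ^ d) = d * dg (D (x ^ d))"
        using dg_power[OF D_in[OF pV[OF x]] nz(3)] .
      moreover have "dg (of_nat d ^ d * ((x ^ d) ^ (d - 1) * \<delta> x ^ d)) = (d - 1) * dg (x ^ d) + dg (\<delta> x ^ d)"
      proof -
        have "dg (of_nat d ^ d) = 0" using dg_power[OF S_of_nat d0, of d] dg_eq_0_iff[OF S_of_nat, of d] by simp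
        then show ?thesis
          using nz d0 pV[OF x] pV[OF \<delta>x] by (simp add: dg_mult dg_power S_power S_mult S_of_nat)
      qed
      moreover have "dg (x ^ d) = Suc (dg (D (x ^ d)))" by (rule dg_D[OF pV[OF x] nz(3)])
      ultimately have "(d - 1) * dg (x ^ d) + dg (\<delta> x ^ d) + d = d * dg (x ^ d)"
        by simp
      moreover have "d * dg (x ^ d) = (d - 1) * dg (x ^ d) + dg (x ^ d)"
        using d_pos by (cases d) auto
      ultimately have "dg (\<delta> x ^ d) < dg (x ^ d)" using d_pos by linarith
      then obtain n where "(\<delta> ^^ n) (\<delta> x) = 0" using less.hyps \<delta>x by blast
      then have "(\<delta> ^^ Suc n) x = 0" by (simp only: funpow_Suc_right o_apply)
      then show ?thesis by blast
    qed
  qed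
  obtain D' where D': "lnd_on (V (Suc 0)) D'" "\<And>i x. int (Suc 0) dvd i \<Longrightarrow> x \<in> G i \<Longrightarrow> D' x = \<delta> x"
  proof (rule lnd_of_homogeneous_pieces[of "Suc 0" \<delta> N])
    fix D assume *: "lnd_on (V (Suc 0)) D" "\<And>i x. int (Suc 0) dvd i \<Longrightarrow> x \<in> G i \<Longrightarrow> D x = \<delta> x"
    show thesis by (rule that[OF *])
  qed (use \<delta> \<delta>_add \<delta>_mult \<delta>_nil in \<open>auto simp: veronese_Suc_0\<close>)
  obtain i x where x: "int d dvd i" "x \<in> G i" "D x \<noteq> 0" using ne by blast
  then have "D' x \<noteq> 0" using D'(2)[of i x] \<delta>_D[OF veronese_homogeneous[OF x(2,1)] x(2)] by simp
  then show ?thesis using D'(1) unfolding rigid_def veronese_Suc_0 by blast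
qed

end

theorem theorem1p2:
  fixes G :: "int \<Rightarrow> 'b::idom set"
  assumes grad: "grading G"
    and fg: "fg_algebra_over_char0_field TYPE('b)"
    and cond: "trdeg_ge2 G \<or> (\<exists>i j. i < 0 \<and> 0 < j \<and> G i \<noteq> {0} \<and> G j \<noteq> {0})"
  shows "((\<exists>d::nat. d \<ge> 1 \<and> \<not> rigid (veronese G d)) \<longleftrightarrow> (\<exists>f. cylindrical G f))
       \<and> (normal_domain TYPE('b) \<and> saturated_codim1 G \<longrightarrow>
            ((\<exists>d::nat. d \<ge> 1 \<and> \<not> rigid (veronese G d)) \<longleftrightarrow> \<not> rigid (UNIV :: 'b set)))"
proof -
  interpret graded_domain G by unfold_locales (fact grad)
  have hom: "\<exists>D N. homogeneous_lnd G d D N \<and> (\<exists>i x. int d dvd i \<and> x \<in> G i \<and> D x \<noteq> 0)"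
    if d: "d \<ge> 1" "\<not> rigid (veronese G d)" for d
  proof -
    obtain D N where D: "lnd (V d) D" "\<And>i x. int d dvd i \<Longrightarrow> x \<in> G i \<Longrightarrow> D x \<in> G (i + N)"
      "\<exists>i x. int d dvd i \<and> x \<in> G i \<and> D x \<noteq> 0"
      using exists_homogeneous_lnd[OF fg _ d(2)] d(1) by (metis less_eq_Suc_le One_nat_def)
    have "homogeneous_lnd G d D N"
      unfolding homogeneous_lnd_def homogeneous_lnd_axioms_def
      using D(1,2) d(1) graded_domain_axioms by auto
    then show ?thesis using D(3) by blast
  qed
  have ab: "\<exists>f. cylindrical G f" if "d \<ge> 1" "\<not> rigid (veronese G d)" for d
    using hom[OF that] homogeneous_lnd.exists_cylindrical[OF _ _ cond] by blast
  have ac: "\<not> rigid (UNIV :: 'b set)"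
    if "normal_domain TYPE('b)" "saturated_codim1 G" "d \<ge> 1" "\<not> rigid (veronese G d)" for d
    using hom[OF that(3,4)] homogeneous_lnd.nonrigid_extension[OF _ noetherian_of_fg_algebra[OF fg] that(1,2)]
    by blast
  have ca: "\<exists>d\<ge>1. \<not> rigid (veronese G d)" if "\<not> rigid (UNIV :: 'b set)"
    using that by (intro exI[of _ 1]) (simp add: veronese_Suc_0)
  show ?thesis
    using ab ac ca cylindrical_imp_nonrigid_veronese[OF fg] by blast
qed

end
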